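(* For each $N\ge1$ let $X_1,X_2,\dots$ be independent, identically distributed random real $N\times N$ matrices, let $\Pi_n=X_n\cdots X_1$, and let $v\in\mathbb R^N$ be an arbitrary unit vector. (i) Suppose that, for each $N$, all $X_i$ are Gaussian with independent entries distributed as $\mathcal N(0,\sigma^2/N)$, where $\sigma>0$ does not depend on $N$. Then for all sufficiently small $t>0$ there is $N_1(t)$ such that for all $N\ge N_1(t)$ and all $n\ge1$, $$\Pr\left\{\left|\frac1n\log\|\Pi_nv\|-\log\sigma\right|>t\right\}\le 2\exp\left(-\frac18Nnt^2\right).$$ (ii) Suppose that, for each $N$, the matrices $X_i$ are rotationally invariant and there is a constant $b$, not depending on $N$, such that with probability 1, $\max_k s_k^{(i,N)}\le b\,\overline{s}^{(i,N)}$, where $s_1^{(i,N)},\dots,s_N^{(i,N)}$ are the eigenvalues of $X_i^*X_i$ and $$\overline{s}^{(i,N)}=\frac1N\sum_{k=1}^N s_k^{(i,N)}=\frac1N\operatorname{Tr}(X_i^*X_i),$$ with $\overline{s}^{(i,N)}>0$ almost surely. Then for all $t\in(0,1/4)$ there is $N_1(t)$ such that for all $N\ge N_1(t)$ and all $n\ge1$, $$\Pr\left\{\left|\frac1n\log\|\Pi_nv\|^2-\frac1n\sum_{i=1}^n\log\overline{s}^{(i,N)}\right|>t\right\}\le2\exp\left(-\frac1{32b^2}Nnt^2\right).$$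
   Context: $\|\cdot\|$ is the Euclidean norm. A random $N\times N$ matrix $X$ is called rotationally invariant if for every integer $k\ge1$, every collection of vectors $\{v_i,w_i\}_{i=1}^k$ and every orthogonal matrix $U$, the joint distributions of $\{\langle w_i,Xv_i\rangle\}_{i=1}^k$ and $\{\langle Uw_i,XUv_i\rangle\}_{i=1}^k$ are the same. *)

theory Defs
  imports
    "HOL-Probability.Probability"
    "Jordan_Normal_Form.Schur_Decomposition"
    "HOL-Computational_Algebra.Fundamental_Theorem_Algebra"
begin

(* The dimension N is quantified inside the statement, so vectors and matrices are those of
   Jordan_Normal_Form, with carriers carrier_vec N and carrier_mat N N. *)

definition eucl_norm :: "real Matrix.vec \<Rightarrow> real" where
  "eucl_norm v = sqrt (scalar_prod v v)"

definition orthogonal_matrix_dim :: "nat \<Rightarrow> real mat \<Rightarrow> bool" where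
  "orthogonal_matrix_dim N U \<longleftrightarrow> U \<in> carrier_mat N N \<and> transpose_mat U * U = 1\<^sub>m N"

definition mat_trace :: "'a::comm_monoid_add mat \<Rightarrow> 'a" where
  "mat_trace A = (\<Sum>i<dim_row A. A $$ (i, i))"

(* The Borel sigma-algebra on N x N matrices: the one pulled back from the product of the
   N^2 copies of the real line along the entry map. *)
definition mat_borel :: "nat \<Rightarrow> real mat measure" where
  "mat_borel N = vimage_algebra (carrier_mat N N)
     (\<lambda>A. \<lambda>p\<in>{..<N} \<times> {..<N}. A $$ p) (\<Pi>\<^sub>M p\<in>{..<N} \<times> {..<N}. borel)"

definition iid_matrices :: "'a measure \<Rightarrow> nat \<Rightarrow> (nat \<Rightarrow> 'a \<Rightarrow> real mat) \<Rightarrow> bool" where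
  "iid_matrices M N X \<longleftrightarrow>
     (\<forall>i\<ge>1. X i \<in> measurable M (mat_borel N)) \<and>
     prob_space.indep_vars M (\<lambda>_. mat_borel N) X {1..} \<and>
     (\<forall>i\<ge>1. distr M (mat_borel N) (X i) = distr M (mat_borel N) (X 1))"

fun mat_product :: "nat \<Rightarrow> (nat \<Rightarrow> 'a \<Rightarrow> real mat) \<Rightarrow> nat \<Rightarrow> 'a \<Rightarrow> real mat" where
  "mat_product N X 0 \<omega> = 1\<^sub>m N"
| "mat_product N X (Suc n) \<omega> = X (Suc n) \<omega> * mat_product N X n \<omega>"

(* normal_density takes the standard deviation, so the variance below is \<sigma>^2 / N. *)
definition gaussian_matrix :: "'a measure \<Rightarrow> nat \<Rightarrow> real \<Rightarrow> ('a \<Rightarrow> real mat) \<Rightarrow> bool" where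
  "gaussian_matrix M N \<sigma> X \<longleftrightarrow>
     prob_space.indep_vars M (\<lambda>_. borel) (\<lambda>p \<omega>. X \<omega> $$ p) ({..<N} \<times> {..<N}) \<and>
     (\<forall>p\<in>{..<N} \<times> {..<N}.
        distributed M lborel (\<lambda>\<omega>. X \<omega> $$ p) (normal_density 0 (\<sigma> / sqrt (real N))))"

definition rotationally_invariant :: "'a measure \<Rightarrow> nat \<Rightarrow> ('a \<Rightarrow> real mat) \<Rightarrow> bool" where
  "rotationally_invariant M N X \<longleftrightarrow>
     (\<forall>k\<ge>1. \<forall>v w. \<forall>U.
        (\<forall>i<k. v i \<in> carrier_vec N \<and> w i \<in> carrier_vec N) \<longrightarrow> orthogonal_matrix_dim N U \<longrightarrow>
        distr M (\<Pi>\<^sub>M i\<in>{..<k::nat}. borel) (\<lambda>\<omega>. \<lambda>i\<in>{..<k}. scalar_prod (w i) (X \<omega> *\<^sub>v v i)) =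
        distr M (\<Pi>\<^sub>M i\<in>{..<k}. borel)
          (\<lambda>\<omega>. \<lambda>i\<in>{..<k}. scalar_prod (U *\<^sub>v w i) (X \<omega> *\<^sub>v (U *\<^sub>v v i))))"

(* The eigenvalues of the transpose of A times A, with algebraic multiplicity. *)
definition gram_eigenvalues :: "real mat \<Rightarrow> real multiset" where
  "gram_eigenvalues A = proots (char_poly (transpose_mat A * A))"

definition mean_gram_eigenvalue :: "real mat \<Rightarrow> real" where
  "mean_gram_eigenvalue A = (\<Sum>s\<in>#gram_eigenvalues A. s) / real (dim_col A)"

(* "The deviation of (1/n) log y from c exceeds t", for y \<ge> 0.  In HOL ln 0 = 0; mathematically
   log 0 is minus infinity and the deviation is infinite, hence the first disjunct. *)
definition log_deviates :: "real \<Rightarrow> nat \<Rightarrow> real \<Rightarrow> real \<Rightarrow> bool" where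
  "log_deviates y n c t \<longleftrightarrow> y = 0 \<or> \<bar>ln y / real n - c\<bar> > t"

lemma mat_trace_mult_commute:
  fixes A B :: "'a::comm_semiring_0 mat"
  assumes "A \<in> carrier_mat n n" "B \<in> carrier_mat n n"
  shows "mat_trace (A * B) = mat_trace (B * A)"
proof -
  have "mat_trace (A * B) = (\<Sum>i<n. \<Sum>j<n. A $$ (i,j) * B $$ (j,i))"
    using assms by (auto simp: mat_trace_def scalar_prod_def atLeast0LessThan intro!: sum.cong)
  also have "\<dots> = (\<Sum>j<n. \<Sum>i<n. A $$ (i,j) * B $$ (j,i))"
    by (rule sum.swap)
  also have "\<dots> = mat_trace (B * A)"
    using assms
    by (auto simp: mat_trace_def scalar_prod_def atLeast0LessThan mult.commute intro!: sum.cong)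
  finally show ?thesis .
qed

lemma symmetric_char_poly_splits:
  fixes A :: "real mat"
  assumes A: "A \<in> carrier_mat n n" and sym: "transpose_mat A = A"
  shows "\<exists>es. char_poly A = (\<Prod>e\<leftarrow>es. [:- e, 1:])"
proof -
  interpret of_real_poly: map_poly_inj_idom_hom "of_real :: real \<Rightarrow> complex" ..
  define C where "C = map_mat complex_of_real A"
  have C: "C \<in> carrier_mat n n" using A by (simp add: C_def)
  obtain as where as: "char_poly C = (\<Prod>a\<leftarrow>as. [:- a, 1:])"
    using char_poly_factorized[OF C] by auto
  have entry: "C $$ (i,j) = of_real (A $$ (i,j))" if "i < n" "j < n" for i j
    using A that by (simp add: C_def)
  have symA: "A $$ (i,j) = A $$ (j,i)" if "i < n" "j < n" for i j
    using A that by (metis carrier_matD index_transpose_mat(1) sym)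
  have real: "a = of_real (Re a)" if "a \<in> set as" for a
  proof -
    have "poly (char_poly C) a = 0"
      using that unfolding as poly_prod_list by (auto simp: prod_list_zero_iff intro!: image_eqI)
    then have "eigenvalue C a" using eigenvalue_root_char_poly[OF C] by simp
    then obtain v where v: "v \<in> carrier_vec n" "v \<noteq> 0\<^sub>v n" and ev: "C *\<^sub>v v = a \<cdot>\<^sub>v v"
      using C by (auto simp: eigenvalue_def eigenvector_def)
    define q where "q = (\<Sum>i<n. \<Sum>j<n. cnj (v $ i) * C $$ (i,j) * v $ j)"
    define s where "s = (\<Sum>i<n. (cmod (v $ i))\<^sup>2)"
    have row: "(\<Sum>j<n. C $$ (i,j) * v $ j) = a * v $ i" if "i < n" for i
    proof -
      have "(C *\<^sub>v v) $ i = (\<Sum>j<n. C $$ (i,j) * v $ j)"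
        using C v that by (auto simp: scalar_prod_def atLeast0LessThan intro!: sum.cong)
      then show ?thesis using v that by (simp add: ev)
    qed
    have "q = (\<Sum>i<n. cnj (v $ i) * (\<Sum>j<n. C $$ (i,j) * v $ j))"
      by (simp add: q_def sum_distrib_left mult.assoc)
    also have "\<dots> = (\<Sum>i<n. a * of_real ((cmod (v $ i))\<^sup>2))"
    proof (rule sum.cong)
      fix i assume "i \<in> {..<n}"
      then show "cnj (v $ i) * (\<Sum>j<n. C $$ (i,j) * v $ j) = a * of_real ((cmod (v $ i))\<^sup>2)"
        using row[of i] complex_norm_square[of "v $ i"] by (simp add: mult_ac)
    qed simp
    finally have q: "q = a * of_real s" by (simp add: s_def sum_distrib_left)
    have "cnj q = (\<Sum>i<n. \<Sum>j<n. v $ i * C $$ (i,j) * cnj (v $ j))"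
      by (auto simp: q_def entry intro!: sum.cong)
    also have "\<dots> = (\<Sum>j<n. \<Sum>i<n. v $ i * C $$ (i,j) * cnj (v $ j))"
      by (rule sum.swap)
    also have "\<dots> = q"
      unfolding q_def using entry symA by (intro sum.cong refl) (simp add: mult_ac)
    finally have "cnj q = q" .
    then have *: "cnj a * of_real s = a * of_real s" by (simp add: q)
    have "s \<noteq> 0"
    proof
      assume "s = 0"
      then have "\<forall>i\<in>{..<n}. (cmod (v $ i))\<^sup>2 = 0"
        unfolding s_def by (subst (asm) sum_nonneg_eq_0_iff) auto
      then have "v = 0\<^sub>v n" using v by (intro eq_vecI) auto
      with v show False by simp
    qed
    with * have "cnj a = a" by simp
    then show ?thesis by (simp add: complex_eq_iff)
  qed
  have "map_poly complex_of_real (char_poly A) = char_poly C"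
    unfolding C_def by (rule of_real_hom.char_poly_hom[OF A, symmetric])
  also have "\<dots> = (\<Prod>a\<leftarrow>as. [:- complex_of_real (Re a), 1:])"
    unfolding as using real by (intro arg_cong[where f = prod_list] map_cong) auto
  also have "\<dots> = map_poly complex_of_real (\<Prod>e\<leftarrow>map Re as. [:- e, 1:])"
    by (induction as) (simp_all add: of_real_poly.hom_mult del: mult_pCons_left)
  finally have "char_poly A = (\<Prod>e\<leftarrow>map Re as. [:- e, 1:])"
    by (simp only: of_real_poly.eq_iff)
  then show ?thesis by blast
qed

lemma proots_linear_factors: "proots (\<Prod>e\<leftarrow>es. [:- e, 1::real:]) = mset es"
proof (induction es)
  case (Cons e es)
  have "proots [:- e, 1:] = {#e#}" using proots_linear_factor[of e] by simp
  moreover have "(\<Prod>e\<leftarrow>es. [:- e, 1::real:]) \<noteq> 0" by (auto simp: prod_list_zero_iff)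
  ultimately show ?case using Cons by (simp add: proots_mult del: mult_pCons_left)
qed simp

lemma mean_gram_eigenvalue_eq_trace:
  assumes A: "A \<in> carrier_mat n n"
  shows "mean_gram_eigenvalue A = mat_trace (transpose_mat A * A) / real n"
proof -
  define G where "G = transpose_mat A * A"
  have G: "G \<in> carrier_mat n n" using A by (simp add: G_def)
  have "transpose_mat G = G"
    unfolding G_def using A by (subst transpose_mult[of _ n n _ n]) auto
  then obtain es where es: "char_poly G = (\<Prod>e\<leftarrow>es. [:- e, 1:])"
    using symmetric_char_poly_splits[OF G] by blast
  obtain B P Q where "schur_decomposition G es = (B, P, Q)" by (cases "schur_decomposition G es")
  from schur_decomposition[OF G es this]
  have wit: "similar_mat_wit G B P Q" and diag: "diag_mat B = es" by auto
  note w = similar_mat_witD2[OF G wit]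
  have "mat_trace G = mat_trace (P * (B * Q))" using w by (simp add: assoc_mult_mat[of _ n n])
  also have "\<dots> = mat_trace (B * Q * P)" using w by (intro mat_trace_mult_commute) auto
  also have "B * Q * P = B" using w by (simp add: assoc_mult_mat[of _ n n _ n _ n])
  also have "mat_trace B = sum_list es"
    unfolding diag[symmetric] diag_mat_def mat_trace_def
    by (simp add: sum_list_distinct_conv_sum_set atLeast0LessThan)
  finally have "mat_trace G = sum_list es" .
  then show ?thesis
    using A by (simp add: mean_gram_eigenvalue_def gram_eigenvalues_def G_def[symmetric] es
        proots_linear_factors sum_mset_sum_list)
qed

end

(* Markov's inequality is applied to the k-th and the -k-th moment of |Pi_n v|^2 / (c(X_1) ... c(X_n)),
   where k is of order N t / b.  By independence these moments are at most K^n as soon as K bounds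
   the corresponding moments of |X u|^2 / (c(X) |u|^2) for every fixed direction u.

   In the Gaussian case |X u|^2 is a multiple of a chi-square variable.  In the rotationally
   invariant case the moments do not depend on u, so u may be replaced by a standard Gaussian
   vector g, and Fubini reduces the problem to one fixed matrix X, with Q = |X g|^2 / s and R = |g|^2
   in place of numerator and denominator.  If the eigenvalues e of X^T X / s have mean 1 and are
   at most b, then E exp(- theta Q / 2) is the product of the (1 + theta e)^(-1/2), which by
   concavity is at most (1 + theta b)^(-N/(2b)).  Positive moments of Q follow from y <= exp (y - 1),
   negative ones from the Gamma integral. *)

theory Submission
  imports Defs
begin

subsection \<open>Gaussian integrals\<close>

text \<open>The eigenvalues enter only through det (c I - G) = prod (c - e) with G = A^T A; G is
  never diagonalised orthogonally. Gaussian integrals are therefore computed by completing the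
  square one coordinate at a time, and the bound G <= b s I, which keeps the Laplace transform
  finite at negative theta, is drawn from the nonvanishing of determinants. Moments live in the
  extended nonnegative reals. There the inverse of 0 is infinite, so the event Pi_n v = 0 falls
  under the negative moment. One step costs about exp (6 b k^2 / N) in the moment of order k,
  against a gain of exp (- k t). The best k is N t / (12 b), with rate t^2 / (24 b); the distance
  from 24 to 32 pays for rounding k and for the correction 1 - 4 b k / N in the exponent. The
  Gaussian case is run with b = 1. Passing to the squared norm doubles t, and (2 t)^2 / 32 = t^2 /
  8.\<close>

definition quad_form :: "nat \<Rightarrow> (nat \<Rightarrow> nat \<Rightarrow> real) \<Rightarrow> (nat \<Rightarrow> real) \<Rightarrow> real" where
  "quad_form n S x = (\<Sum>i<n. \<Sum>j<n. S i j * x i * x j)"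

definition pos_def :: "nat \<Rightarrow> (nat \<Rightarrow> nat \<Rightarrow> real) \<Rightarrow> bool" where
  "pos_def n S \<longleftrightarrow> (\<forall>i<n. \<forall>j<n. S i j = S j i) \<and> (\<forall>x. (\<exists>i<n. x i \<noteq> 0) \<longrightarrow> quad_form n S x > 0)"

lemma pos_def_sym: "pos_def n S \<Longrightarrow> i < n \<Longrightarrow> j < n \<Longrightarrow> S i j = S j i"
  unfolding pos_def_def by blast

lemma pos_def_pos: "pos_def n S \<Longrightarrow> i < n \<Longrightarrow> x i \<noteq> 0 \<Longrightarrow> quad_form n S x > 0"
  unfolding pos_def_def by blast

definition fun_det :: "nat \<Rightarrow> (nat \<Rightarrow> nat \<Rightarrow> real) \<Rightarrow> real" where
  "fun_det n S = Determinant.det (Matrix.mat n n (\<lambda>(i, j). S i j))"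

definition schur_complement :: "nat \<Rightarrow> (nat \<Rightarrow> nat \<Rightarrow> real) \<Rightarrow> nat \<Rightarrow> nat \<Rightarrow> real" where
  "schur_complement n S i j = S i j - S i n * S n j / S n n"

text \<open>Block elimination of the last row and column: S is a unit upper triangular matrix times
  a block lower triangular one with diagonal blocks the Schur complement and
  \<open>S n n\<close>.\<close>

lemma fun_det_schur:
  assumes "S n n \<noteq> 0"
  shows "fun_det (Suc n) S = S n n * fun_det n (schur_complement n S)"
proof -
  let ?c = "Matrix.mat n 1 (\<lambda>(i, _). S i n / S n n)" and ?r = "Matrix.mat 1 n (\<lambda>(_, j). S n j)"
    and ?d = "Matrix.mat 1 1 (\<lambda>_. S n n)" and ?T = "Matrix.mat n n (\<lambda>(i, j). schur_complement n S i j)"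
  let ?L = "four_block_mat (1\<^sub>m n) ?c (0\<^sub>m 1 n) (1\<^sub>m 1)" and ?R = "four_block_mat ?T (0\<^sub>m n 1) ?r ?d"
  have "?L * ?R = four_block_mat (1\<^sub>m n * ?T + ?c * ?r) (1\<^sub>m n * 0\<^sub>m n 1 + ?c * ?d)
      (0\<^sub>m 1 n * ?T + 1\<^sub>m 1 * ?r) (0\<^sub>m 1 n * 0\<^sub>m n 1 + 1\<^sub>m 1 * ?d)"
    by (rule mult_four_block_mat) auto
  also have "\<dots> = Matrix.mat (Suc n) (Suc n) (\<lambda>(i, j). S i j)"
  proof (rule eq_matI, goal_cases)
    case (1 i j)
    then have "i = n \<or> i < n" "j = n \<or> j < n" by auto
    then show ?case using assms
      by (auto simp: schur_complement_def scalar_prod_def)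
  qed auto
  finally have "fun_det (Suc n) S = Determinant.det (?L * ?R)" by (simp add: fun_det_def)
  also have "\<dots> = Determinant.det ?L * Determinant.det ?R"
    by (rule det_mult[of _ "n + 1"]) auto
  also have "Determinant.det ?L = 1"
    by (subst det_four_block_mat_lower_left_zero[of _ n _ 1]) auto
  also have "Determinant.det ?R = Determinant.det ?T * Determinant.det ?d"
    by (rule det_four_block_mat_upper_right_zero) auto
  also have "Determinant.det ?d = S n n" by (subst det_single) auto
  finally show ?thesis by (simp add: fun_det_def)
qed

text \<open>Completing the square in the last variable.\<close>

lemma quad_form_schur:
  assumes "S n n \<noteq> 0" and sym: "\<And>i j. i < Suc n \<Longrightarrow> j < Suc n \<Longrightarrow> S i j = S j i"
  shows "quad_form (Suc n) S x =
    S n n * (x n + (\<Sum>j<n. S n j * x j) / S n n)\<^sup>2 + quad_form n (schur_complement n S) x"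
proof -
  let ?r = "\<Sum>j<n. S n j * x j"
  have "quad_form (Suc n) S x
      = (\<Sum>i<n. \<Sum>j<n. S i j * x i * x j) + (\<Sum>i<n. S i n * x i * x n) + (\<Sum>j<n. S n j * x n * x j)
        + S n n * x n * x n"
    by (simp add: quad_form_def sum.distrib)
  also have "(\<Sum>i<n. S i n * x i * x n) = x n * ?r"
    unfolding sum_distrib_left using sym by (intro sum.cong) auto
  also have "(\<Sum>j<n. S n j * x n * x j) = x n * ?r"
    unfolding sum_distrib_left by (intro sum.cong) auto
  finally have 1: "quad_form (Suc n) S x
      = (\<Sum>i<n. \<Sum>j<n. S i j * x i * x j) + 2 * x n * ?r + S n n * x n * x n" by simp
  have "(\<Sum>i<n. \<Sum>j<n. S i n * S n j / S n n * x i * x j) = (\<Sum>i<n. \<Sum>j<n. (S n i * x i) * (S n j * x j) / S n n)"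
    using sym by (intro sum.cong refl) auto
  also have "\<dots> = ?r * ?r / S n n"
    by (simp add: sum_product sum_divide_distrib)
  finally have "quad_form n (schur_complement n S) x = (\<Sum>i<n. \<Sum>j<n. S i j * x i * x j) - ?r * ?r / S n n"
    by (simp add: quad_form_def schur_complement_def left_diff_distrib sum_subtractf)
  moreover have "S n n * (x n + ?r / S n n)\<^sup>2 = S n n * x n * x n + 2 * x n * ?r + ?r * ?r / S n n"
    using assms(1) by (simp add: power2_eq_square field_simps)
  ultimately show ?thesis
    using 1 by simp
qed

lemma quad_form_cong: "(\<And>i. i < n \<Longrightarrow> x i = y i) \<Longrightarrow> quad_form n S x = quad_form n S y"
  unfolding quad_form_def by (intro sum.cong refl) auto

lemma pos_def_Suc:
  assumes "pos_def (Suc n) S"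
  shows "S n n > 0" "pos_def n (schur_complement n S)"
proof -
  note sym = pos_def_sym[OF assms]
  have "quad_form (Suc n) S (\<lambda>i. if i = n then 1 else 0) > 0"
    by (rule pos_def_pos[OF assms, of n]) auto
  also have "quad_form (Suc n) S (\<lambda>i. if i = n then 1 else 0) = S n n"
    by (simp add: quad_form_def if_distrib[of "\<lambda>c. c * _"] if_distrib[of "\<lambda>c. _ * c"] cong: if_cong)
  finally show pos: "S n n > 0" .
  have "quad_form n (schur_complement n S) x > 0" if "i < n" "x i \<noteq> 0" for x i
  proof -
    \<comment> \<open>The last coordinate that minimises the form: the square in
      \<open>quad_form_schur\<close> vanishes and only the Schur complement remains.\<close>
    let ?y = "x(n := - (\<Sum>j<n. S n j * x j) / S n n)"
    have "0 < quad_form (Suc n) S ?y"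
      using that by (intro pos_def_pos[OF assms, of i]) auto
    also have "\<dots> = S n n * (?y n + (\<Sum>j<n. S n j * ?y j) / S n n)\<^sup>2 + quad_form n (schur_complement n S) ?y"
      using pos by (intro quad_form_schur sym) auto
    also have "(\<Sum>j<n. S n j * ?y j) = (\<Sum>j<n. S n j * x j)" by (intro sum.cong) auto
    also have "quad_form n (schur_complement n S) ?y = quad_form n (schur_complement n S) x"
      by (rule quad_form_cong) auto
    finally show ?thesis by (simp add: diff_divide_distrib)
  qed
  moreover have "schur_complement n S i j = schur_complement n S j i" if "i < n" "j < n" for i j
    using sym[of i j] sym[of i n] sym[of j n] that by (simp add: schur_complement_def)
  ultimately show "pos_def n (schur_complement n S)"
    unfolding pos_def_def by blast
qed

lemma nn_integral_gaussian_shift: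
  fixes s c :: real
  assumes "s > 0"
  shows "(\<integral>\<^sup>+x. ennreal (exp (- (s * (x + c)\<^sup>2) / 2)) \<partial>lborel) = ennreal (sqrt (2 * pi / s))"
proof -
  interpret prob_space "density lborel (normal_density (- c) (1 / sqrt s))"
    using assms by (intro prob_space_normal_density) simp
  have eq: "exp (- (s * (x + c)\<^sup>2) / 2) = sqrt (2 * pi / s) * normal_density (- c) (1 / sqrt s) x" for x
    using assms by (simp add: normal_density_def power_divide real_sqrt_divide field_simps)
  have "(\<integral>\<^sup>+x. ennreal (normal_density (- c) (1 / sqrt s) x) \<partial>lborel) = 1"
    using emeasure_space_1 by (simp add: emeasure_density)
  then show ?thesis
    unfolding eq using assms by (simp add: ennreal_mult nn_integral_cmult)
qed

lemma quad_form_measurable [measurable]: "quad_form n S \<in> borel_measurable (\<Pi>\<^sub>M i\<in>{..<n}. lborel)"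
  unfolding quad_form_def by measurable

text \<open>Integrating out the last coordinate leaves the Schur complement and splits off the
  pivot, exactly as the determinant does. Positivity of the determinant comes from the same
  induction; later it also excludes negative eigenvalues of Gram matrices.\<close>

lemma nn_integral_gaussian:
  assumes "pos_def n S"
  shows "fun_det n S > 0 \<and>
    (\<integral>\<^sup>+x. ennreal (exp (- quad_form n S x / 2)) \<partial>(\<Pi>\<^sub>M i\<in>{..<n}. lborel)) = ennreal (sqrt ((2 * pi) ^ n / fun_det n S))"
  using assms
proof (induction n arbitrary: S)
  case 0
  interpret product_sigma_finite "\<lambda>_::nat. lborel :: real measure" ..
  show ?case by (simp add: quad_form_def fun_det_def PiM_empty)
next
  case (Suc n)
  interpret product_sigma_finite "\<lambda>_::nat. lborel :: real measure" ..
  let ?T = "schur_complement n S"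
  note sym = pos_def_sym[OF Suc.prems]
  note pos = pos_def_Suc[OF Suc.prems]
  note IH = Suc.IH[OF pos(2)]
  have det: "fun_det (Suc n) S = S n n * fun_det n ?T"
    using pos(1) by (intro fun_det_schur) simp
  have "(\<integral>\<^sup>+x. ennreal (exp (- quad_form (Suc n) S x / 2)) \<partial>(\<Pi>\<^sub>M i\<in>{..<Suc n}. lborel))
    = (\<integral>\<^sup>+x. \<integral>\<^sup>+y. ennreal (exp (- quad_form (Suc n) S (x(n := y)) / 2)) \<partial>lborel \<partial>(\<Pi>\<^sub>M i\<in>{..<n}. lborel))"
    unfolding lessThan_Suc
    by (subst product_nn_integral_insert) (auto simp: lessThan_Suc[symmetric])
  also have "\<dots> = (\<integral>\<^sup>+x. ennreal (exp (- quad_form n ?T x / 2)) * ennreal (sqrt (2 * pi / S n n))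
      \<partial>(\<Pi>\<^sub>M i\<in>{..<n}. lborel))"
  proof (rule nn_integral_cong)
    fix x :: "nat \<Rightarrow> real"
    let ?c = "(\<Sum>j<n. S n j * x j) / S n n"
    have "quad_form (Suc n) S (x(n := y)) = S n n * (y + ?c)\<^sup>2 + quad_form n ?T x" for y
    proof -
      have "(\<Sum>j<n. S n j * (x(n := y)) j) = (\<Sum>j<n. S n j * x j)" by (intro sum.cong) auto
      moreover have "quad_form n ?T (x(n := y)) = quad_form n ?T x" by (rule quad_form_cong) auto
      moreover have "quad_form (Suc n) S (x(n := y)) = S n n * ((x(n := y)) n +
          (\<Sum>j<n. S n j * (x(n := y)) j) / S n n)\<^sup>2 + quad_form n ?T (x(n := y))"
        using pos(1) by (intro quad_form_schur sym) auto
      ultimately show ?thesis by simp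
    qed
    then have "exp (- quad_form (Suc n) S (x(n := y)) / 2)
        = exp (- quad_form n ?T x / 2) * exp (- (S n n * (y + ?c)\<^sup>2) / 2)" for y
      by (simp add: exp_add[symmetric] field_simps)
    then show "(\<integral>\<^sup>+y. ennreal (exp (- quad_form (Suc n) S (x(n := y)) / 2)) \<partial>lborel)
        = ennreal (exp (- quad_form n ?T x / 2)) * ennreal (sqrt (2 * pi / S n n))"
      using nn_integral_gaussian_shift[OF pos(1), of ?c] by (simp add: ennreal_mult nn_integral_cmult)
  qed
  also have "\<dots> = ennreal (sqrt ((2 * pi) ^ n / fun_det n ?T)) * ennreal (sqrt (2 * pi / S n n))"
    using IH by (simp add: nn_integral_multc)
  also have "\<dots> = ennreal (sqrt ((2 * pi) ^ n / fun_det n ?T) * sqrt (2 * pi / S n n))"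
    using IH pos by (intro ennreal_mult[symmetric]) auto
  also have "sqrt ((2 * pi) ^ n / fun_det n ?T) * sqrt (2 * pi / S n n) = sqrt ((2 * pi) ^ Suc n / fun_det (Suc n) S)"
    unfolding real_sqrt_mult[symmetric] det by (simp add: mult_ac)
  finally show ?case using IH pos det by simp
qed

subsection \<open>Gram matrices\<close>

definition sq_sum :: "nat \<Rightarrow> (nat \<Rightarrow> real) \<Rightarrow> real" where
  "sq_sum n x = (\<Sum>i<n. (x i)\<^sup>2)"

lemma sq_sum_nonneg: "sq_sum n x \<ge> 0"
  by (simp add: sq_sum_def sum_nonneg)

lemma sq_sum_pos: "i < n \<Longrightarrow> x i \<noteq> 0 \<Longrightarrow> sq_sum n x > 0"
  unfolding sq_sum_def by (rule sum_pos2[of _ i]) auto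

lemma abs_mult_le_sq_sum:
  assumes "i < n" "j < n"
  shows "\<bar>x i * x j\<bar> \<le> sq_sum n x"
proof -
  have "(x k)\<^sup>2 \<le> sq_sum n x" if "k < n" for k
    unfolding sq_sum_def using that by (intro member_le_sum) auto
  from this[OF assms(1)] this[OF assms(2)]
  show ?thesis
    using sum_squares_bound[of "\<bar>x i\<bar>" "\<bar>x j\<bar>"] by (simp add: abs_mult)
qed

lemma quad_form_le_sq_sum: "quad_form n S x \<le> (\<Sum>i<n. \<Sum>j<n. \<bar>S i j\<bar>) * sq_sum n x"
  unfolding quad_form_def sum_distrib_right
proof (intro sum_mono)
  fix i j assume "i \<in> {..<n}" "j \<in> {..<n}"
  then have "\<bar>S i j\<bar> * \<bar>x i * x j\<bar> \<le> \<bar>S i j\<bar> * sq_sum n x"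
    by (intro mult_left_mono abs_mult_le_sq_sum) auto
  moreover have "S i j * x i * x j \<le> \<bar>S i j\<bar> * \<bar>x i * x j\<bar>"
    by (metis abs_ge_self abs_mult mult.assoc)
  ultimately show "S i j * x i * x j \<le> \<bar>S i j\<bar> * sq_sum n x" by linarith
qed

text \<open>Serves two purposes: d = -1 gives the characteristic matrix, c = 1 the matrix in the
  exponent of a Gaussian Laplace transform.\<close>

definition shift_form :: "real \<Rightarrow> real \<Rightarrow> (nat \<Rightarrow> nat \<Rightarrow> real) \<Rightarrow> nat \<Rightarrow> nat \<Rightarrow> real" where
  "shift_form c d S i j = (if i = j then c else 0) + d * S i j"

lemma quad_form_shift: "quad_form n (shift_form c d S) x = c * sq_sum n x + d * quad_form n S x"
proof -
  have "quad_form n (shift_form c d S) x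
      = (\<Sum>i<n. \<Sum>j<n. (if i = j then c * (x i)\<^sup>2 else 0) + d * (S i j * x i * x j))"
    unfolding quad_form_def shift_form_def by (intro sum.cong) (auto simp: power2_eq_square algebra_simps)
  also have "\<dots> = (\<Sum>i<n. c * (x i)\<^sup>2) + (\<Sum>i<n. \<Sum>j<n. d * (S i j * x i * x j))"
    by (simp add: sum.distrib)
  finally show ?thesis by (simp add: quad_form_def sq_sum_def sum_distrib_left)
qed

lemma fun_det_nonzero_inverse:
  assumes "fun_det n S \<noteq> 0"
  obtains W where "\<And>i k. i < n \<Longrightarrow> k < n \<Longrightarrow> (\<Sum>j<n. S i j * W j k) = (if i = k then 1 else 0)"
proof -
  let ?S = "Matrix.mat n n (\<lambda>(i, j). S i j)"
  have "?S \<in> Units (ring_mat TYPE(real) n ())"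
    by (rule det_non_zero_imp_unit) (use assms in \<open>auto simp: fun_det_def\<close>)
  then obtain W where W: "W \<in> carrier_mat n n" "?S * W = 1\<^sub>m n"
    unfolding Units_def ring_mat_def by auto
  have "(\<Sum>j<n. S i j * W $$ (j, k)) = (if i = k then 1 else 0)" if "i < n" "k < n" for i k
  proof -
    have "(?S * W) $$ (i, k) = (\<Sum>j<n. S i j * W $$ (j, k))"
      using that W(1) by (auto simp: scalar_prod_def atLeast0LessThan intro!: sum.cong)
    then show ?thesis using that W(2) by simp
  qed
  then show ?thesis by (rule that)
qed

text \<open>A lower bound without compactness or eigenvectors: evaluate the form at x - t w with B w
  = x. The cross terms are both |x|^2, and the quadratic term <x, w> is at most C |x|^2 because the
  entries of the inverse are bounded.\<close>

lemma psd_nonsingular_gap: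
  assumes psd: "\<And>x. quad_form n B x \<ge> 0" and sym: "\<And>i j. i < n \<Longrightarrow> j < n \<Longrightarrow> B i j = B j i"
    and det: "fun_det n B \<noteq> 0"
  obtains C where "C > 0" "\<And>x. sq_sum n x \<le> C * quad_form n B x"
proof -
  obtain W where W: "\<And>i k. i < n \<Longrightarrow> k < n \<Longrightarrow> (\<Sum>j<n. B i j * W j k) = (if i = k then 1 else 0)"
    using fun_det_nonzero_inverse[OF det] by blast
  define C where "C = (\<Sum>i<n. \<Sum>j<n. \<bar>W i j\<bar>) + 1"
  have C: "C > 0" unfolding C_def by (intro add_nonneg_pos sum_nonneg) auto
  have "sq_sum n x \<le> C * quad_form n B x" for x
  proof -
    define w where "w j = (\<Sum>k<n. W j k * x k)" for j
    have Bw: "(\<Sum>j<n. B i j * w j) = x i" if "i < n" for i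
    proof -
      have "(\<Sum>j<n. B i j * w j) = (\<Sum>j<n. \<Sum>k<n. B i j * W j k * x k)"
        unfolding w_def by (simp add: sum_distrib_left mult.assoc)
      also have "\<dots> = (\<Sum>k<n. (\<Sum>j<n. B i j * W j k) * x k)"
        by (subst sum.swap) (simp add: sum_distrib_right)
      also have "\<dots> = (\<Sum>k<n. (if i = k then 1 else 0) * x k)"
        using W that by (intro sum.cong) auto
      also have "\<dots> = x i" using that by (simp add: if_distrib[of "\<lambda>c. c * _"] cong: if_cong)
      finally show ?thesis .
    qed
    have xw: "(\<Sum>i<n. x i * w i) \<le> C * sq_sum n x"
    proof -
      have "(\<Sum>i<n. x i * w i) = quad_form n W x"
        unfolding quad_form_def w_def by (simp add: sum_distrib_left mult_ac)
      also have "\<dots> \<le> (\<Sum>i<n. \<Sum>j<n. \<bar>W i j\<bar>) * sq_sum n x" by (rule quad_form_le_sq_sum)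
      also have "\<dots> \<le> C * sq_sum n x" using sq_sum_nonneg[of n x] by (simp add: C_def algebra_simps)
      finally show ?thesis .
    qed
    have c1: "(\<Sum>i<n. \<Sum>j<n. B i j * x i * w j) = sq_sum n x"
    proof -
      have "(\<Sum>i<n. \<Sum>j<n. B i j * x i * w j) = (\<Sum>i<n. x i * (\<Sum>j<n. B i j * w j))"
        by (simp add: sum_distrib_left mult_ac)
      also have "\<dots> = sq_sum n x"
        unfolding sq_sum_def using Bw by (intro sum.cong) (auto simp: power2_eq_square)
      finally show ?thesis .
    qed
    have c2: "(\<Sum>i<n. \<Sum>j<n. B i j * w i * x j) = sq_sum n x"
    proof -
      have "(\<Sum>i<n. \<Sum>j<n. B i j * w i * x j) = (\<Sum>j<n. \<Sum>i<n. B i j * w i * x j)"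
        by (rule sum.swap)
      also have "\<dots> = (\<Sum>j<n. \<Sum>i<n. B j i * x j * w i)"
        using sym by (intro sum.cong refl) auto
      finally show ?thesis using c1 by simp
    qed
    have c3: "quad_form n B w = (\<Sum>i<n. x i * w i)"
    proof -
      have "quad_form n B w = (\<Sum>i<n. w i * (\<Sum>j<n. B i j * w j))"
        unfolding quad_form_def by (simp add: sum_distrib_left mult_ac)
      also have "\<dots> = (\<Sum>i<n. x i * w i)" using Bw by (intro sum.cong) auto
      finally show ?thesis .
    qed
    have expand: "quad_form n B (\<lambda>i. x i - t * w i)
        = quad_form n B x - t * sq_sum n x - t * sq_sum n x + t\<^sup>2 * quad_form n B w" for t
    proof -
      have "quad_form n B (\<lambda>i. x i - t * w i) = (\<Sum>i<n. \<Sum>j<n. B i j * x i * x j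
          - t * (B i j * x i * w j) - t * (B i j * w i * x j) + t\<^sup>2 * (B i j * w i * w j))"
        unfolding quad_form_def by (intro sum.cong refl) (simp add: power2_eq_square algebra_simps)
      then show ?thesis
        by (simp only: sum.distrib sum_subtractf sum_distrib_left[symmetric] quad_form_def c1 c2)
    qed
    \<comment> \<open>The minimiser of C t^2 - 2 t, the coefficient of |x|^2 in the resulting
      bound.\<close>
    let ?t = "1 / C"
    have "0 \<le> quad_form n B (\<lambda>i. x i - ?t * w i)" by (rule psd)
    also have "\<dots> = quad_form n B x - 2 * ?t * sq_sum n x + ?t\<^sup>2 * (\<Sum>i<n. x i * w i)"
      unfolding expand c3 by simp
    also have "\<dots> \<le> quad_form n B x - 2 * ?t * sq_sum n x + ?t\<^sup>2 * (C * sq_sum n x)"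
      using xw by (intro add_left_mono mult_left_mono) auto
    also have "\<dots> = quad_form n B x - sq_sum n x / C"
      using C by (simp add: power2_eq_square field_simps)
    finally show ?thesis using C by (simp add: field_simps)
  qed
  with C show ?thesis by (rule that)
qed

text \<open>The set of \<open>c' \<ge> c\<close> with \<open>S \<le> c' I\<close> is closed, and since \<open>c' I - S\<close> is nonsingular for
  \<open>c' > c\<close>, no such \<open>c'\<close> can be its minimum.\<close>

lemma rayleigh_bound:
  assumes sym: "\<And>i j. i < n \<Longrightarrow> j < n \<Longrightarrow> S i j = S j i"
    and det: "\<And>c'. c' > c \<Longrightarrow> fun_det n (shift_form c' (- 1) S) \<noteq> 0"
  shows "quad_form n S x \<le> c * sq_sum n x"
proof -
  define T where "T = {c'. c \<le> c' \<and> (\<forall>x. quad_form n S x \<le> c' * sq_sum n x)}"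
  let ?K = "\<Sum>i<n. \<Sum>j<n. \<bar>S i j\<bar>"
  have "quad_form n S x \<le> max c ?K * sq_sum n x" for x
    using quad_form_le_sq_sum[of n S x] mult_right_mono[of ?K "max c ?K" "sq_sum n x"] sq_sum_nonneg[of n x]
    by simp
  then have ne: "T \<noteq> {}" unfolding T_def by (auto intro!: exI[of _ "max c ?K"])
  have bdd: "bdd_below T" unfolding T_def by (rule bdd_belowI[of _ c]) auto
  define c0 where "c0 = Inf T"
  have c0: "c \<le> c0" unfolding c0_def using ne by (intro cInf_greatest) (auto simp: T_def)
  have le: "quad_form n S x \<le> c0 * sq_sum n x" for x
  proof (cases "sq_sum n x = 0")
    case True
    obtain c' where "c' \<in> T" using ne by blast
    then have "quad_form n S x \<le> c' * sq_sum n x" unfolding T_def by blast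
    with True show ?thesis by simp
  next
    case False
    then have pos: "sq_sum n x > 0" using sq_sum_nonneg[of n x] by linarith
    have "quad_form n S x / sq_sum n x \<le> c0" unfolding c0_def
    proof (rule cInf_greatest[OF ne])
      fix c' assume "c' \<in> T"
      then have "quad_form n S x \<le> c' * sq_sum n x" unfolding T_def by blast
      with pos show "quad_form n S x / sq_sum n x \<le> c'" by (simp add: field_simps)
    qed
    with pos show ?thesis by (simp add: field_simps)
  qed
  have "c0 = c"
  proof (rule ccontr)
    assume "c0 \<noteq> c"
    with c0 have "c0 > c" by simp
    obtain C where C: "C > 0" "\<And>x. sq_sum n x \<le> C * quad_form n (shift_form c0 (- 1) S) x"
    proof (rule psd_nonsingular_gap[of n "shift_form c0 (- 1) S"])
      show "quad_form n (shift_form c0 (- 1) S) x \<ge> 0" for x using le[of x] by (simp add: quad_form_shift)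
      show "shift_form c0 (- 1) S i j = shift_form c0 (- 1) S j i" if "i < n" "j < n" for i j
        using sym[OF that] by (auto simp: shift_form_def)
      show "fun_det n (shift_form c0 (- 1) S) \<noteq> 0" by (rule det) fact
    qed blast
    \<comment> \<open>The gap allows \<open>c0\<close> to be lowered by 1/C; the minimum with
      \<open>c0 - c\<close> keeps the lowered value in the range where the determinants are known
      not to vanish.\<close>
    define d where "d = min (1 / C) (c0 - c)"
    have d: "d > 0" "d \<le> 1 / C" "c \<le> c0 - d" using C(1) \<open>c0 > c\<close> by (auto simp: d_def)
    have "quad_form n S x \<le> (c0 - d) * sq_sum n x" for x
    proof -
      have "d * sq_sum n x \<le> 1 / C * sq_sum n x"
        using d(2) sq_sum_nonneg by (intro mult_right_mono)
      also have "\<dots> \<le> c0 * sq_sum n x - quad_form n S x"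
        using C(2)[of x] C(1) by (simp add: quad_form_shift field_simps)
      finally show ?thesis by (simp add: algebra_simps)
    qed
    with d(3) have "c0 - d \<in> T" unfolding T_def by blast
    then have "c0 \<le> c0 - d" unfolding c0_def using bdd by (rule cInf_lower)
    with d(1) show False by simp
  qed
  with le show ?thesis by simp
qed

section \<open>Spectrum of a Gram matrix\<close>

definition gram :: "real mat \<Rightarrow> nat \<Rightarrow> nat \<Rightarrow> real" where
  "gram A i j = (transpose_mat A * A) $$ (i, j)"

definition image_sq :: "nat \<Rightarrow> real mat \<Rightarrow> (nat \<Rightarrow> real) \<Rightarrow> real" where
  "image_sq n A x = sq_sum n (\<lambda>i. \<Sum>j<n. A $$ (i, j) * x j)"

lemma image_sq_nonneg: "image_sq n A x \<ge> 0"
  by (simp add: image_sq_def sq_sum_nonneg)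

lemma gram_sum: "A \<in> carrier_mat n n \<Longrightarrow> i < n \<Longrightarrow> j < n \<Longrightarrow> gram A i j = (\<Sum>k<n. A $$ (k, i) * A $$ (k, j))"
  by (simp add: gram_def scalar_prod_def atLeast0LessThan)

lemma quad_form_gram:
  assumes "A \<in> carrier_mat n n"
  shows "quad_form n (gram A) x = image_sq n A x"
proof -
  have "image_sq n A x = (\<Sum>k<n. \<Sum>i<n. \<Sum>j<n. A $$ (k, i) * A $$ (k, j) * x i * x j)"
    unfolding image_sq_def sq_sum_def power2_eq_square sum_product by (simp add: mult_ac)
  also have "\<dots> = (\<Sum>i<n. \<Sum>k<n. \<Sum>j<n. A $$ (k, i) * A $$ (k, j) * x i * x j)" by (rule sum.swap)
  also have "\<dots> = (\<Sum>i<n. \<Sum>j<n. \<Sum>k<n. A $$ (k, i) * A $$ (k, j) * x i * x j)"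
    by (intro sum.cong refl sum.swap)
  also have "\<dots> = quad_form n (gram A) x"
    unfolding quad_form_def using assms
    by (intro sum.cong refl) (simp add: gram_sum sum_distrib_right)
  finally show ?thesis ..
qed

text \<open>The characteristic polynomial of a symmetric real matrix splits over the reals. Its
  roots are kept as a list with multiplicities, so that one list serves the determinants for all
  real c.\<close>

lemma gram_eigenvalue_list:
  assumes A: "A \<in> carrier_mat n n"
  obtains es where "gram_eigenvalues A = mset es" "length es = n"
    "\<And>c. fun_det n (shift_form c (- 1) (gram A)) = (\<Prod>e\<leftarrow>es. c - e)"
proof -
  define G where "G = transpose_mat A * A"
  have G: "G \<in> carrier_mat n n" using A by (simp add: G_def)
  have "transpose_mat G = G"
    unfolding G_def using A by (subst transpose_mult[of _ n n _ n]) auto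
  then obtain es where es: "char_poly G = (\<Prod>e\<leftarrow>es. [:- e, 1:])"
    using symmetric_char_poly_splits[OF G] by blast
  have "gram_eigenvalues A = mset es"
    by (simp add: gram_eigenvalues_def G_def[symmetric] es proots_linear_factors)
  moreover have "length es = n"
    using degree_monic_char_poly[OF G] degree_linear_factors[of uminus es] unfolding es by simp
  moreover have "fun_det n (shift_form c (- 1) (gram A)) = (\<Prod>e\<leftarrow>es. c - e)" for c
  proof -
    have "Matrix.mat n n (\<lambda>(i, j). shift_form c (- 1) (gram A) i j) = - char_matrix G c"
      using G by (intro eq_matI) (auto simp: char_matrix_def shift_form_def gram_def G_def[symmetric])
    then have "fun_det n (shift_form c (- 1) (gram A)) = poly (char_poly G) c"
      using char_poly_matrix[OF G, of c] by (simp add: fun_det_def)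
    also have "\<dots> = (\<Prod>e\<leftarrow>es. c - e)"
      unfolding es poly_prod_list by (simp add: o_def)
    finally show ?thesis .
  qed
  ultimately show ?thesis by (rule that)
qed

lemma fun_det_scale: "fun_det n (\<lambda>i j. a * S i j) = a ^ n * fun_det n S"
proof -
  have "Matrix.mat n n (\<lambda>(i, j). a * S i j) = a \<cdot>\<^sub>m Matrix.mat n n (\<lambda>(i, j). S i j)"
    by (intro eq_matI) auto
  then show ?thesis by (simp add: fun_det_def)
qed

lemma fun_det_one: "fun_det n (shift_form 1 0 S) = 1"
proof -
  have "Matrix.mat n n (\<lambda>(i, j). shift_form 1 0 S i j) = 1\<^sub>m n"
    by (intro eq_matI) (auto simp: shift_form_def)
  then show ?thesis by (simp add: fun_det_def)
qed

text \<open>For d nonzero, I + d S is -d times (-1/d) I - S, so its determinant is a value of the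
  characteristic polynomial.\<close>

lemma fun_det_shift_gram:
  assumes det: "\<And>c. fun_det n (shift_form c (- 1) S) = (\<Prod>e\<leftarrow>es. c - e)" and len: "length es = n"
  shows "fun_det n (shift_form 1 d S) = (\<Prod>e\<leftarrow>es. 1 + d * e)"
proof (cases "d = 0")
  case True
  have "(\<Prod>e\<leftarrow>es. 1 :: real) = 1" by (induction es) auto
  then show ?thesis using True by (simp add: fun_det_one)
next
  case False
  then have "shift_form 1 d S = (\<lambda>i j. (- d) * shift_form (- (1 / d)) (- 1) S i j)"
    by (intro ext) (auto simp: shift_form_def algebra_simps)
  then have "fun_det n (shift_form 1 d S) = (- d) ^ n * (\<Prod>e\<leftarrow>es. - (1 / d) - e)"
    by (simp only: fun_det_scale det)
  also have "\<dots> = (\<Prod>e\<leftarrow>es. 1 + d * e)"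
    unfolding len[symmetric] using False by (induction es) (auto simp: field_simps)
  finally show ?thesis .
qed

text \<open>Weighted inequality between the geometric and arithmetic means of 1 and 1 + \<theta> b,
  with weight y / b on the second.\<close>

lemma powr_le_chord:
  fixes b y \<theta> :: real
  assumes "0 \<le> y" "y \<le> b" "0 < b" "1 + \<theta> * b > 0"
  shows "(1 + \<theta> * b) powr (y / b) \<le> 1 + \<theta> * y"
proof -
  have "(1 - y / b) * 1 + y / b * (1 + \<theta> * b) = 1 + \<theta> * y" using assms by (simp add: field_simps)
  then show ?thesis
    using Youngs_inequality_0[of "1 - y / b" "y / b" 1 "1 + \<theta> * b"] assms by simp
qed

text \<open>By concavity of the logarithm, for a given sum the product is smallest when all \<open>e\<close> are \<open>0\<close> or \<open>b\<close>.\<close>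

lemma prod_list_powr_le:
  fixes b \<theta> :: real
  assumes "\<And>e. e \<in> set es \<Longrightarrow> 0 \<le> e \<and> e \<le> b" "0 < b" "1 + \<theta> * b > 0"
  shows "(1 + \<theta> * b) powr (sum_list es / b) \<le> (\<Prod>e\<leftarrow>es. 1 + \<theta> * e)"
  using assms
proof (induction es)
  case (Cons e es)
  have "(1 + \<theta> * b) powr (sum_list (e # es) / b) = (1 + \<theta> * b) powr (e / b) * (1 + \<theta> * b) powr (sum_list es / b)"
    by (simp add: powr_add[symmetric] add_divide_distrib)
  also have "\<dots> \<le> (1 + \<theta> * e) * (\<Prod>e\<leftarrow>es. 1 + \<theta> * e)"
    using Cons powr_le_chord[of e b \<theta>] by (intro mult_mono) (auto intro: order.trans[OF powr_ge_zero])
  finally show ?case by simp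
qed auto

text \<open>Everything the Laplace transform of |A g|^2 / s requires: positive definiteness makes
  the Gaussian integral finite, the determinant bound makes it small. Negative \<theta> is the
  delicate case, where positivity depends on the upper bound for the eigenvalues.\<close>

lemma gram_det_bound:
  assumes A: "A \<in> carrier_mat n n" and n: "n \<ge> 1"
    and s: "mean_gram_eigenvalue A > 0"
    and b: "\<forall>e\<in>#gram_eigenvalues A. e \<le> b * mean_gram_eigenvalue A"
  shows "b \<ge> 1"
    and "\<And>\<theta>. 1 + \<theta> * b > 0 \<Longrightarrow> pos_def n (shift_form 1 (\<theta> / mean_gram_eigenvalue A) (gram A))"
    and "\<And>\<theta>. 1 + \<theta> * b > 0 \<Longrightarrow>
      (1 + \<theta> * b) powr (real n / b) \<le> fun_det n (shift_form 1 (\<theta> / mean_gram_eigenvalue A) (gram A))"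
proof -
  let ?s = "mean_gram_eigenvalue A"
  obtain es where es: "gram_eigenvalues A = mset es" "length es = n"
    "\<And>c. fun_det n (shift_form c (- 1) (gram A)) = (\<Prod>e\<leftarrow>es. c - e)"
    using gram_eigenvalue_list[OF A] by blast
  have det: "fun_det n (shift_form 1 d (gram A)) = (\<Prod>e\<leftarrow>es. 1 + d * e)" for d
    by (rule fun_det_shift_gram[OF es(3,2)])
  have sum: "sum_list es = n * ?s"
    using A n es(1) by (simp add: mean_gram_eigenvalue_def sum_mset_sum_list)
  have sym: "gram A i j = gram A j i" if "i < n" "j < n" for i j
    using A that by (simp add: gram_sum mult.commute)
  have symS: "shift_form c d (gram A) i j = shift_form c d (gram A) j i" if "i < n" "j < n" for c d i j
    using sym[OF that] by (auto simp: shift_form_def)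
  have le: "e \<le> b * ?s" if "e \<in> set es" for e
    using b that by (simp add: es(1))
  have pd_nonneg: "pos_def n (shift_form 1 d (gram A))" if "d \<ge> 0" for d
    unfolding pos_def_def
  proof (intro conjI allI impI)
    fix x :: "nat \<Rightarrow> real" assume "\<exists>i<n. x i \<noteq> 0"
    then have "sq_sum n x > 0" using sq_sum_pos by blast
    then show "quad_form n (shift_form 1 d (gram A)) x > 0"
      using that A image_sq_nonneg[of n A x] by (simp add: quad_form_shift quad_form_gram add_pos_nonneg)
  qed (use symS in blast)
  \<comment> \<open>A negative eigenvalue e would make I - G / e singular, although this matrix is
    positive definite because -1/e is positive.\<close>
  have nonneg: "e \<ge> 0" if "e \<in> set es" for e
  proof (rule ccontr)
    assume neg: "\<not> e \<ge> 0"
    then have "0 < fun_det n (shift_form 1 (- 1 / e) (gram A))"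
      using nn_integral_gaussian[OF pd_nonneg, of "- 1 / e"] by (simp add: divide_nonneg_neg)
    moreover have "(\<Prod>e'\<leftarrow>es. 1 + (- 1 / e) * e') = 0"
      unfolding prod_list_zero_iff set_map using that neg by (intro image_eqI[of _ _ e]) auto
    ultimately show False unfolding det by linarith
  qed
  have "real n * ?s \<le> real n * (b * ?s)"
    using sum_list_mono[of es "\<lambda>e. e" "\<lambda>_. b * ?s"] le sum es(2) by (simp add: sum_list_const_mult sum_list_replicate map_replicate_const)
  then show b1: "b \<ge> 1" using n s by simp
  \<comment> \<open>Every c' above b s exceeds all eigenvalues, so the product form of the
    determinant has no zero factor.\<close>
  have ray: "image_sq n A x \<le> b * ?s * sq_sum n x" for x
    unfolding quad_form_gram[OF A, symmetric]
  proof (rule rayleigh_bound[OF sym])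
    fix c' assume "c' > b * ?s"
    then have "c' - e \<noteq> 0" if "e \<in> set es" for e using le[OF that] by simp
    then show "fun_det n (shift_form c' (- 1) (gram A)) \<noteq> 0"
      unfolding es(3) prod_list_zero_iff by auto
  qed
  fix \<theta> assume \<theta>: "1 + \<theta> * b > 0"
  show "pos_def n (shift_form 1 (\<theta> / ?s) (gram A))"
  proof (cases "\<theta> \<ge> 0")
    case True
    then show ?thesis using s by (intro pd_nonneg) auto
  next
    case False
    show ?thesis unfolding pos_def_def
    proof (intro conjI allI impI)
      fix x :: "nat \<Rightarrow> real" assume "\<exists>i<n. x i \<noteq> 0"
      then have "sq_sum n x > 0" using sq_sum_pos by blast
      with \<theta> have "0 < (1 + \<theta> * b) * sq_sum n x" by simp
      also have "\<dots> = sq_sum n x + (\<theta> / ?s) * (b * ?s * sq_sum n x)" using s by (simp add: field_simps)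
      also have "\<dots> \<le> sq_sum n x + (\<theta> / ?s) * image_sq n A x"
        using False s ray[of x] by (intro add_left_mono mult_left_mono_neg) (auto simp: field_simps)
      finally show "quad_form n (shift_form 1 (\<theta> / ?s) (gram A)) x > 0"
        using A by (simp add: quad_form_shift quad_form_gram)
    qed (use symS in blast)
  qed
  have "(1 + \<theta> * b) powr (sum_list (map (\<lambda>e. e / ?s) es) / b) \<le> (\<Prod>e\<leftarrow>map (\<lambda>e. e / ?s) es. 1 + \<theta> * e)"
    using le nonneg s b1 \<theta> by (intro prod_list_powr_le) (auto simp: field_simps)
  also have "sum_list (map (\<lambda>e. e / ?s) es) = n"
    using s sum sum_list_mult_const[of "\<lambda>e. e" "1 / ?s" es] by simp
  also have "(\<Prod>e\<leftarrow>map (\<lambda>e. e / ?s) es. 1 + \<theta> * e) = fun_det n (shift_form 1 (\<theta> / ?s) (gram A))"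
    unfolding det by (simp add: o_def)
  finally show "(1 + \<theta> * b) powr (real n / b) \<le> fun_det n (shift_form 1 (\<theta> / ?s) (gram A))" .
qed

subsection \<open>Moments from Laplace transforms\<close>

text \<open>The right-hand side is the Laplace transform of \<open>b\<close> times a chi-square variable with
  \<open>2 * m\<close> degrees of freedom; negative \<open>\<theta>\<close> control the upper tail.\<close>

definition laplace_dominated :: "'a measure \<Rightarrow> ('a \<Rightarrow> real) \<Rightarrow> real \<Rightarrow> real \<Rightarrow> bool" where
  "laplace_dominated M Q b m \<longleftrightarrow> Q \<in> borel_measurable M \<and> (\<forall>x\<in>space M. 0 \<le> Q x) \<and>
    (\<forall>\<theta>. 1 + \<theta> * b > 0 \<longrightarrow>
      (\<integral>\<^sup>+x. ennreal (exp (- \<theta> * Q x / 2)) \<partial>M) \<le> ennreal ((1 + \<theta> * b) powr (- m)))"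

text \<open>The difference of the two sides vanishes at 0 and has derivative y^2 / (2 (1 -
  y)^2).\<close>

lemma neg_ln_one_minus_le:
  fixes x :: real
  assumes "0 \<le> x" "x < 1"
  shows "- ln (1 - x) \<le> x + x\<^sup>2 / (2 * (1 - x))"
proof -
  let ?f = "\<lambda>x::real. x + x\<^sup>2 / (2 * (1 - x)) + ln (1 - x)"
  have "?f 0 \<le> ?f x"
  proof (rule DERIV_nonneg_imp_nondecreasing[OF assms(1)])
    fix y assume y: "0 \<le> y" "y \<le> x"
    then have y1: "1 - y > 0" using assms by simp
    then have "(?f has_real_derivative (1 + (2 * y * (2 * (1 - y)) + 2 * y\<^sup>2) / (2 * (1 - y))\<^sup>2 - 1 / (1 - y))) (at y)"
      by (auto intro!: derivative_eq_intros simp: power2_eq_square)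
    moreover have "1 + (2 * y * (2 * z) + 2 * y\<^sup>2) / (2 * z)\<^sup>2 - 1 / z = y\<^sup>2 / (2 * z\<^sup>2)"
      if "z > 0" "y = 1 - z" for z
      using that(1) unfolding that(2) by (simp add: power2_eq_square field_simps)
    from this[OF y1] have "1 + (2 * y * (2 * (1 - y)) + 2 * y\<^sup>2) / (2 * (1 - y))\<^sup>2 - 1 / (1 - y) \<ge> 0"
      using y1 by simp
    ultimately show "\<exists>z. (?f has_real_derivative z) (at y) \<and> 0 \<le> z" by blast
  qed
  then show ?thesis by simp
qed

text \<open>The dominating law has mean N, so y <= exp (y - 1) is applied to Q / N, where it is
  tight at the mean. The first-order term of the logarithm then cancels exp (- p), and the bound is
  quadratic in p.\<close>

lemma laplace_power_moment:
  assumes "laplace_dominated M Q b (N / (2 * b))" "b > 0" "N > 0" "2 * b * real p < N"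
  shows "(\<integral>\<^sup>+x. ennreal (Q x / N) ^ p \<partial>M) \<le> ennreal (exp (b * (real p)\<^sup>2 / (N * (1 - 2 * b * real p / N))))"
proof -
  have Q: "Q \<in> borel_measurable M" "\<And>x. x \<in> space M \<Longrightarrow> 0 \<le> Q x"
    and L: "\<And>\<theta>. 1 + \<theta> * b > 0 \<Longrightarrow>
      (\<integral>\<^sup>+x. ennreal (exp (- \<theta> * Q x / 2)) \<partial>M) \<le> ennreal ((1 + \<theta> * b) powr (- (N / (2 * b))))"
    using assms(1) by (auto simp: laplace_dominated_def)
  note [measurable] = Q(1)
  define y where "y = 2 * b * real p / N"
  have y: "0 \<le> y" "y < 1" using assms by (auto simp: y_def)
  \<comment> \<open>Chosen so that the exponential in the Laplace transform is exp (p Q /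
    N).\<close>
  let ?\<theta> = "- (2 * real p / N)"
  have th: "1 + ?\<theta> * b = 1 - y" by (simp add: y_def)
  have "(\<integral>\<^sup>+x. ennreal (Q x / N) ^ p \<partial>M) \<le> (\<integral>\<^sup>+x. ennreal (exp (- real p)) * ennreal (exp (- ?\<theta> * Q x / 2)) \<partial>M)"
  proof (intro nn_integral_mono)
    fix x assume "x \<in> space M"
    then have q: "Q x / N \<ge> 0" using Q assms by auto
    have "Q x / N \<le> exp (Q x / N - 1)" using exp_ge_add_one_self[of "Q x / N - 1"] by simp
    then have "(Q x / N) ^ p \<le> exp (Q x / N - 1) ^ p" using q by (intro power_mono)
    also have "\<dots> = exp (- real p) * exp (- ?\<theta> * Q x / 2)"
      by (simp add: exp_of_nat_mult[symmetric] exp_add[symmetric] algebra_simps)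
    finally show "ennreal (Q x / N) ^ p \<le> ennreal (exp (- real p)) * ennreal (exp (- ?\<theta> * Q x / 2))"
      using q by (simp add: ennreal_power ennreal_mult[symmetric])
  qed
  also have "\<dots> = ennreal (exp (- real p)) * (\<integral>\<^sup>+x. ennreal (exp (- ?\<theta> * Q x / 2)) \<partial>M)"
    by (intro nn_integral_cmult) measurable
  also have "\<dots> \<le> ennreal (exp (- real p)) * ennreal ((1 + ?\<theta> * b) powr (- (N / (2 * b))))"
    using y th by (intro mult_left_mono L) auto
  also have "\<dots> = ennreal (exp (- real p + N / (2 * b) * - ln (1 - y)))"
  proof -
    have "(1 - y) powr (- (N / (2 * b))) = exp (N / (2 * b) * - ln (1 - y))"
      using y by (simp add: powr_def)
    then show ?thesis unfolding th exp_add by (simp add: ennreal_mult)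
  qed
  also have "\<dots> \<le> ennreal (exp (b * (real p)\<^sup>2 / (N * (1 - y))))"
  proof -
    have "N / (2 * b) * - ln (1 - y) \<le> N / (2 * b) * (y + y\<^sup>2 / (2 * (1 - y)))"
      using assms y by (intro mult_left_mono neg_ln_one_minus_le) auto
    also have "\<dots> = N / (2 * b) * y + N / (2 * b) * y\<^sup>2 / (2 * (1 - y))"
      by (simp add: distrib_left)
    also have "N / (2 * b) * y = real p" using assms by (simp add: y_def)
    also have "N / (2 * b) * y\<^sup>2 = 2 * (b * (real p)\<^sup>2 / N)"
      using assms by (simp add: y_def power2_eq_square)
    finally have "N / (2 * b) * - ln (1 - y) \<le> real p + 2 * (b * (real p)\<^sup>2 / N) / (2 * (1 - y))" .
    moreover have "2 * (b * (real p)\<^sup>2 / N) / (2 * (1 - y)) = b * (real p)\<^sup>2 / (N * (1 - y))"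
    proof -
      have "2 * (c / N) / (2 * z) = c / (N * z)" for c z :: real by simp
      then show ?thesis .
    qed
    ultimately show ?thesis by (intro ennreal_leI) simp
  qed
  finally show ?thesis by (simp add: y_def)
qed

lemma nn_integral_Gamma_scaled:
  fixes s q :: real
  assumes "s > 0" "q > 0"
  shows "(\<integral>\<^sup>+t. ennreal (indicator {0..} t * t powr (s - 1) * exp (- (t * q))) \<partial>lborel) = ennreal (Gamma s * q powr (- s))"
proof -
  have "ennreal (Gamma s) = (\<integral>\<^sup>+t. ennreal (indicator {0..} t * t powr (s - 1) / exp t) \<partial>lborel)"
    using assms by (intro Gamma_conv_nn_integral_real)
  also have "\<dots> = ennreal q * (\<integral>\<^sup>+t. ennreal (indicator {0..} (q * t) * (q * t) powr (s - 1) / exp (q * t)) \<partial>lborel)"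
    using nn_integral_real_affine[of "\<lambda>t. ennreal (indicator {0..} t * t powr (s - 1) / exp t)" q 0] assms by simp
  also have "\<dots> = ennreal q * (\<integral>\<^sup>+t. ennreal (q powr (s - 1)) * ennreal (indicator {0..} t * t powr (s - 1) * exp (- (t * q))) \<partial>lborel)"
    using assms by (intro arg_cong2[of _ _ _ _ "(*)"] refl nn_integral_cong)
      (auto simp: ennreal_mult[symmetric] powr_mult exp_minus field_simps indicator_def zero_le_mult_iff)
  also have "\<dots> = ennreal (q powr s) * (\<integral>\<^sup>+t. ennreal (indicator {0..} t * t powr (s - 1) * exp (- (t * q))) \<partial>lborel)"
    using assms by (subst nn_integral_cmult) (auto simp: mult.assoc[symmetric] ennreal_mult[symmetric] powr_diff)
  finally have *: "ennreal (Gamma s) = ennreal (q powr s) * (\<integral>\<^sup>+t. ennreal (indicator {0..} t * t powr (s - 1) * exp (- (t * q))) \<partial>lborel)"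
    (is "_ = _ * ?I") .
  have "?I = ennreal (q powr (- s) * q powr s) * ?I"
    using assms by (simp add: powr_add[symmetric])
  also have "\<dots> = ennreal (q powr (- s)) * (ennreal (q powr s) * ?I)"
    by (simp add: ennreal_mult mult.assoc)
  also have "\<dots> = ennreal (q powr (- s) * Gamma s)"
    unfolding *[symmetric] using assms by (intro ennreal_mult[symmetric]) (auto simp: less_imp_le)
  finally show ?thesis by (simp add: mult.commute)
qed

text \<open>For q > 0 this is the Gamma integral. At q = 0 the integral diverges, since the
  integrand is at least 1 on [1, oo), which matches the infinite inverse. Thus bounds on negative
  moments also control the event Q = 0.\<close>

lemma Gamma_inverse_power_le:
  fixes q :: real
  assumes "q \<ge> 0" "p > 0"
  shows "ennreal (Gamma (real p)) * inverse (ennreal q) ^ p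
    \<le> (\<integral>\<^sup>+t. ennreal (indicator {0..} t * t powr (real p - 1) * exp (- (t * q))) \<partial>lborel)"
proof (cases "q = 0")
  case True
  have "\<infinity> = emeasure lborel {1::real..}"
  proof (cases "emeasure lborel {1::real..}")
    case (real r)
    \<comment> \<open>If the half-line had finite measure r, it would still contain an interval of
      length r + 1.\<close>
    have "emeasure lborel {1..2 + r} \<le> emeasure lborel {1::real..}"
      by (intro emeasure_mono) auto
    with real show ?thesis by (simp del: ennreal_plus)
  qed simp
  also have "\<dots> = (\<integral>\<^sup>+t. indicator {1..} (t::real) \<partial>lborel)"
    by (subst nn_integral_indicator) auto
  also have "\<dots> \<le> (\<integral>\<^sup>+t. ennreal (indicator {0..} t * t powr (real p - 1) * exp (- (t * q))) \<partial>lborel)"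
    using assms True by (intro nn_integral_mono) (auto simp: indicator_def ge_one_powr_ge_zero)
  finally show ?thesis by (simp add: top_unique)
next
  case False
  then have "inverse (ennreal q) ^ p = ennreal (q powr (- real p))"
    using assms by (simp add: inverse_ennreal ennreal_power powr_minus powr_realpow power_inverse)
  then show ?thesis
    using nn_integral_Gamma_scaled[of "real p" q] assms False by (simp add: ennreal_mult)
qed

text \<open>Writing the inverse power as a Gamma integral reduces the claim to the Laplace transform
  at 2 a, integrated against a^(p-1). The result is the corresponding moment of the dominating law,
  (2 b)^(-p) Gamma (m - p) / Gamma m, which is then bounded by an elementary expression.\<close>

lemma laplace_inverse_moment:
  assumes "prob_space M" "laplace_dominated M Q b m" "b > 0" "p > 0" "real p < m"
  shows "(\<integral>\<^sup>+x. inverse (ennreal (Q x)) ^ p \<partial>M) \<le> ennreal ((1 / (2 * b * (m - real p))) ^ p)"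
proof -
  interpret prob_space M by fact
  interpret P: pair_sigma_finite lborel M ..
  have Q[measurable]: "Q \<in> borel_measurable M" and Q0: "\<And>x. x \<in> space M \<Longrightarrow> 0 \<le> Q x"
    and L: "\<And>\<theta>. 1 + \<theta> * b > 0 \<Longrightarrow>
      (\<integral>\<^sup>+x. ennreal (exp (- \<theta> * Q x / 2)) \<partial>M) \<le> ennreal ((1 + \<theta> * b) powr (- m))"
    using assms(2) by (auto simp: laplace_dominated_def)
  let ?g = "\<lambda>a::real. indicator {0..} a * a powr (real p - 1)"
  let ?h = "\<lambda>x::real. indicator {0..} x * x powr (m - 1) * exp (- x)"
  have m: "m > 0" using assms by linarith
  have pos: "Gamma (real p) > 0" "Gamma m > 0" "Gamma (m - real p) > 0"
    using assms by (auto intro!: Gamma_real_pos)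
  have "ennreal (Gamma (real p)) * (\<integral>\<^sup>+x. inverse (ennreal (Q x)) ^ p \<partial>M)
      = (\<integral>\<^sup>+x. ennreal (Gamma (real p)) * inverse (ennreal (Q x)) ^ p \<partial>M)"
    by (intro nn_integral_cmult[symmetric]) measurable
  also have "\<dots> \<le> (\<integral>\<^sup>+x. \<integral>\<^sup>+a. ennreal (?g a * exp (- (a * Q x))) \<partial>lborel \<partial>M)"
    using Q0 assms by (intro nn_integral_mono Gamma_inverse_power_le) auto
  also have "\<dots> = (\<integral>\<^sup>+a. \<integral>\<^sup>+x. ennreal (?g a * exp (- (a * Q x))) \<partial>M \<partial>lborel)"
    by (intro P.Fubini') measurable
  also have "\<dots> \<le> (\<integral>\<^sup>+a. ennreal (?g a * (1 + 2 * a * b) powr (- m)) \<partial>lborel)"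
  proof (intro nn_integral_mono)
    fix a :: real
    show "(\<integral>\<^sup>+x. ennreal (?g a * exp (- (a * Q x))) \<partial>M) \<le> ennreal (?g a * (1 + 2 * a * b) powr (- m))"
    proof (cases "a \<ge> 0")
      case True
      have "(\<integral>\<^sup>+x. ennreal (?g a * exp (- (a * Q x))) \<partial>M) = ennreal (?g a) * (\<integral>\<^sup>+x. ennreal (exp (- (2 * a) * Q x / 2)) \<partial>M)"
        using True by (subst nn_integral_cmult[symmetric]) (auto simp: ennreal_mult)
      also have "\<dots> \<le> ennreal (?g a) * ennreal ((1 + 2 * a * b) powr (- m))"
        using True assms by (intro mult_left_mono L) (auto intro!: add_pos_nonneg)
      finally show ?thesis using True by (simp add: ennreal_mult)
    qed simp
  qed
  finally have 1: "ennreal (Gamma (real p)) * (\<integral>\<^sup>+x. inverse (ennreal (Q x)) ^ p \<partial>M)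
      \<le> (\<integral>\<^sup>+a. ennreal (?g a * (1 + 2 * a * b) powr (- m)) \<partial>lborel)" .
  \<comment> \<open>This evaluates a Beta integral: with the factor Gamma m, the power (1 + 2 a
    b)^(-m) is itself a Gamma integral, and exchanging the order leaves two Gamma integrals in
    succession.\<close>
  have "ennreal (Gamma m) * (\<integral>\<^sup>+a. ennreal (?g a * (1 + 2 * a * b) powr (- m)) \<partial>lborel)
      = (\<integral>\<^sup>+a. ennreal (?g a) * ennreal (Gamma m * (1 + 2 * a * b) powr (- m)) \<partial>lborel)"
    using pos by (subst nn_integral_cmult[symmetric]) (auto simp: ennreal_mult[symmetric] mult_ac intro!: nn_integral_cong)
  also have "\<dots> = (\<integral>\<^sup>+a. \<integral>\<^sup>+x. ennreal (?g a * (?h x * exp (- (a * (2 * b * x))))) \<partial>lborel \<partial>lborel)"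
  proof (intro nn_integral_cong)
    fix a :: real
    show "ennreal (?g a) * ennreal (Gamma m * (1 + 2 * a * b) powr (- m))
        = (\<integral>\<^sup>+x. ennreal (?g a * (?h x * exp (- (a * (2 * b * x))))) \<partial>lborel)"
    proof (cases "a \<ge> 0")
      case True
      then have "1 + 2 * a * b > 0" using assms by (intro add_pos_nonneg) auto
      have e: "?h x * exp (- (a * (2 * b * x))) = indicator {0..} x * x powr (m - 1) * exp (- (x * (1 + 2 * a * b)))" for x
        by (simp add: mult_exp_exp algebra_simps)
      have "ennreal (?g a) * ennreal (Gamma m * (1 + 2 * a * b) powr (- m))
        = ennreal (?g a) * (\<integral>\<^sup>+x. ennreal (?h x * exp (- (a * (2 * b * x)))) \<partial>lborel)"
        unfolding e using nn_integral_Gamma_scaled[OF m \<open>1 + 2 * a * b > 0\<close>] by simp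
      also have "\<dots> = (\<integral>\<^sup>+x. ennreal (?g a * (?h x * exp (- (a * (2 * b * x))))) \<partial>lborel)"
        by (subst nn_integral_cmult[symmetric]) (auto simp: ennreal_mult)
      finally show ?thesis .
    qed simp
  qed
  also have "\<dots> = (\<integral>\<^sup>+x. \<integral>\<^sup>+a. ennreal (?g a * (?h x * exp (- (a * (2 * b * x))))) \<partial>lborel \<partial>lborel)"
    by (intro lborel_pair.Fubini') measurable
  also have "\<dots> = (\<integral>\<^sup>+x. ennreal (Gamma (real p) * (2 * b) powr (- real p)) *
      ennreal (indicator {0..} x * x powr (m - real p - 1) * exp (- (x * 1))) \<partial>lborel)"
  proof (intro nn_integral_cong)
    fix x :: real
    show "(\<integral>\<^sup>+a. ennreal (?g a * (?h x * exp (- (a * (2 * b * x))))) \<partial>lborel)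
      = ennreal (Gamma (real p) * (2 * b) powr (- real p)) *
        ennreal (indicator {0..} x * x powr (m - real p - 1) * exp (- (x * 1)))"
    proof (cases "x > 0")
      case True
      have "(\<integral>\<^sup>+a. ennreal (?g a * (?h x * exp (- (a * (2 * b * x))))) \<partial>lborel)
          = ennreal (?h x) * (\<integral>\<^sup>+a. ennreal (?g a * exp (- (a * (2 * b * x)))) \<partial>lborel)"
        by (subst nn_integral_cmult[symmetric]) (auto simp: ennreal_mult[symmetric] mult_ac intro!: nn_integral_cong)
      also have "\<dots> = ennreal (?h x) * ennreal (Gamma (real p) * (2 * b * x) powr (- real p))"
        using True assms by (subst nn_integral_Gamma_scaled) auto
      also have "\<dots> = ennreal (?h x * (Gamma (real p) * (2 * b * x) powr (- real p)))"
        using pos by (intro ennreal_mult[symmetric]) auto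
      also have "?h x * (Gamma (real p) * (2 * b * x) powr (- real p))
          = (Gamma (real p) * (2 * b) powr (- real p)) * (x powr (m - 1) * x powr (- real p) * exp (- x))"
        using True assms by (simp add: powr_mult)
      also have "x powr (m - 1) * x powr (- real p) = x powr (m - real p - 1)"
        unfolding powr_add[symmetric] by (simp add: algebra_simps)
      finally show ?thesis using True pos by (simp add: ennreal_mult[symmetric])
    qed (cases "x = 0"; simp)
  qed
  also have "\<dots> = ennreal (Gamma (real p) * (2 * b) powr (- real p)) * ennreal (Gamma (m - real p))"
    using nn_integral_Gamma_scaled[of "m - real p" 1] assms by (subst nn_integral_cmult) auto
  also have "\<dots> = ennreal (Gamma (real p)) * ennreal ((2 * b) powr (- real p) * Gamma (m - real p))"
    using pos by (simp add: ennreal_mult mult.assoc)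
  finally have 2: "ennreal (Gamma m) * (\<integral>\<^sup>+a. ennreal (?g a * (1 + 2 * a * b) powr (- m)) \<partial>lborel)
      = ennreal (Gamma (real p)) * ennreal ((2 * b) powr (- real p) * Gamma (m - real p))" .
  have "ennreal (Gamma (real p)) * (ennreal (Gamma m) * (\<integral>\<^sup>+x. inverse (ennreal (Q x)) ^ p \<partial>M))
      = ennreal (Gamma m) * (ennreal (Gamma (real p)) * (\<integral>\<^sup>+x. inverse (ennreal (Q x)) ^ p \<partial>M))"
    by (simp add: mult_ac)
  also have "\<dots> \<le> ennreal (Gamma (real p)) * ennreal ((2 * b) powr (- real p) * Gamma (m - real p))"
    unfolding 2[symmetric] using 1 by (rule mult_left_mono) simp
  finally have 3: "ennreal (Gamma m) * (\<integral>\<^sup>+x. inverse (ennreal (Q x)) ^ p \<partial>M)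
      \<le> ennreal ((2 * b) powr (- real p) * Gamma (m - real p))"
    using pos by (subst (asm) ennreal_mult_le_mult_iff) auto
  \<comment> \<open>Gamma m / Gamma (m - p) is a product of p factors, the smallest of which is m -
    p.\<close>
  have "(m - real p) ^ p \<le> pochhammer (m - real p) p"
    unfolding pochhammer_prod using prod_mono[of "{0..<p}" "\<lambda>_. m - real p" "\<lambda>i. m - real p + real i"] assms by simp
  also have "\<dots> = Gamma m / Gamma (m - real p)"
    using pochhammer_Gamma[of "m - real p" p] assms nonpos_Ints_nonpos[of "m - real p"] by auto
  finally have "Gamma (m - real p) \<le> Gamma m * (1 / (m - real p)) ^ p"
    using pos assms by (simp add: field_simps)
  then have "(2 * b) powr (- real p) * Gamma (m - real p) \<le> (2 * b) powr (- real p) * (Gamma m * (1 / (m - real p)) ^ p)"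
    by (intro mult_left_mono) auto
  also have "\<dots> = Gamma m * (1 / (2 * b * (m - real p))) ^ p"
  proof -
    have "(2 * b) powr (- real p) = (1 / (2 * b)) ^ p"
      using assms by (simp add: powr_minus powr_realpow power_one_over inverse_eq_divide)
    moreover have "1 / (2 * b * (m - real p)) = 1 / (2 * b) * (1 / (m - real p))" by simp
    ultimately show ?thesis by (simp only: power_mult_distrib mult_ac)
  qed
  finally have "ennreal ((2 * b) powr (- real p) * Gamma (m - real p)) \<le> ennreal (Gamma m) * ennreal ((1 / (2 * b * (m - real p))) ^ p)"
    using pos assms by (subst ennreal_mult[symmetric]) (auto intro!: ennreal_leI)
  with 3 have "ennreal (Gamma m) * (\<integral>\<^sup>+x. inverse (ennreal (Q x)) ^ p \<partial>M) \<le> ennreal (Gamma m) * ennreal ((1 / (2 * b * (m - real p))) ^ p)"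
    by (rule order.trans)
  then show ?thesis using pos by (subst (asm) ennreal_mult_le_mult_iff) auto
qed

text \<open>After scaling by N the bound becomes (1 - y)^(-p), and 1 / (1 - y) = 1 + y / (1 - y) <=
  exp (y / (1 - y)). This simple estimate gives 2 b where the positive moments have b.\<close>

lemma laplace_inverse_power_moment:
  assumes "prob_space M" "laplace_dominated M Q b (N / (2 * b))" "b > 0" "N > 0" "p > 0" "2 * b * real p < N"
  shows "(\<integral>\<^sup>+x. inverse (ennreal (Q x / N)) ^ p \<partial>M) \<le> ennreal (exp (2 * b * (real p)\<^sup>2 / (N * (1 - 2 * b * real p / N))))"
proof -
  have Q[measurable]: "Q \<in> borel_measurable M" and Q0: "\<And>x. x \<in> space M \<Longrightarrow> 0 \<le> Q x"
    using assms(2) by (auto simp: laplace_dominated_def)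
  define y where "y = 2 * b * real p / N"
  have y: "0 \<le> y" "y < 1" using assms by (auto simp: y_def)
  have inv: "inverse (ennreal (q / N)) = ennreal N * inverse (ennreal q)" if "q \<ge> 0" for q
  proof (cases "q = 0")
    case True
    then show ?thesis using assms by (simp add: ennreal_mult_top)
  next
    case False
    then have "inverse (ennreal (q / N)) = ennreal (N * inverse q)"
      using that assms False by (simp add: inverse_ennreal inverse_eq_divide)
    also have "\<dots> = ennreal N * inverse (ennreal q)"
      using that assms False by (subst inverse_ennreal) (auto simp: ennreal_mult)
    finally show ?thesis .
  qed
  have "(\<integral>\<^sup>+x. inverse (ennreal (Q x / N)) ^ p \<partial>M) = (\<integral>\<^sup>+x. ennreal N ^ p * inverse (ennreal (Q x)) ^ p \<partial>M)"
    using Q0 by (intro nn_integral_cong) (simp add: inv power_mult_distrib)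
  also have "\<dots> = ennreal N ^ p * (\<integral>\<^sup>+x. inverse (ennreal (Q x)) ^ p \<partial>M)"
    by (intro nn_integral_cmult) measurable
  also have "\<dots> \<le> ennreal N ^ p * ennreal ((1 / (2 * b * (N / (2 * b) - real p))) ^ p)"
    using assms by (intro mult_left_mono laplace_inverse_moment) (auto simp: field_simps)
  also have "\<dots> = ennreal ((N * (1 / (2 * b * (N / (2 * b) - real p)))) ^ p)"
    using assms by (simp add: ennreal_power ennreal_mult[symmetric] power_mult_distrib field_simps)
  also have "N * (1 / (2 * b * (N / (2 * b) - real p))) = 1 / (1 - y)"
    using assms by (simp add: y_def field_simps)
  also have "ennreal ((1 / (1 - y)) ^ p) \<le> ennreal (exp (2 * b * (real p)\<^sup>2 / (N * (1 - y))))"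
  proof (rule ennreal_leI)
    have "1 / (1 - y) = 1 + y / (1 - y)" using y by (simp add: field_simps)
    then have "(1 / (1 - y)) ^ p \<le> exp (y / (1 - y)) ^ p"
      using y exp_ge_add_one_self[of "y / (1 - y)"] by (intro power_mono) auto
    also have "\<dots> = exp (real p * (y / (1 - y)))" by (rule exp_of_nat_mult[symmetric])
    also have "real p * (y / (1 - y)) = 2 * b * (real p)\<^sup>2 / (N * (1 - y))"
      by (simp add: y_def power2_eq_square)
    finally show "(1 / (1 - y)) ^ p \<le> exp (2 * b * (real p)\<^sup>2 / (N * (1 - y)))" .
  qed
  finally show ?thesis unfolding y_def .
qed

text \<open>Where Q vanishes the integrand is infinite, and a finite integral allows this only on a
  null set.\<close>

lemma AE_pos_of_inverse_power_moment:
  assumes [measurable]: "Q \<in> borel_measurable M" and fin: "(\<integral>\<^sup>+x. inverse (ennreal (Q x)) ^ p \<partial>M) \<le> ennreal C" and p: "p > 0"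
  shows "AE x in M. Q x > 0"
proof -
  have "AE x in M. inverse (ennreal (Q x)) ^ p \<noteq> \<infinity>"
  proof (rule nn_integral_PInf_AE)
    show "(\<integral>\<^sup>+x. inverse (ennreal (Q x)) ^ p \<partial>M) \<noteq> \<infinity>"
      using fin by (metis ennreal_less_top infinity_ennreal_def not_less)
  qed measurable
  then show ?thesis
  proof eventually_elim
    case (elim x)
    show ?case
    proof (rule ccontr)
      assume "\<not> Q x > 0"
      then have "ennreal (Q x) = 0" by (simp add: ennreal_neg)
      with elim p show False by simp
    qed
  qed
qed

lemma ennreal_le_of_power2_le:
  assumes "x\<^sup>2 \<le> ennreal (y\<^sup>2)" "y \<ge> 0"
  shows "x \<le> ennreal y"
proof (cases x)
  case (real r)
  then have "r\<^sup>2 \<le> y\<^sup>2" using assms by (simp add: ennreal_power)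
  then have "r \<le> y" using assms(2) by (rule power2_le_imp_le)
  then show ?thesis using real by (simp add: ennreal_leI)
next
  case top
  then show ?thesis using assms by (simp add: top_unique)
qed

text \<open>The Cauchy-Schwarz inequality decouples \<open>Q\<close> from \<open>R\<close>, so that length and direction of a
  Gaussian vector need not be shown to be independent.\<close>

lemma laplace_ratio_moments:
  assumes M: "prob_space M" and Q: "laplace_dominated M Q b (N / (2 * b))" and R: "laplace_dominated M R 1 (N / 2)"
    and b: "b \<ge> 1" and N: "N > 0" and k: "k > 0" "4 * b * real k < N"
  defines "K \<equiv> exp (6 * b * (real k)\<^sup>2 / (N * (1 - 4 * b * real k / N)))"
  shows "(\<integral>\<^sup>+x. ennreal (Q x / R x) ^ k \<partial>M) \<le> ennreal K"
    and "(\<integral>\<^sup>+x. inverse (ennreal (Q x / R x)) ^ k \<partial>M) \<le> ennreal K"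
proof -
  have [measurable]: "Q \<in> borel_measurable M" "R \<in> borel_measurable M"
    and Q0: "\<And>x. x \<in> space M \<Longrightarrow> 0 \<le> Q x" and R0: "\<And>x. x \<in> space M \<Longrightarrow> 0 \<le> R x"
    using Q R by (auto simp: laplace_dominated_def)
  have R': "laplace_dominated M R 1 (N / (2 * 1))" using R by simp
  define y where "y = 4 * b * real k / N"
  have y: "y < 1" using k N by (simp add: y_def)
  define c where "c = (real k)\<^sup>2 / (N * (1 - y))"
  have c0: "c \<ge> 0" using y N by (simp add: c_def)
  have kb: "4 * real k \<le> 4 * b * real k" using mult_right_mono[OF b, of "4 * real k"] by simp
  have kb': "4 * real k / N \<le> y" unfolding y_def using kb N by (intro divide_right_mono) auto
  have cR: "(real k)\<^sup>2 / (N * (1 - 4 * real k / N)) \<le> c"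
  proof -
    have "N * (1 - y) \<le> N * (1 - 4 * real k / N)" using N kb' by (intro mult_left_mono) auto
    moreover have "0 < N * (1 - y)" using N y by simp
    ultimately show ?thesis unfolding c_def using mult_pos_pos by (intro divide_left_mono) force+
  qed
  \<comment> \<open>Cauchy-Schwarz calls for order 2 k, which turns b and 2 b into 4 b and 8 b for
    Q, and likewise 4 and 8 for R. As b is at least 1, each pairing costs at most 12 b; the square
    root gives the 6 b in \<open>K\<close>.\<close>
  have Qu: "(\<integral>\<^sup>+x. ennreal (Q x / N) ^ (2 * k) \<partial>M) \<le> ennreal (exp (4 * b * c))"
    using laplace_power_moment[OF Q, of "2 * k"] b N k by (simp add: c_def y_def power_mult_distrib mult_ac)
  have Ql: "(\<integral>\<^sup>+x. inverse (ennreal (Q x / N)) ^ (2 * k) \<partial>M) \<le> ennreal (exp (8 * b * c))"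
    using laplace_inverse_power_moment[OF M Q, of "2 * k"] b N k by (simp add: c_def y_def power_mult_distrib mult_ac)
  have "(\<integral>\<^sup>+x. ennreal (R x / N) ^ (2 * k) \<partial>M) \<le> ennreal (exp (4 * ((real k)\<^sup>2 / (N * (1 - 4 * real k / N)))))"
    using laplace_power_moment[OF R', of "2 * k"] N k kb by (simp add: power_mult_distrib)
  also have "\<dots> \<le> ennreal (exp (4 * c))" using cR by (intro ennreal_leI) simp
  finally have Ru: "(\<integral>\<^sup>+x. ennreal (R x / N) ^ (2 * k) \<partial>M) \<le> ennreal (exp (4 * c))" .
  have "(\<integral>\<^sup>+x. inverse (ennreal (R x / N)) ^ (2 * k) \<partial>M) \<le> ennreal (exp (8 * ((real k)\<^sup>2 / (N * (1 - 4 * real k / N)))))"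
    using laplace_inverse_power_moment[OF M R', of "2 * k"] N k kb by (simp add: power_mult_distrib)
  also have "\<dots> \<le> ennreal (exp (8 * c))" using cR by (intro ennreal_leI) simp
  finally have Rl: "(\<integral>\<^sup>+x. inverse (ennreal (R x / N)) ^ (2 * k) \<partial>M) \<le> ennreal (exp (8 * c))" .
  \<comment> \<open>The quotient splits into a product with an inverse only where both variables are
    positive, since real division by 0 returns 0.\<close>
  have AEQ: "AE x in M. Q x / N > 0"
    by (rule AE_pos_of_inverse_power_moment[OF _ Ql]) (use k in auto)
  have AER': "AE x in M. R x / N > 0"
    by (rule AE_pos_of_inverse_power_moment[OF _ Rl]) (use k in auto)
  have K2: "K\<^sup>2 = exp (12 * b * c)"
    by (simp add: K_def c_def y_def power2_eq_square exp_add[symmetric])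
  have K0: "K \<ge> 0" by (simp add: K_def)
  have bc: "c \<le> b * c" using b c0 by (simp add: mult_le_cancel_right1)
  have cs: "(\<integral>\<^sup>+x. f x ^ k * g x ^ k \<partial>M) \<le> ennreal K"
    if [measurable]: "f \<in> borel_measurable M" "g \<in> borel_measurable M"
      and f: "(\<integral>\<^sup>+x. f x ^ (2 * k) \<partial>M) \<le> ennreal (exp u)" and g: "(\<integral>\<^sup>+x. g x ^ (2 * k) \<partial>M) \<le> ennreal (exp w)"
      and uw: "u + w \<le> 12 * b * c" for f g :: "_ \<Rightarrow> ennreal" and u w
  proof (rule ennreal_le_of_power2_le[OF _ K0])
    have "(\<integral>\<^sup>+x. f x ^ k * g x ^ k \<partial>M)\<^sup>2 \<le> (\<integral>\<^sup>+x. (f x ^ k)\<^sup>2 \<partial>M) * (\<integral>\<^sup>+x. (g x ^ k)\<^sup>2 \<partial>M)"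
      by (rule Cauchy_Schwarz_nn_integral) measurable
    also have "\<dots> \<le> ennreal (exp u) * ennreal (exp w)"
      using f g by (intro mult_mono) (auto simp: power_mult[symmetric] mult.commute)
    also have "\<dots> = ennreal (exp (u + w))" by (simp add: ennreal_mult exp_add)
    also have "\<dots> \<le> ennreal (K\<^sup>2)" unfolding K2 using uw by (intro ennreal_leI) simp
    finally show "(\<integral>\<^sup>+x. f x ^ k * g x ^ k \<partial>M)\<^sup>2 \<le> ennreal (K\<^sup>2)" .
  qed
  have ratio: "ennreal (q / r) = ennreal (q / N) * inverse (ennreal (r / N))"
    "inverse (ennreal (q / r)) = inverse (ennreal (q / N)) * ennreal (r / N)" if "q / N > 0" "r / N > 0" for q r
    using that N by (auto simp: zero_less_divide_iff inverse_ennreal ennreal_mult[symmetric] field_simps)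
  have "(\<integral>\<^sup>+x. ennreal (Q x / R x) ^ k \<partial>M) = (\<integral>\<^sup>+x. ennreal (Q x / N) ^ k * inverse (ennreal (R x / N)) ^ k \<partial>M)"
    using AEQ AER'
  proof (intro nn_integral_cong_AE, eventually_elim)
    case (elim x)
    show ?case unfolding ratio(1)[OF elim(3,4)] power_mult_distrib ..
  qed
  also have "\<dots> \<le> ennreal K" using bc by (intro cs[OF _ _ Qu Rl]) auto
  finally show "(\<integral>\<^sup>+x. ennreal (Q x / R x) ^ k \<partial>M) \<le> ennreal K" .
  have "(\<integral>\<^sup>+x. inverse (ennreal (Q x / R x)) ^ k \<partial>M) = (\<integral>\<^sup>+x. inverse (ennreal (Q x / N)) ^ k * ennreal (R x / N) ^ k \<partial>M)"
    using AEQ AER'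
  proof (intro nn_integral_cong_AE, eventually_elim)
    case (elim x)
    show ?case unfolding ratio(2)[OF elim(3,4)] power_mult_distrib ..
  qed
  also have "\<dots> \<le> ennreal K" using bc by (intro cs[OF _ _ Ql Ru]) auto
  finally show "(\<integral>\<^sup>+x. inverse (ennreal (Q x / R x)) ^ k \<partial>M) \<le> ennreal K" .
qed

subsection \<open>Gaussian directions\<close>

definition std_gauss :: "nat \<Rightarrow> (nat \<Rightarrow> real) measure" where
  "std_gauss n = density (\<Pi>\<^sub>M i\<in>{..<n}. lborel) (\<lambda>x. ennreal (exp (- sq_sum n x / 2) / sqrt ((2 * pi) ^ n)))"

lemma sq_sum_measurable [measurable]: "sq_sum n \<in> borel_measurable (\<Pi>\<^sub>M i\<in>{..<n}. lborel)"
  unfolding sq_sum_def by measurable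

lemma sets_std_gauss [measurable_cong, simp]: "sets (std_gauss n) = sets (\<Pi>\<^sub>M i\<in>{..<n}. lborel)"
  by (simp add: std_gauss_def)

text \<open>The Gaussian density adds the identity matrix to the exponent, and its normalisation
  cancels the powers of 2 pi.\<close>

lemma nn_integral_std_gauss:
  assumes pd: "pos_def n (shift_form 1 d S)"
  shows "(\<integral>\<^sup>+x. ennreal (exp (- d * quad_form n S x / 2)) \<partial>std_gauss n)
    = ennreal (1 / sqrt (fun_det n (shift_form 1 d S)))"
proof -
  note G = nn_integral_gaussian[OF pd]
  let ?P = "(2 * pi) ^ n" and ?D = "fun_det n (shift_form 1 d S)"
  have "(\<integral>\<^sup>+x. ennreal (exp (- d * quad_form n S x / 2)) \<partial>std_gauss n)
      = (\<integral>\<^sup>+x. ennreal (exp (- sq_sum n x / 2) / sqrt ?P) * ennreal (exp (- d * quad_form n S x / 2)) \<partial>(\<Pi>\<^sub>M i\<in>{..<n}. lborel))"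
    unfolding std_gauss_def by (rule nn_integral_density) measurable
  also have "\<dots> = (\<integral>\<^sup>+x. ennreal (1 / sqrt ?P) * ennreal (exp (- quad_form n (shift_form 1 d S) x / 2)) \<partial>(\<Pi>\<^sub>M i\<in>{..<n}. lborel))"
  proof (rule nn_integral_cong)
    fix x :: "nat \<Rightarrow> real"
    have "exp (- sq_sum n x / 2) * exp (- d * quad_form n S x / 2) = exp (- quad_form n (shift_form 1 d S) x / 2)"
      unfolding quad_form_shift mult_exp_exp by (simp add: add_divide_distrib)
    then show "ennreal (exp (- sq_sum n x / 2) / sqrt ?P) * ennreal (exp (- d * quad_form n S x / 2))
      = ennreal (1 / sqrt ?P) * ennreal (exp (- quad_form n (shift_form 1 d S) x / 2))"
      by (simp add: ennreal_mult[symmetric])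
  qed
  also have "\<dots> = ennreal (1 / sqrt ?P) * ennreal (sqrt (?P / ?D))"
    using G by (subst nn_integral_cmult) auto
  also have "\<dots> = ennreal (1 / sqrt ?P * sqrt (?P / ?D))"
    using G by (intro ennreal_mult[symmetric]) auto
  also have "1 / sqrt ?P * sqrt (?P / ?D) = 1 / sqrt ?D"
    by (simp add: real_sqrt_divide)
  finally show ?thesis .
qed

lemma prob_space_std_gauss: "prob_space (std_gauss n)"
proof
  \<comment> \<open>At d = 0 the preceding formula computes the total mass.\<close>
  have "pos_def n (shift_form 1 0 (\<lambda>_ _. 0))"
    unfolding pos_def_def by (auto simp: quad_form_shift shift_form_def sq_sum_pos)
  from nn_integral_std_gauss[OF this] show "emeasure (std_gauss n) (space (std_gauss n)) = 1"
    by (simp add: fun_det_one)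
qed

lemma laplace_sq_sum: "laplace_dominated (std_gauss n) (sq_sum n) 1 (real n / 2)"
  unfolding laplace_dominated_def
proof (intro conjI allI impI ballI)
  fix \<theta> :: real assume \<theta>: "1 + \<theta> * 1 > 0"
  \<comment> \<open>The identity matrix, so that the squared length becomes an instance of the
    general quadratic form.\<close>
  define S where "S = shift_form 1 0 (\<lambda>_ _. 0)"
  have S: "shift_form 1 \<theta> S = (\<lambda>i j. (1 + \<theta>) * shift_form 1 0 (\<lambda>_ _. 0) i j)"
    by (intro ext) (simp add: S_def shift_form_def)
  have q: "quad_form n S x = sq_sum n x" for x by (simp add: S_def quad_form_shift)
  have "pos_def n (shift_form 1 \<theta> S)"
    unfolding pos_def_def
  proof (intro conjI allI impI)
    fix x :: "nat \<Rightarrow> real" assume "\<exists>i<n. x i \<noteq> 0"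
    then have "(1 + \<theta>) * sq_sum n x > 0" using sq_sum_pos \<theta> by auto
    then show "0 < quad_form n (shift_form 1 \<theta> S) x" unfolding quad_form_shift q by (simp add: algebra_simps)
  qed (simp add: S_def shift_form_def)
  from nn_integral_std_gauss[OF this]
  have "(\<integral>\<^sup>+x. ennreal (exp (- \<theta> * sq_sum n x / 2)) \<partial>std_gauss n) = ennreal (1 / sqrt ((1 + \<theta>) ^ n))"
    unfolding q S fun_det_scale fun_det_one by simp
  also have "1 / sqrt ((1 + \<theta>) ^ n) = (1 + \<theta> * 1) powr (- (real n / 2))"
    using \<theta> by (simp add: powr_half_sqrt[symmetric] powr_realpow[symmetric] powr_powr powr_minus inverse_eq_divide)
  finally show "(\<integral>\<^sup>+x. ennreal (exp (- \<theta> * sq_sum n x / 2)) \<partial>std_gauss n) \<le> ennreal ((1 + \<theta> * 1) powr (- (real n / 2)))"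
    by simp
qed (auto simp: sq_sum_nonneg)

lemma image_sq_measurable [measurable]: "image_sq n A \<in> borel_measurable (\<Pi>\<^sub>M i\<in>{..<n}. lborel)"
  unfolding image_sq_def sq_sum_def by measurable

text \<open>The determinant enters through its inverse square root, which turns the exponent n / b
  into - n / (2 b).\<close>

lemma laplace_image_sq:
  assumes A: "A \<in> carrier_mat n n" and n: "n \<ge> 1"
    and s: "mean_gram_eigenvalue A > 0"
    and b: "\<forall>e\<in>#gram_eigenvalues A. e \<le> b * mean_gram_eigenvalue A"
  shows "laplace_dominated (std_gauss n) (\<lambda>x. image_sq n A x / mean_gram_eigenvalue A) b (real n / (2 * b))"
  unfolding laplace_dominated_def
proof (intro conjI allI impI ballI)
  let ?s = "mean_gram_eigenvalue A"
  fix \<theta> :: real assume \<theta>: "1 + \<theta> * b > 0"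
  note B = gram_det_bound[OF A n s b]
  let ?D = "fun_det n (shift_form 1 (\<theta> / ?s) (gram A))"
  have "(\<integral>\<^sup>+x. ennreal (exp (- \<theta> * (image_sq n A x / ?s) / 2)) \<partial>std_gauss n) = ennreal (1 / sqrt ?D)"
    using nn_integral_std_gauss[OF B(2)[OF \<theta>]] unfolding quad_form_gram[OF A] by simp
  also have "\<dots> \<le> ennreal (1 / sqrt ((1 + \<theta> * b) powr (real n / b)))"
    using B(3)[OF \<theta>] \<theta> by (intro ennreal_leI divide_left_mono real_sqrt_le_mono mult_pos_pos real_sqrt_gt_zero)
      (auto intro: less_le_trans[OF _ B(3)[OF \<theta>]])
  also have "1 / sqrt ((1 + \<theta> * b) powr (real n / b)) = (1 + \<theta> * b) powr (- (real n / (2 * b)))"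
    using \<theta> by (simp add: powr_half_sqrt[symmetric] powr_powr powr_minus inverse_eq_divide mult.commute)
  finally show "(\<integral>\<^sup>+x. ennreal (exp (- \<theta> * (image_sq n A x / ?s) / 2)) \<partial>std_gauss n) \<le> ennreal ((1 + \<theta> * b) powr (- (real n / (2 * b))))" .
qed (use s in \<open>auto simp: image_sq_nonneg\<close>)

text \<open>The normalised squared stretch; for nonzero x it depends only on the direction of x,
  which is why a vector of any length may represent it.\<close>

definition gain :: "nat \<Rightarrow> real mat \<Rightarrow> (nat \<Rightarrow> real) \<Rightarrow> real" where
  "gain n A x = image_sq n A x / (mean_gram_eigenvalue A * sq_sum n x)"

lemma gain_moments:
  assumes A: "A \<in> carrier_mat n n" and n: "n \<ge> 1"
    and s: "mean_gram_eigenvalue A > 0"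
    and b: "\<forall>e\<in>#gram_eigenvalues A. e \<le> b * mean_gram_eigenvalue A"
    and k: "k > 0" "4 * b * real k < real n"
  defines "K \<equiv> exp (6 * b * (real k)\<^sup>2 / (real n * (1 - 4 * b * real k / real n)))"
  shows "(\<integral>\<^sup>+x. ennreal (gain n A x) ^ k \<partial>std_gauss n) \<le> ennreal K"
    and "(\<integral>\<^sup>+x. inverse (ennreal (gain n A x)) ^ k \<partial>std_gauss n) \<le> ennreal K"
proof -
  have "gain n A = (\<lambda>x. image_sq n A x / mean_gram_eigenvalue A / sq_sum n x)"
    by (simp add: gain_def fun_eq_iff)
  moreover note laplace_ratio_moments[OF prob_space_std_gauss laplace_image_sq[OF A n s b] laplace_sq_sum gram_det_bound(1)[OF A n s b] _ k]
  ultimately show "(\<integral>\<^sup>+x. ennreal (gain n A x) ^ k \<partial>std_gauss n) \<le> ennreal K"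
    "(\<integral>\<^sup>+x. inverse (ennreal (gain n A x)) ^ k \<partial>std_gauss n) \<le> ennreal K"
    unfolding K_def using n by simp_all
qed

text \<open>The indicator of the origin lies below exp (- \<theta> |x|^2 / 2) for every nonnegative
  \<theta>, and the Laplace transform tends to 0 as \<theta> grows.\<close>

lemma AE_std_gauss_sq_sum_pos:
  assumes "n \<ge> 1" shows "AE x in std_gauss n. sq_sum n x > 0"
proof -
  interpret prob_space "std_gauss n" by (rule prob_space_std_gauss)
  have L: "(\<integral>\<^sup>+x. ennreal (exp (- \<theta> * sq_sum n x / 2)) \<partial>std_gauss n) \<le> ennreal ((1 + \<theta>) powr (- (real n / 2)))" if "\<theta> \<ge> 0" for \<theta>
    using laplace_sq_sum[of n] that unfolding laplace_dominated_def by auto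
  define A where "A = {x \<in> space (std_gauss n). \<not> sq_sum n x > 0}"
  have A[measurable]: "A \<in> sets (std_gauss n)" unfolding A_def by measurable
  have le: "emeasure (std_gauss n) A \<le> ennreal ((1 + \<theta>) powr (- (real n / 2)))" if "\<theta> \<ge> 0" for \<theta>
  proof -
    have "emeasure (std_gauss n) A = (\<integral>\<^sup>+x. indicator A x \<partial>std_gauss n)"
      by (rule nn_integral_indicator[symmetric]) measurable
    also have "\<dots> \<le> (\<integral>\<^sup>+x. ennreal (exp (- \<theta> * sq_sum n x / 2)) \<partial>std_gauss n)"
    proof (intro nn_integral_mono)
      fix x
      have "sq_sum n x = 0" if "x \<in> A" using that sq_sum_nonneg[of n x] unfolding A_def by auto
      then show "indicator A x \<le> ennreal (exp (- \<theta> * sq_sum n x / 2))"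
        by (auto simp: indicator_def)
    qed
    finally show ?thesis using L[OF that] by (rule order.trans)
  qed
  have "((\<lambda>\<theta>. ennreal ((1 + \<theta>) powr (- (real n / 2)))) \<longlongrightarrow> ennreal 0) at_top"
    using assms by (intro tendsto_ennrealI tendsto_neg_powr filterlim_tendsto_add_at_top[OF tendsto_const filterlim_ident]) auto
  moreover have "\<forall>\<^sub>F \<theta> in at_top. emeasure (std_gauss n) A \<le> ennreal ((1 + \<theta>) powr (- (real n / 2)))"
    using eventually_ge_at_top[of 0] by eventually_elim (rule le)
  ultimately have "emeasure (std_gauss n) A \<le> ennreal 0"
    by (rule tendsto_lowerbound) simp
  then show ?thesis
    using A by (intro AE_I[of _ _ A]) (auto simp: A_def)
qed

subsection \<open>Rotational invariance and averaging over directions\<close>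

definition app :: "nat \<Rightarrow> (nat \<Rightarrow> nat \<Rightarrow> real) \<Rightarrow> (nat \<Rightarrow> real) \<Rightarrow> nat \<Rightarrow> real" where
  "app n U x i = (\<Sum>j<n. U i j * x j)"

text \<open>Reflections already map any vector to any other of the same length, so symmetric
  orthogonal matrices suffice. They are their own inverses, and no transposes appear in the
  conjugations below.\<close>

definition sym_orth :: "nat \<Rightarrow> (nat \<Rightarrow> nat \<Rightarrow> real) \<Rightarrow> bool" where
  "sym_orth n U \<longleftrightarrow> (\<forall>i<n. \<forall>j<n. U i j = U j i) \<and>
    (\<forall>i<n. \<forall>j<n. (\<Sum>k<n. U i k * U k j) = (if i = j then 1 else 0))"

lemma sq_sum_app_sym_orth:
  assumes "sym_orth n U" shows "sq_sum n (app n U x) = sq_sum n x"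
proof -
  have sym: "U i j = U j i" and orth: "(\<Sum>k<n. U i k * U k j) = (if i = j then 1 else 0)"
    if "i < n" "j < n" for i j
    using assms that unfolding sym_orth_def by blast+
  have "sq_sum n (app n U x) = (\<Sum>k<n. \<Sum>i<n. \<Sum>j<n. U k i * U k j * (x i * x j))"
    unfolding sq_sum_def app_def power2_eq_square sum_product by (simp add: mult_ac)
  also have "\<dots> = (\<Sum>i<n. \<Sum>k<n. \<Sum>j<n. U k i * U k j * (x i * x j))" by (rule sum.swap)
  also have "\<dots> = (\<Sum>i<n. \<Sum>j<n. \<Sum>k<n. U k i * U k j * (x i * x j))"
    by (intro sum.cong refl sum.swap)
  also have "\<dots> = (\<Sum>i<n. \<Sum>j<n. (\<Sum>k<n. U i k * U k j) * (x i * x j))"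
    unfolding sum_distrib_right using sym by (intro sum.cong refl) auto
  also have "\<dots> = (\<Sum>i<n. \<Sum>j<n. if i = j then x i * x j else 0)"
    using orth by (intro sum.cong refl) auto
  also have "\<dots> = sq_sum n x"
    by (simp add: sq_sum_def power2_eq_square)
  finally show ?thesis .
qed

text \<open>The reflection in the hyperplane orthogonal to x - y exchanges two vectors of equal
  length. If they agree the hyperplane is undefined, and the identity is used.\<close>

lemma householder:
  assumes eq: "sq_sum n x = sq_sum n y"
  obtains U where "sym_orth n U" "\<And>i. i < n \<Longrightarrow> app n U y i = x i"
proof (cases "\<exists>i<n. x i \<noteq> y i")
  case False
  have "sym_orth n (\<lambda>i j. if i = j then 1 else 0)"
    by (simp add: sym_orth_def if_distrib[of "\<lambda>c. c * _"] cong: if_cong)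
  moreover have "app n (\<lambda>i j. if i = j then 1 else 0) y i = x i" if "i < n" for i
    using False that by (simp add: app_def if_distrib[of "\<lambda>c. c * _"] cong: if_cong)
  ultimately show ?thesis by (rule that)
next
  case True
  define w where "w i = x i - y i" for i
  define W where "W = sq_sum n w"
  have W: "W > 0" using True unfolding W_def w_def by (auto intro: sq_sum_pos)
  have WW: "W = (\<Sum>k<n. w k * w k)" by (simp add: W_def sq_sum_def power2_eq_square)
  define U where "U i j = (if i = j then 1 else 0) - 2 / W * (w i * w j)" for i j
  have "(\<Sum>k<n. U i k * U k j) = (if i = j then 1 else 0)" if "i < n" "j < n" for i j
  proof -
    define c where "c = 2 / W * (w i * w j)"
    have "(\<Sum>k<n. U i k * U k j) = (\<Sum>k<n. (if k = i then if i = j then 1 else 0 else 0)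
        - (if k = i then c else 0) - (if k = j then c else 0) + 2 / W * c * (w k * w k))"
      by (intro sum.cong refl) (auto simp: U_def c_def algebra_simps)
    also have "\<dots> = (if i = j then 1 else 0) - c - c + 2 / W * c * W"
      unfolding sum.distrib sum_subtractf WW sum_distrib_left using that by simp
    also have "2 / W * c * W = 2 * c" using W by simp
    finally show ?thesis by simp
  qed
  then have "sym_orth n U" unfolding sym_orth_def by (simp add: U_def mult.commute)
  moreover have "app n U y i = x i" if "i < n" for i
  proof -
    have "app n U y i = (\<Sum>j<n. (if j = i then y i else 0) - 2 / W * w i * (w j * y j))"
      unfolding app_def by (intro sum.cong refl) (auto simp: U_def algebra_simps)
    also have "\<dots> = y i - 2 / W * w i * (\<Sum>j<n. w j * y j)"
      unfolding sum_subtractf sum_distrib_left using that by simp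
    also have "\<dots> = y i + w i"
    proof -
      \<comment> \<open>Equal lengths force <x - y, y> = - |x - y|^2 / 2, which is what makes the
        reflection add exactly x - y to y.\<close>
      have "W + 2 * (\<Sum>j<n. w j * y j) = (\<Sum>j<n. (x j)\<^sup>2 - (y j)\<^sup>2)"
        unfolding WW sum_distrib_left sum.distrib[symmetric]
        by (intro sum.cong refl) (simp add: w_def power2_eq_square algebra_simps)
      also have "\<dots> = 0" using eq by (simp add: sq_sum_def sum_subtractf)
      finally have "(\<Sum>j<n. w j * y j) = - W / 2" by simp
      then show ?thesis using W by simp
    qed
    finally show ?thesis by (simp add: w_def)
  qed
  ultimately show ?thesis by (rule that)
qed


section \<open>Matrices as families of entries\<close>

lemma measurable_entry:
  assumes "i < n" "j < n"
  shows "(\<lambda>A. A $$ (i, j)) \<in> borel_measurable (mat_borel n)"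
proof -
  have "(\<lambda>A. \<lambda>p\<in>{..<n} \<times> {..<n}. A $$ p) \<in> measurable (mat_borel n) (\<Pi>\<^sub>M p\<in>{..<n} \<times> {..<n}. (borel :: real measure))"
    unfolding mat_borel_def by (intro measurable_vimage_algebra1) (auto simp: space_PiM)
  from measurable_compose[OF this measurable_component_singleton[of "(i, j)"]]
  show ?thesis using assms by simp
qed

lemma space_mat_borel [simp]: "space (mat_borel n) = carrier_mat n n"
  by (simp add: mat_borel_def)

text \<open>The trace of the Gram matrix is the squared Frobenius norm. In this form the mean
  eigenvalue is visibly measurable and can be seen to be invariant under orthogonal
  conjugation.\<close>

lemma mean_gram_eigenvalue_entries:
  assumes "A \<in> carrier_mat n n"
  shows "mean_gram_eigenvalue A = (\<Sum>i<n. \<Sum>j<n. (A $$ (i, j))\<^sup>2) / real n"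
proof -
  have "mat_trace (transpose_mat A * A) = (\<Sum>j<n. \<Sum>i<n. (A $$ (i, j))\<^sup>2)"
    using assms by (auto simp: mat_trace_def scalar_prod_def atLeast0LessThan power2_eq_square intro!: sum.cong)
  also have "\<dots> = (\<Sum>i<n. \<Sum>j<n. (A $$ (i, j))\<^sup>2)" by (rule sum.swap)
  finally show ?thesis using mean_gram_eigenvalue_eq_trace[OF assms] by simp
qed

text \<open>\<open>gain\<close> with the matrix replaced by its array of entries and the mean
  eigenvalue by the Frobenius norm, so that it can be evaluated on a finite family of scalar
  products, the only objects that \<open>rotationally_invariant\<close> speaks of.\<close>

definition entry_gain :: "nat \<Rightarrow> (nat \<Rightarrow> nat \<Rightarrow> real) \<Rightarrow> (nat \<Rightarrow> real) \<Rightarrow> real" where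
  "entry_gain n Y x = sq_sum n (app n Y x) / ((\<Sum>i<n. sq_sum n (Y i)) / real n * sq_sum n x)"

lemma gain_eq_entry_gain:
  assumes "A \<in> carrier_mat n n"
  shows "gain n A x = entry_gain n (\<lambda>i j. A $$ (i, j)) x"
  unfolding gain_def entry_gain_def mean_gram_eigenvalue_entries[OF assms] image_sq_def
  by (simp add: sq_sum_def app_def)

lemma sq_sum_cong: "(\<And>i. i < n \<Longrightarrow> x i = y i) \<Longrightarrow> sq_sum n x = sq_sum n y"
  unfolding sq_sum_def by (intro sum.cong refl) auto

lemma app_cong: "(\<And>i. i < n \<Longrightarrow> x i = y i) \<Longrightarrow> app n U x = app n U y"
  unfolding app_def by (intro ext sum.cong refl) auto

text \<open>The matrix product U Y U, written column by column; for symmetric orthogonal U it is the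
  conjugate of Y.\<close>

definition conj_entries :: "nat \<Rightarrow> (nat \<Rightarrow> nat \<Rightarrow> real) \<Rightarrow> (nat \<Rightarrow> nat \<Rightarrow> real) \<Rightarrow> nat \<Rightarrow> nat \<Rightarrow> real" where
  "conj_entries n U Y i j = app n U (\<lambda>k. app n Y (\<lambda>l. U l j) k) i"

lemma sum_sq_sum_swap: "(\<Sum>i<n. sq_sum n (Y i)) = (\<Sum>j<n. sq_sum n (\<lambda>i. Y i j))"
  unfolding sq_sum_def by (rule sum.swap)

text \<open>The outer U preserves lengths, and the inner one can be moved onto x.\<close>

lemma entry_gain_conj:
  assumes U: "sym_orth n U"
  shows "entry_gain n (conj_entries n U Y) x = entry_gain n Y (app n U x)"
proof -
  have sym: "U i j = U j i" if "i < n" "j < n" for i j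
    using U that unfolding sym_orth_def by blast
  have "app n (conj_entries n U Y) x i = app n U (app n Y (app n U x)) i" for i
  proof -
    have "app n (conj_entries n U Y) x i = (\<Sum>j<n. \<Sum>k<n. \<Sum>l<n. U i k * Y k l * U l j * x j)"
      unfolding app_def conj_entries_def by (simp only: sum_distrib_left sum_distrib_right mult.assoc)
    also have "\<dots> = (\<Sum>k<n. \<Sum>j<n. \<Sum>l<n. U i k * Y k l * U l j * x j)" by (rule sum.swap)
    also have "\<dots> = (\<Sum>k<n. \<Sum>l<n. \<Sum>j<n. U i k * Y k l * U l j * x j)"
      by (intro sum.cong refl sum.swap)
    also have "\<dots> = app n U (app n Y (app n U x)) i"
      unfolding app_def by (simp only: sum_distrib_left mult.assoc)
    finally show ?thesis .
  qed
  then have "app n (conj_entries n U Y) x = app n U (app n Y (app n U x))" by (rule ext)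
  then have 1: "sq_sum n (app n (conj_entries n U Y) x) = sq_sum n (app n Y (app n U x))"
    using sq_sum_app_sym_orth[OF U] by simp
  \<comment> \<open>Invariance of the Frobenius norm: the left factor U preserves the length of each
    column; read by rows, the right factor preserves the length of each row.\<close>
  have "(\<Sum>i<n. sq_sum n (conj_entries n U Y i)) = (\<Sum>j<n. sq_sum n (app n U (\<lambda>k. app n Y (\<lambda>l. U l j) k)))"
    by (subst sum_sq_sum_swap) (simp add: conj_entries_def)
  also have "\<dots> = (\<Sum>j<n. sq_sum n (\<lambda>k. app n Y (\<lambda>l. U l j) k))"
    using sq_sum_app_sym_orth[OF U] by simp
  also have "\<dots> = (\<Sum>k<n. sq_sum n (\<lambda>j. app n Y (\<lambda>l. U l j) k))"
    by (rule sum_sq_sum_swap[symmetric])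
  also have "\<dots> = (\<Sum>k<n. sq_sum n (app n U (Y k)))"
    using sym by (intro sum.cong refl sq_sum_cong) (auto simp: app_def mult.commute intro!: sum.cong)
  also have "\<dots> = (\<Sum>k<n. sq_sum n (Y k))" using sq_sum_app_sym_orth[OF U] by simp
  finally show ?thesis
    unfolding entry_gain_def 1 sq_sum_app_sym_orth[OF U] by simp
qed

lemma entry_gain_scale:
  assumes "c \<noteq> 0" shows "entry_gain n Y (\<lambda>i. c * x i) = entry_gain n Y x"
proof -
  have s: "sq_sum n (\<lambda>i. c * y i) = c\<^sup>2 * sq_sum n y" for y
    by (simp add: sq_sum_def power_mult_distrib sum_distrib_left)
  have "app n Y (\<lambda>i. c * x i) = (\<lambda>i. c * app n Y x i)"
    by (simp add: app_def fun_eq_iff sum_distrib_left mult_ac)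
  then show ?thesis unfolding entry_gain_def using assms by (simp add: s)
qed

lemma scalar_prod_mult_mat_vec_entries:
  assumes "A \<in> carrier_mat n n"
  shows "scalar_prod (Matrix.vec n a) (A *\<^sub>v Matrix.vec n b) = (\<Sum>k<n. a k * app n (\<lambda>k l. A $$ (k, l)) b k)"
  using assms by (auto simp: scalar_prod_def app_def atLeast0LessThan intro!: sum.cong)

text \<open>The functional h may involve all entries, so their joint law is what matters.
  Measurability in the flattened coordinates and \<open>h_cong\<close> express that h sees only the
  n * n entries in range.\<close>

lemma rotational_invariance_conj_entries:
  fixes h :: "(nat \<Rightarrow> nat \<Rightarrow> real) \<Rightarrow> ennreal"
  assumes P: "prob_space P" and X: "X \<in> measurable P (mat_borel n)" and rot: "rotationally_invariant P n X"
    and n: "n \<ge> 1" and U: "sym_orth n U"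
    and h: "(\<lambda>z. h (\<lambda>i j. z (i * n + j))) \<in> borel_measurable (\<Pi>\<^sub>M i\<in>{..<n * n}. borel)"
    and h_cong: "\<And>Y Z. (\<And>i j. i < n \<Longrightarrow> j < n \<Longrightarrow> Y i j = Z i j) \<Longrightarrow> h Y = h Z"
  shows "(\<integral>\<^sup>+\<omega>. h (\<lambda>i j. X \<omega> $$ (i, j)) \<partial>P) = (\<integral>\<^sup>+\<omega>. h (conj_entries n U (\<lambda>i j. X \<omega> $$ (i, j))) \<partial>P)"
proof -
  interpret prob_space P by fact
  have carrier: "X \<omega> \<in> carrier_mat n n" if "\<omega> \<in> space P" for \<omega>
    using measurable_space[OF X that] by simp
  have [measurable]: "(\<lambda>\<omega>. X \<omega> $$ (i, j)) \<in> borel_measurable P" if "i < n" "j < n" for i j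
    using measurable_compose[OF X measurable_entry[OF that]] .
  have sym: "U i j = U j i" if "i < n" "j < n" for i j
    using U that unfolding sym_orth_def by blast
  define e :: "nat \<Rightarrow> real Matrix.vec" where "e i = Matrix.vec n (\<lambda>k. if k = i then 1 else 0)" for i
  define V where "V = Matrix.mat n n (\<lambda>(i, j). U i j)"
  have V: "orthogonal_matrix_dim n V"
    unfolding orthogonal_matrix_dim_def
  proof
    show "transpose_mat V * V = 1\<^sub>m n"
    proof (rule eq_matI)
      fix i j assume "i < dim_row (1\<^sub>m n :: real mat)" "j < dim_col (1\<^sub>m n :: real mat)"
      then have ij: "i < n" "j < n" by auto
      then have "(transpose_mat V * V) $$ (i, j) = (\<Sum>k<n. U k i * U k j)"
        by (auto simp: V_def scalar_prod_def atLeast0LessThan)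
      also have "\<dots> = (\<Sum>k<n. U i k * U k j)" using sym ij by (intro sum.cong refl) auto
      also have "\<dots> = (if i = j then 1 else 0)" using U ij unfolding sym_orth_def by blast
      finally show "(transpose_mat V * V) $$ (i, j) = 1\<^sub>m n $$ (i, j)" using ij by simp
    qed (auto simp: V_def)
  qed (simp add: V_def)
  have Ve: "V *\<^sub>v e i = Matrix.vec n (\<lambda>k. U k i)" if "i < n" for i
    using that by (intro eq_vecI)
      (auto simp: V_def e_def scalar_prod_def atLeast0LessThan if_distrib[of "\<lambda>c. _ * c"] cong: if_cong)
  \<comment> \<open>The hypothesis is used with k = n * n, the pairs of basis vectors (e_i, e_j)
    being listed at p = i * n + j: \<open>a\<close> lists the entries of X, and \<open>b\<close>
    below those of U X U.\<close>
  define a where "a \<omega> = (\<lambda>p\<in>{..<n * n}. scalar_prod (e (p div n)) (X \<omega> *\<^sub>v e (p mod n)))" for \<omega>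
  define b where "b \<omega> = (\<lambda>p\<in>{..<n * n}. scalar_prod (V *\<^sub>v e (p div n)) (X \<omega> *\<^sub>v (V *\<^sub>v e (p mod n))))" for \<omega>
  have distr: "distr P (\<Pi>\<^sub>M i\<in>{..<n * n}. borel) a = distr P (\<Pi>\<^sub>M i\<in>{..<n * n}. borel) b"
    unfolding a_def b_def
    by (rule rot[unfolded rotationally_invariant_def, rule_format]) (use n V in \<open>auto simp: e_def\<close>)
  have index: "i * n + j < n * n" if "i < n" "j < n" for i j
  proof -
    have "i * n + j < Suc i * n" using that by simp
    also have "\<dots> \<le> n * n" using that by (intro mult_le_mono1) simp
    finally show ?thesis .
  qed
  have bounds: "p div n < n" "p mod n < n" if "p < n * n" for p
    using that n by (auto simp: less_mult_imp_div_less)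
  have a: "a \<omega> (i * n + j) = X \<omega> $$ (i, j)" if "i < n" "j < n" "\<omega> \<in> space P" for i j \<omega>
  proof -
    have "a \<omega> (i * n + j) = (\<Sum>k<n. (if k = i then 1 else 0) * (\<Sum>l<n. X \<omega> $$ (k, l) * (if l = j then 1 else 0)))"
      using that index[OF that(1,2)] scalar_prod_mult_mat_vec_entries[OF carrier[OF that(3)]]
      by (simp add: a_def e_def app_def)
    then show ?thesis using that
      by (simp add: if_distrib[of "\<lambda>c. c * _"] if_distrib[of "\<lambda>c. _ * c"] cong: if_cong)
  qed
  have b: "b \<omega> (i * n + j) = conj_entries n U (\<lambda>i j. X \<omega> $$ (i, j)) i j" if "i < n" "j < n" "\<omega> \<in> space P" for i j \<omega>
  proof -
    have "b \<omega> (i * n + j) = (\<Sum>k<n. U k i * app n (\<lambda>k l. X \<omega> $$ (k, l)) (\<lambda>l. U l j) k)"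
      using that index[OF that(1,2)] scalar_prod_mult_mat_vec_entries[OF carrier[OF that(3)]]
      by (simp add: b_def Ve)
    also have "\<dots> = conj_entries n U (\<lambda>i j. X \<omega> $$ (i, j)) i j"
      unfolding conj_entries_def app_def[of n U] using sym that by (intro sum.cong refl) auto
    finally show ?thesis .
  qed
  \<comment> \<open>Equality of the two \<open>distr\<close> measures transfers integrals only for
    measurable maps, so \<open>a\<close> and \<open>b\<close> are identified with measurable
    families of entries.\<close>
  have am: "a \<in> measurable P (\<Pi>\<^sub>M i\<in>{..<n * n}. borel)"
  proof -
    have "(\<lambda>\<omega>. \<lambda>p\<in>{..<n * n}. X \<omega> $$ (p div n, p mod n)) \<in> measurable P (\<Pi>\<^sub>M i\<in>{..<n * n}. borel)"
      using bounds by (intro measurable_restrict) auto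
    moreover have "a \<omega> = (\<lambda>p\<in>{..<n * n}. X \<omega> $$ (p div n, p mod n))" if "\<omega> \<in> space P" for \<omega>
    proof
      fix p show "a \<omega> p = (\<lambda>p\<in>{..<n * n}. X \<omega> $$ (p div n, p mod n)) p"
        using a[of "p div n" "p mod n" \<omega>] bounds[of p] that by (cases "p < n * n") (auto simp: a_def)
    qed
    ultimately show ?thesis by (simp cong: measurable_cong)
  qed
  have bm: "b \<in> measurable P (\<Pi>\<^sub>M i\<in>{..<n * n}. borel)"
  proof -
    have "(\<lambda>\<omega>. conj_entries n U (\<lambda>i j. X \<omega> $$ (i, j)) i j) \<in> borel_measurable P" if "i < n" "j < n" for i j
      unfolding conj_entries_def app_def using that by measurable
    then have "(\<lambda>\<omega>. \<lambda>p\<in>{..<n * n}. conj_entries n U (\<lambda>i j. X \<omega> $$ (i, j)) (p div n) (p mod n)) \<in> measurable P (\<Pi>\<^sub>M i\<in>{..<n * n}. borel)"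
      using bounds by (intro measurable_restrict) auto
    moreover have "b \<omega> = (\<lambda>p\<in>{..<n * n}. conj_entries n U (\<lambda>i j. X \<omega> $$ (i, j)) (p div n) (p mod n))" if "\<omega> \<in> space P" for \<omega>
    proof
      fix p show "b \<omega> p = (\<lambda>p\<in>{..<n * n}. conj_entries n U (\<lambda>i j. X \<omega> $$ (i, j)) (p div n) (p mod n)) p"
        using b[of "p div n" "p mod n" \<omega>] bounds[of p] that by (cases "p < n * n") (auto simp: b_def)
    qed
    ultimately show ?thesis by (simp cong: measurable_cong)
  qed
  have "(\<integral>\<^sup>+\<omega>. h (\<lambda>i j. X \<omega> $$ (i, j)) \<partial>P) = (\<integral>\<^sup>+\<omega>. h (\<lambda>i j. a \<omega> (i * n + j)) \<partial>P)"
    by (intro nn_integral_cong h_cong) (simp add: a)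
  also have "\<dots> = (\<integral>\<^sup>+z. h (\<lambda>i j. z (i * n + j)) \<partial>distr P (\<Pi>\<^sub>M i\<in>{..<n * n}. borel) a)"
    using am h by (simp add: nn_integral_distr)
  also have "\<dots> = (\<integral>\<^sup>+\<omega>. h (\<lambda>i j. b \<omega> (i * n + j)) \<partial>P)"
    unfolding distr using bm h by (simp add: nn_integral_distr)
  also have "\<dots> = (\<integral>\<^sup>+\<omega>. h (conj_entries n U (\<lambda>i j. X \<omega> $$ (i, j))) \<partial>P)"
    by (intro nn_integral_cong h_cong) (simp add: b)
  finally show ?thesis .
qed

text \<open>Rescaling y to the length of x does not change the gain; a reflection then exchanges the
  two vectors, and it is absorbed by conjugating the matrix.\<close>

lemma rotational_invariance_gain:
  fixes \<phi> :: "real \<Rightarrow> ennreal"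
  assumes P: "prob_space P" and X: "X \<in> measurable P (mat_borel n)" and rot: "rotationally_invariant P n X"
    and n: "n \<ge> 1" and \<phi>[measurable]: "\<phi> \<in> borel_measurable borel"
    and x: "sq_sum n x > 0" and y: "sq_sum n y > 0"
  shows "(\<integral>\<^sup>+\<omega>. \<phi> (gain n (X \<omega>) x) \<partial>P) = (\<integral>\<^sup>+\<omega>. \<phi> (gain n (X \<omega>) y) \<partial>P)"
proof -
  have carrier: "X \<omega> \<in> carrier_mat n n" if "\<omega> \<in> space P" for \<omega>
    using measurable_space[OF X that] by simp
  define c where "c = sqrt (sq_sum n x / sq_sum n y)"
  have c: "c > 0" "c\<^sup>2 = sq_sum n x / sq_sum n y" using x y by (auto simp: c_def)
  have "sq_sum n (\<lambda>i. c * y i) = c\<^sup>2 * sq_sum n y"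
    by (simp add: sq_sum_def power_mult_distrib sum_distrib_left)
  then have "sq_sum n (\<lambda>i. c * y i) = sq_sum n x" using c y by simp
  then obtain U where U: "sym_orth n U" "\<And>i. i < n \<Longrightarrow> app n U x i = c * y i"
    using householder by blast
  have index: "i * n + j < n * n" if "i < n" "j < n" for i j
  proof -
    have "i * n + j < Suc i * n" using that by simp
    also have "\<dots> \<le> n * n" using that by (intro mult_le_mono1) simp
    finally show ?thesis .
  qed
  have "(\<integral>\<^sup>+\<omega>. \<phi> (gain n (X \<omega>) x) \<partial>P) = (\<integral>\<^sup>+\<omega>. \<phi> (entry_gain n (\<lambda>i j. X \<omega> $$ (i, j)) x) \<partial>P)"
    using carrier by (intro nn_integral_cong) (simp add: gain_eq_entry_gain)
  also have "\<dots> = (\<integral>\<^sup>+\<omega>. \<phi> (entry_gain n (conj_entries n U (\<lambda>i j. X \<omega> $$ (i, j))) x) \<partial>P)"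
  proof (rule rotational_invariance_conj_entries[OF P X rot n U(1)])
    have [measurable]: "(\<lambda>z. z (i * n + j)) \<in> borel_measurable (\<Pi>\<^sub>M i\<in>{..<n * n}. (borel :: real measure))"
      if "i < n" "j < n" for i j using index[OF that] by (intro measurable_component_singleton) simp
    show "(\<lambda>z. \<phi> (entry_gain n (\<lambda>i j. z (i * n + j)) x)) \<in> borel_measurable (\<Pi>\<^sub>M i\<in>{..<n * n}. borel)"
      unfolding entry_gain_def sq_sum_def app_def by measurable
    fix Y Z :: "nat \<Rightarrow> nat \<Rightarrow> real" assume YZ: "\<And>i j. i < n \<Longrightarrow> j < n \<Longrightarrow> Y i j = Z i j"
    have "sq_sum n (app n Y x) = sq_sum n (app n Z x)"
      using YZ by (intro sq_sum_cong) (auto simp: app_def intro!: sum.cong)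
    moreover have "(\<Sum>i<n. sq_sum n (Y i)) = (\<Sum>i<n. sq_sum n (Z i))"
      using YZ by (intro sum.cong refl sq_sum_cong) auto
    ultimately show "\<phi> (entry_gain n Y x) = \<phi> (entry_gain n Z x)" by (simp add: entry_gain_def)
  qed
  also have "\<dots> = (\<integral>\<^sup>+\<omega>. \<phi> (entry_gain n (\<lambda>i j. X \<omega> $$ (i, j)) y) \<partial>P)"
  proof -
    have "entry_gain n Y (app n U x) = entry_gain n Y y" for Y
    proof -
      have "entry_gain n Y (app n U x) = entry_gain n Y (\<lambda>i. c * y i)"
        unfolding entry_gain_def using app_cong[OF U(2)] sq_sum_cong[OF U(2)] by simp
      then show ?thesis using c by (simp add: entry_gain_scale)
    qed
    then show ?thesis unfolding entry_gain_conj[OF U(1)] by simp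
  qed
  also have "\<dots> = (\<integral>\<^sup>+\<omega>. \<phi> (gain n (X \<omega>) y) \<partial>P)"
    using carrier by (intro nn_integral_cong) (simp add: gain_eq_entry_gain)
  finally show ?thesis .
qed

lemma rotational_invariance_average:
  fixes \<phi> :: "real \<Rightarrow> ennreal"
  assumes P: "prob_space P" and X: "X \<in> measurable P (mat_borel n)" and rot: "rotationally_invariant P n X"
    and n: "n \<ge> 1" and \<phi>[measurable]: "\<phi> \<in> borel_measurable borel"
    and bound: "AE \<omega> in P. (\<integral>\<^sup>+g. \<phi> (gain n (X \<omega>) g) \<partial>std_gauss n) \<le> K"
    and x: "sq_sum n x > 0"
  shows "(\<integral>\<^sup>+\<omega>. \<phi> (gain n (X \<omega>) x) \<partial>P) \<le> K"
proof -
  interpret P: prob_space P by fact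
  interpret G: prob_space "std_gauss n" by (rule prob_space_std_gauss)
  interpret PG: pair_sigma_finite P "std_gauss n" ..
  have carrier: "X \<omega> \<in> carrier_mat n n" if "\<omega> \<in> space P" for \<omega>
    using measurable_space[OF X that] by simp
  have [measurable]: "(\<lambda>\<omega>. X \<omega> $$ (i, j)) \<in> borel_measurable P" if "i < n" "j < n" for i j
    using measurable_compose[OF X measurable_entry[OF that]] .
  have m: "(\<lambda>(\<omega>, g). \<phi> (gain n (X \<omega>) g)) \<in> borel_measurable (P \<Otimes>\<^sub>M std_gauss n)"
  proof -
    have "(\<lambda>g. g j) \<in> borel_measurable (std_gauss n)" if "j < n" for j
      using measurable_component_singleton[of j "{..<n}" "\<lambda>_. lborel :: real measure"] that
      by (simp cong: measurable_cong_sets)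
    from measurable_compose[OF measurable_snd this]
    have [measurable]: "(\<lambda>p. snd p j) \<in> borel_measurable (P \<Otimes>\<^sub>M std_gauss n)" if "j < n" for j
      using that by simp
    have "(\<lambda>p. \<phi> (entry_gain n (\<lambda>i j. X (fst p) $$ (i, j)) (snd p))) \<in> borel_measurable (P \<Otimes>\<^sub>M std_gauss n)"
      unfolding entry_gain_def sq_sum_def app_def by measurable
    then show ?thesis
      using carrier by (subst measurable_cong) (auto simp: gain_eq_entry_gain space_pair_measure split_beta)
  qed
  \<comment> \<open>The integral over \<omega> is constant in g and \<open>std_gauss\<close> has
    mass 1, so g can be introduced first and then take the place of x for almost every g.\<close>
  have "(\<integral>\<^sup>+\<omega>. \<phi> (gain n (X \<omega>) x) \<partial>P) = (\<integral>\<^sup>+g. (\<integral>\<^sup>+\<omega>. \<phi> (gain n (X \<omega>) x) \<partial>P) \<partial>std_gauss n)"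
    by (simp add: G.emeasure_space_1)
  also have "\<dots> = (\<integral>\<^sup>+g. (\<integral>\<^sup>+\<omega>. \<phi> (gain n (X \<omega>) g) \<partial>P) \<partial>std_gauss n)"
    using AE_std_gauss_sq_sum_pos[OF n]
    by (intro nn_integral_cong_AE, eventually_elim) (rule rotational_invariance_gain[OF P X rot n \<phi> x])
  also have "\<dots> = (\<integral>\<^sup>+\<omega>. (\<integral>\<^sup>+g. \<phi> (gain n (X \<omega>) g) \<partial>std_gauss n) \<partial>P)"
    using PG.Fubini'[OF m] by simp
  also have "\<dots> \<le> (\<integral>\<^sup>+\<omega>. K \<partial>P)"
    by (rule nn_integral_mono_AE) (rule bound)
  also have "\<dots> = K" by (simp add: P.emeasure_space_1)
  finally show ?thesis .
qed

subsection \<open>Products of independent matrices\<close>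

text \<open>Takes a plain sequence of matrices, so that it can be read both along random matrices
  and on a product space. Coordinates from N on are out-of-range entries without meaning; lengths
  and products use only those below N.\<close>

fun orbit :: "nat \<Rightarrow> (nat \<Rightarrow> real) \<Rightarrow> (nat \<Rightarrow> real mat) \<Rightarrow> nat \<Rightarrow> nat \<Rightarrow> real" where
  "orbit N v x 0 = v"
| "orbit N v x (Suc n) = app N (\<lambda>i j. x (Suc n) $$ (i, j)) (orbit N v x n)"

lemma image_sq_eq_sq_sum_app: "image_sq n A x = sq_sum n (app n (\<lambda>i j. A $$ (i, j)) x)"
  by (simp add: image_sq_def app_def[abs_def])

lemma mat_product_orbit:
  assumes v: "v \<in> carrier_vec N" and X: "\<And>i. i \<ge> 1 \<Longrightarrow> X i \<omega> \<in> carrier_mat N N"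
  shows "mat_product N X n \<omega> \<in> carrier_mat N N"
    and "mat_product N X n \<omega> *\<^sub>v v = Matrix.vec N (orbit N (\<lambda>i. v $ i) (\<lambda>i. X i \<omega>) n)"
proof (induction n)
  case 0
  { case 1 then show ?case by simp }
  { case 2 then show ?case using v by (intro eq_vecI) auto }
next
  case (Suc n)
  have X': "X (Suc n) \<omega> \<in> carrier_mat N N" by (rule X) simp
  { case 1 then show ?case using Suc.IH(1) X' by simp }
  { case 2
    have "mat_product N X (Suc n) \<omega> *\<^sub>v v = X (Suc n) \<omega> *\<^sub>v (mat_product N X n \<omega> *\<^sub>v v)"
      using Suc.IH(1) X' v by (simp add: assoc_mult_mat_vec[of _ N N _ N])
    also have "\<dots> = Matrix.vec N (orbit N (\<lambda>i. v $ i) (\<lambda>i. X i \<omega>) (Suc n))"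
      unfolding Suc.IH(2) using X'
      by (intro eq_vecI) (auto simp: app_def scalar_prod_def atLeast0LessThan intro!: sum.cong)
    finally show ?case . }
qed

lemma eucl_norm_sq_vec: "(eucl_norm (Matrix.vec N x))\<^sup>2 = sq_sum N x"
proof -
  have "scalar_prod (Matrix.vec N x) (Matrix.vec N x) = sq_sum N x"
    by (simp add: scalar_prod_def sq_sum_def power2_eq_square atLeast0LessThan)
  then show ?thesis by (simp add: eucl_norm_def sq_sum_nonneg)
qed

lemma orbit_cong: "(\<And>i. 1 \<le> i \<Longrightarrow> i \<le> n \<Longrightarrow> x i = y i) \<Longrightarrow> orbit N v x n = orbit N v y n"
  by (induction n) auto

lemma measurable_orbit:
  assumes "{1..n} \<subseteq> I" "j < N"
  shows "(\<lambda>x. orbit N v x n j) \<in> borel_measurable (\<Pi>\<^sub>M i\<in>I. mat_borel N)"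
  using assms
proof (induction n arbitrary: j)
  case (Suc n)
  have [measurable]: "(\<lambda>x. orbit N v x n k) \<in> borel_measurable (\<Pi>\<^sub>M i\<in>I. mat_borel N)" if "k < N" for k
    using Suc that by (intro Suc.IH) auto
  have "Suc n \<in> I" using Suc.prems by auto
  then have [measurable]: "(\<lambda>x. x (Suc n) $$ (j, k)) \<in> borel_measurable (\<Pi>\<^sub>M i\<in>I. mat_borel N)" if "k < N" for k
    using measurable_compose[OF measurable_component_singleton[of "Suc n" I "\<lambda>_. mat_borel N"] measurable_entry[of j N k]] Suc.prems that
    by simp
  show ?case by (simp add: app_def) measurable
qed simp

text \<open>Given the first n matrices, the orbit is a fixed vector u, and \<open>step\<close>
  bounds the integral over the next matrix uniformly in u. The general \<phi> and d cover positive
  and negative moments with their respective normalisations.\<close>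

lemma product_moment_chain:
  fixes X :: "nat \<Rightarrow> 'a \<Rightarrow> real mat" and \<phi> :: "real \<Rightarrow> ennreal" and d :: "real mat \<Rightarrow> ennreal"
  assumes M: "prob_space M"
    and X: "\<And>i. i \<ge> 1 \<Longrightarrow> X i \<in> measurable M (mat_borel N)"
    and indep: "prob_space.indep_vars M (\<lambda>_. mat_borel N) X {1..}"
    and \<phi>[measurable]: "\<phi> \<in> borel_measurable borel" and d[measurable]: "d \<in> borel_measurable (mat_borel N)"
    and step: "\<And>i u. i \<ge> 1 \<Longrightarrow> (\<integral>\<^sup>+\<omega>. \<phi> (image_sq N (X i \<omega>) u) * d (X i \<omega>) \<partial>M) \<le> K * \<phi> (sq_sum N u)"
  shows "(\<integral>\<^sup>+\<omega>. \<phi> (sq_sum N (orbit N v (\<lambda>i. X i \<omega>) n)) * (\<Prod>i\<in>{1..n}. d (X i \<omega>)) \<partial>M) \<le> K ^ n * \<phi> (sq_sum N v)"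
\<comment> \<open>The joint law is identified with a product measure over a nonempty index set, so
  the empty product is settled separately.\<close>
proof (cases "n = 0")
  case True
  interpret prob_space M by fact
  show ?thesis using True by (simp add: emeasure_space_1)
next
  case False
  interpret prob_space M by fact
  \<comment> \<open>Nothing is known about \<open>X 0\<close>, whereas the product locale wants a
    measure at every index; hence \<open>max 1 i\<close>.\<close>
  define \<mu> where "\<mu> i = distr M (mat_borel N) (X (max 1 i))" for i
  have sets[measurable_cong, simp]: "sets (\<mu> i) = sets (mat_borel N)" for i by (simp add: \<mu>_def)
  interpret \<mu>: prob_space "\<mu> i" for i
    unfolding \<mu>_def by (rule prob_space_distr) (rule X, simp)
  interpret product_sigma_finite \<mu> ..
  have sets_PiM: "sets (PiM I \<mu>) = sets (\<Pi>\<^sub>M i\<in>I. mat_borel N)" for I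
    by (intro sets_PiM_cong) auto
  define f where "f n x = \<phi> (sq_sum N (orbit N v x n)) * (\<Prod>i\<in>{1..n}. d (x i))" for n x
  have f_meas: "f n \<in> borel_measurable (\<Pi>\<^sub>M i\<in>{1..n}. mat_borel N)" for n
  proof -
    have [measurable]: "(\<lambda>x. orbit N v x n j) \<in> borel_measurable (\<Pi>\<^sub>M i\<in>{1..n}. mat_borel N)" if "j < N" for j
      using that by (intro measurable_orbit) auto
    show ?thesis unfolding f_def sq_sum_def by measurable
  qed
  have f_meas': "f n \<in> borel_measurable (PiM {1..n} \<mu>)" for n
    using f_meas sets_PiM by (simp cong: measurable_cong_sets)
  have bound: "(\<integral>\<^sup>+x. f n x \<partial>PiM {1..n} \<mu>) \<le> K ^ n * \<phi> (sq_sum N v)" for n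
  proof (induction n)
    case 0
    then show ?case by (simp add: f_def PiM_empty)
  next
    case (Suc n)
    have "(\<integral>\<^sup>+x. f (Suc n) x \<partial>PiM {1..Suc n} \<mu>) = (\<integral>\<^sup>+x. \<integral>\<^sup>+y. f (Suc n) (x(Suc n := y)) \<partial>\<mu> (Suc n) \<partial>PiM {1..n} \<mu>)"
      using f_meas'[of "Suc n"] by (simp add: atLeastAtMostSuc_conv product_nn_integral_insert)
    also have "\<dots> \<le> (\<integral>\<^sup>+x. K * f n x \<partial>PiM {1..n} \<mu>)"
    proof (intro nn_integral_mono)
      fix x
      define D where "D = (\<Prod>i\<in>{1..n}. d (x i))"
      have [measurable]: "(\<lambda>y. image_sq N y u) \<in> borel_measurable (mat_borel N)" for u
        unfolding image_sq_def sq_sum_def using measurable_entry by measurable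
      have "f (Suc n) (x(Suc n := y)) = D * (\<phi> (image_sq N y (orbit N v x n)) * d y)" for y
      proof -
        have "orbit N v (x(Suc n := y)) n = orbit N v x n" by (rule orbit_cong) auto
        moreover have "(\<Prod>i\<in>{1..n}. d ((x(Suc n := y)) i)) = D" unfolding D_def by (intro prod.cong) auto
        ultimately show ?thesis by (simp add: f_def image_sq_eq_sq_sum_app mult_ac)
      qed
      then have "(\<integral>\<^sup>+y. f (Suc n) (x(Suc n := y)) \<partial>\<mu> (Suc n)) = D * (\<integral>\<^sup>+y. \<phi> (image_sq N y (orbit N v x n)) * d y \<partial>\<mu> (Suc n))"
        by (simp add: nn_integral_cmult)
      also have "(\<integral>\<^sup>+y. \<phi> (image_sq N y (orbit N v x n)) * d y \<partial>\<mu> (Suc n))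
          = (\<integral>\<^sup>+\<omega>. \<phi> (image_sq N (X (Suc n) \<omega>) (orbit N v x n)) * d (X (Suc n) \<omega>) \<partial>M)"
        unfolding \<mu>_def using X[of "Suc n"] by (simp add: nn_integral_distr)
      also have "D * \<dots> \<le> D * (K * \<phi> (sq_sum N (orbit N v x n)))"
        by (intro mult_left_mono step) auto
      finally show "(\<integral>\<^sup>+y. f (Suc n) (x(Suc n := y)) \<partial>\<mu> (Suc n)) \<le> K * f n x"
        unfolding f_def[of n] D_def by (simp only: mult_ac)
    qed
    also have "\<dots> = K * (\<integral>\<^sup>+x. f n x \<partial>PiM {1..n} \<mu>)"
      using f_meas' by (rule nn_integral_cmult)
    also have "\<dots> \<le> K * (K ^ n * \<phi> (sq_sum N v))" using Suc by (rule mult_left_mono) simp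
    finally show ?case by (simp add: mult.assoc)
  qed
  have "distr M (\<Pi>\<^sub>M i\<in>{1..n}. mat_borel N) (\<lambda>\<omega>. \<lambda>i\<in>{1..n}. X i \<omega>) = (\<Pi>\<^sub>M i\<in>{1..n}. distr M (mat_borel N) (X i))"
    using False X by (intro indep_vars_iff_distr_eq_PiM'[THEN iffD1] indep_vars_subset[OF indep]) auto
  also have "\<dots> = PiM {1..n} \<mu>" by (intro PiM_cong) (auto simp: \<mu>_def max_def)
  finally have distr: "distr M (\<Pi>\<^sub>M i\<in>{1..n}. mat_borel N) (\<lambda>\<omega>. \<lambda>i\<in>{1..n}. X i \<omega>) = PiM {1..n} \<mu>" .
  have "(\<integral>\<^sup>+\<omega>. \<phi> (sq_sum N (orbit N v (\<lambda>i. X i \<omega>) n)) * (\<Prod>i\<in>{1..n}. d (X i \<omega>)) \<partial>M) = (\<integral>\<^sup>+\<omega>. f n (\<lambda>i\<in>{1..n}. X i \<omega>) \<partial>M)"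
  proof (intro nn_integral_cong)
    fix \<omega>
    have "orbit N v (\<lambda>i\<in>{1..n}. X i \<omega>) n = orbit N v (\<lambda>i. X i \<omega>) n" by (rule orbit_cong) auto
    then show "\<phi> (sq_sum N (orbit N v (\<lambda>i. X i \<omega>) n)) * (\<Prod>i\<in>{1..n}. d (X i \<omega>)) = f n (\<lambda>i\<in>{1..n}. X i \<omega>)"
      by (simp add: f_def)
  qed
  also have "\<dots> = (\<integral>\<^sup>+x. f n x \<partial>distr M (\<Pi>\<^sub>M i\<in>{1..n}. mat_borel N) (\<lambda>\<omega>. \<lambda>i\<in>{1..n}. X i \<omega>))"
    using f_meas X by (subst nn_integral_distr) (auto intro!: measurable_restrict)
  also have "\<dots> \<le> K ^ n * \<phi> (sq_sum N v)" unfolding distr by (rule bound)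
  finally show ?thesis .
qed

section \<open>From moments to tail probabilities\<close>

lemma chernoff_tail:
  assumes M: "prob_space M" and u[measurable]: "u \<in> borel_measurable M" and I: "(\<integral>\<^sup>+\<omega>. u \<omega> \<partial>M) \<le> ennreal B" and B: "B \<ge> 0"
    and a: "a > 0"
  shows "measure M {\<omega>\<in>space M. ennreal a \<le> u \<omega>} \<le> B / a"
proof -
  interpret prob_space M by fact
  have "{\<omega>\<in>space M. ennreal a \<le> u \<omega>} = {\<omega>\<in>space M. 1 \<le> ennreal (1 / a) * u \<omega>}"
  proof (intro Collect_cong conj_cong refl iffI)
    fix \<omega> assume "ennreal a \<le> u \<omega>"
    then have "ennreal (1 / a) * ennreal a \<le> ennreal (1 / a) * u \<omega>" by (intro mult_left_mono) auto
    then show "1 \<le> ennreal (1 / a) * u \<omega>" using a by (simp add: ennreal_mult[symmetric])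
  next
    fix \<omega> assume "1 \<le> ennreal (1 / a) * u \<omega>"
    then have "ennreal a * 1 \<le> ennreal a * (ennreal (1 / a) * u \<omega>)" by (intro mult_left_mono) auto
    then show "ennreal a \<le> u \<omega>" using a by (simp add: ennreal_mult[symmetric] mult.assoc[symmetric])
  qed
  also have "emeasure M \<dots> \<le> ennreal (1 / a) * (\<integral>\<^sup>+\<omega>. u \<omega> * indicator (space M) \<omega> \<partial>M)"
    by (rule nn_integral_Markov_inequality) auto
  also have "(\<integral>\<^sup>+\<omega>. u \<omega> * indicator (space M) \<omega> \<partial>M) = (\<integral>\<^sup>+\<omega>. u \<omega> \<partial>M)"
    by (intro nn_integral_cong) simp
  also have "ennreal (1 / a) * \<dots> \<le> ennreal (1 / a) * ennreal B" using I by (rule mult_left_mono) simp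
  also have "\<dots> = ennreal (B / a)" using a B by (simp add: ennreal_mult[symmetric])
  finally show ?thesis using a B by (simp add: emeasure_eq_measure)
qed

text \<open>A deviation upwards makes the k-th power large, one downwards the inverse power. For Y =
  0 the second alternative holds because the inverse is infinite, in agreement with the convention
  of \<open>log_deviates\<close>.\<close>

lemma deviation_dichotomy:
  fixes Y C t :: real
  assumes Y: "Y \<ge> 0" and C: "C > 0" and n: "n \<ge> 1"
    and dev: "log_deviates Y n (ln C / real n) t" and k: "k > 0"
  shows "ennreal (exp (real n * (real k * t))) \<le> ennreal (Y / C) ^ k \<or>
    ennreal (exp (real n * (real k * t))) \<le> inverse (ennreal (Y / C)) ^ k"
proof (cases "Y = 0")
  case True
  then show ?thesis using k by simp
next
  case False
  with Y have Y0: "Y > 0" by simp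
  from dev False have "\<bar>ln Y / real n - ln C / real n\<bar> > t" by (simp add: log_deviates_def)
  also have "ln Y / real n - ln C / real n = ln (Y / C) / real n"
    using Y0 C by (simp add: ln_div diff_divide_distrib)
  finally have "\<bar>ln (Y / C)\<bar> > real n * t" using n by (simp add: field_simps abs_divide)
  then have "real n * t \<le> ln (Y / C) \<or> real n * t \<le> - ln (Y / C)" by linarith
  also have "- ln (Y / C) = ln (inverse (Y / C))" by (rule ln_inverse[symmetric])
  finally consider "real n * t \<le> ln (Y / C)" | "real n * t \<le> ln (inverse (Y / C))" by blast
  then show ?thesis
  proof cases
    case 1
    then have "exp (real n * t) \<le> Y / C" using Y0 C by (simp add: ln_ge_iff)
    then have "exp (real n * t) ^ k \<le> (Y / C) ^ k" by (intro power_mono) auto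
    then show ?thesis using Y0 C by (simp add: exp_of_nat_mult[symmetric] ennreal_power mult_ac)
  next
    case 2
    then have "exp (real n * t) \<le> inverse (Y / C)" using Y0 C by (simp add: ln_ge_iff)
    then have "exp (real n * t) ^ k \<le> inverse (Y / C) ^ k" by (intro power_mono) auto
    moreover have "inverse (ennreal (Y / C)) ^ k = ennreal (inverse (Y / C) ^ k)"
      using Y0 C by (subst inverse_ennreal) (auto simp: ennreal_power)
    moreover have "exp (real n * (real k * t)) = exp (real n * t) ^ k"
      by (simp add: exp_of_nat_mult[symmetric] mult_ac)
    ultimately show ?thesis using Y0 C by simp
  qed
qed

lemma inverse_ennreal_mult_pos:
  fixes y q :: real
  assumes "y \<ge> 0" "q > 0"
  shows "inverse (ennreal (q * y)) = inverse (ennreal q) * inverse (ennreal y)"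
proof (cases "y = 0")
  case True
  then show ?thesis using assms by (simp add: inverse_ennreal ennreal_mult_top)
next
  case False
  then show ?thesis using assms by (simp add: inverse_ennreal ennreal_mult[symmetric])
qed

text \<open>The normalisation \<open>c\<close> is constantly \<open>\<sigma>\<^sup>2\<close> in part (i) and the mean Gram eigenvalue in part (ii).\<close>

lemma log_norm_deviation:
  fixes X :: "nat \<Rightarrow> 'a \<Rightarrow> real mat" and c :: "real mat \<Rightarrow> real"
  assumes M: "prob_space M" and iid: "iid_matrices M N X"
    and c: "c \<in> borel_measurable (mat_borel N)"
    and c_pos: "\<And>i. i \<ge> 1 \<Longrightarrow> AE \<omega> in M. c (X i \<omega>) > 0"
    and up: "\<And>i u. i \<ge> 1 \<Longrightarrow> sq_sum N u > 0 \<Longrightarrow>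
      (\<integral>\<^sup>+\<omega>. ennreal (image_sq N (X i \<omega>) u / (c (X i \<omega>) * sq_sum N u)) ^ k \<partial>M) \<le> ennreal K"
    and low: "\<And>i u. i \<ge> 1 \<Longrightarrow> sq_sum N u > 0 \<Longrightarrow>
      (\<integral>\<^sup>+\<omega>. inverse (ennreal (image_sq N (X i \<omega>) u / (c (X i \<omega>) * sq_sum N u))) ^ k \<partial>M) \<le> ennreal K"
    and K: "K > 0" and k: "k > 0" and n: "n \<ge> 1"
    and v: "v \<in> carrier_vec N" "eucl_norm v = 1"
  shows "measure M {\<omega> \<in> space M. log_deviates ((eucl_norm (mat_product N X n \<omega> *\<^sub>v v))\<^sup>2) n
      ((1 / real n) * (\<Sum>i=1..n. ln (c (X i \<omega>)))) t} \<le> 2 * (K * exp (- (real k * t))) ^ n"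
proof -
  interpret prob_space M by fact
  have X: "\<And>i. i \<ge> 1 \<Longrightarrow> X i \<in> measurable M (mat_borel N)" and indep: "indep_vars (\<lambda>_. mat_borel N) X {1..}"
    using iid by (auto simp: iid_matrices_def)
  note [measurable] = c
  have carrier: "X i \<omega> \<in> carrier_mat N N" if "\<omega> \<in> space M" "i \<ge> 1" for i \<omega>
    using measurable_space[OF X that(1)] that by simp
  have [measurable]: "(\<lambda>\<omega>. image_sq N (X i \<omega>) u) \<in> borel_measurable M" "(\<lambda>\<omega>. c (X i \<omega>)) \<in> borel_measurable M" if "i \<ge> 1" for i u
  proof -
    have "(\<lambda>y. image_sq N y u) \<in> borel_measurable (mat_borel N)"
      unfolding image_sq_def sq_sum_def using measurable_entry by measurable
    then show "(\<lambda>\<omega>. image_sq N (X i \<omega>) u) \<in> borel_measurable M"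
      by (rule measurable_compose[OF X[OF that]])
    show "(\<lambda>\<omega>. c (X i \<omega>)) \<in> borel_measurable M" by (rule measurable_compose[OF X[OF that] c])
  qed
  define w where "w i = v $ i" for i
  define Y where "Y \<omega> = sq_sum N (orbit N w (\<lambda>i. X i \<omega>) n)" for \<omega>
  have [measurable]: "Y \<in> borel_measurable M"
  proof -
    have "(\<lambda>\<omega>. \<lambda>i\<in>{1..}. X i \<omega>) \<in> measurable M (\<Pi>\<^sub>M i\<in>{1..}. mat_borel N)"
      using X by (intro measurable_restrict) auto
    from measurable_compose[OF this measurable_orbit[of n "{1..}" _ N w]]
    have "(\<lambda>\<omega>. orbit N w (\<lambda>i\<in>{1..}. X i \<omega>) n j) \<in> borel_measurable M" if "j < N" for j
      using that by auto
    moreover have "orbit N w (\<lambda>i\<in>{1..}. X i \<omega>) n = orbit N w (\<lambda>i. X i \<omega>) n" for \<omega>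
      by (rule orbit_cong) auto
    ultimately have [measurable]: "(\<lambda>\<omega>. orbit N w (\<lambda>i. X i \<omega>) n j) \<in> borel_measurable M" if "j < N" for j
      using that by simp
    show ?thesis unfolding Y_def sq_sum_def by measurable
  qed
  have Y: "(eucl_norm (mat_product N X n \<omega> *\<^sub>v v))\<^sup>2 = Y \<omega>" if "\<omega> \<in> space M" for \<omega>
    unfolding Y_def w_def using mat_product_orbit(2)[OF v(1), of X \<omega> n] carrier[OF that] eucl_norm_sq_vec by simp
  have w1: "sq_sum N w = 1"
  proof -
    have "v = Matrix.vec N w" using v(1) by (intro eq_vecI) (auto simp: w_def)
    then show ?thesis using eucl_norm_sq_vec[of N w] v(2) by simp
  qed
  define C where "C \<omega> = (\<Prod>i\<in>{1..n}. c (X i \<omega>))" for \<omega>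
  have [measurable]: "C \<in> borel_measurable M" unfolding C_def by measurable
  \<comment> \<open>\<open>product_moment_chain\<close> wants the one-step bound for every vector,
    while the hypotheses \<open>up\<close> and \<open>low\<close> cover only nonzero ones.\<close>
  have zero: "image_sq N A u = 0" if "\<not> sq_sum N u > 0" for A u
  proof -
    have "u i = 0" if "i < N" for i using sq_sum_pos[OF that, of u] \<open>\<not> sq_sum N u > 0\<close> by blast
    then have "app N (\<lambda>i j. A $$ (i, j)) u = (\<lambda>_. 0)" by (simp add: app_def fun_eq_iff)
    then show ?thesis by (simp add: image_sq_eq_sq_sum_app sq_sum_def)
  qed
  have "(\<integral>\<^sup>+\<omega>. ennreal (Y \<omega>) ^ k * (\<Prod>i\<in>{1..n}. ennreal (1 / c (X i \<omega>)) ^ k) \<partial>M) \<le> ennreal K ^ n * ennreal (sq_sum N w) ^ k"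
    unfolding Y_def
  proof (rule product_moment_chain[OF M X indep])
    show "(\<lambda>y::real. ennreal y ^ k) \<in> borel_measurable borel" "(\<lambda>A. ennreal (1 / c A) ^ k) \<in> borel_measurable (mat_borel N)"
      by measurable
    fix i :: nat and u assume i: "i \<ge> 1"
    show "(\<integral>\<^sup>+\<omega>. ennreal (image_sq N (X i \<omega>) u) ^ k * ennreal (1 / c (X i \<omega>)) ^ k \<partial>M) \<le> ennreal K * ennreal (sq_sum N u) ^ k"
    proof (cases "sq_sum N u > 0")
      case True
      have "(\<integral>\<^sup>+\<omega>. ennreal (image_sq N (X i \<omega>) u) ^ k * ennreal (1 / c (X i \<omega>)) ^ k \<partial>M)
        = (\<integral>\<^sup>+\<omega>. ennreal (sq_sum N u) ^ k * ennreal (image_sq N (X i \<omega>) u / (c (X i \<omega>) * sq_sum N u)) ^ k \<partial>M)"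
      proof (intro nn_integral_cong_AE, use c_pos[OF i] in eventually_elim)
        case (elim \<omega>)
        have "ennreal (image_sq N (X i \<omega>) u) * ennreal (1 / c (X i \<omega>)) = ennreal (sq_sum N u) * ennreal (image_sq N (X i \<omega>) u / (c (X i \<omega>) * sq_sum N u))"
          using elim True image_sq_nonneg[of N "X i \<omega>" u] by (simp add: ennreal_mult[symmetric])
        then show ?case by (simp add: power_mult_distrib[symmetric])
      qed
      also have "\<dots> = ennreal (sq_sum N u) ^ k * (\<integral>\<^sup>+\<omega>. ennreal (image_sq N (X i \<omega>) u / (c (X i \<omega>) * sq_sum N u)) ^ k \<partial>M)"
        using i by (intro nn_integral_cmult) measurable
      also have "\<dots> \<le> ennreal (sq_sum N u) ^ k * ennreal K" by (intro mult_left_mono up i True) simp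
      finally show ?thesis by (simp add: mult.commute)
    qed (use k zero in \<open>simp add: zero_power\<close>)
  qed simp
  then have up': "(\<integral>\<^sup>+\<omega>. ennreal (Y \<omega>) ^ k * (\<Prod>i\<in>{1..n}. ennreal (1 / c (X i \<omega>)) ^ k) \<partial>M) \<le> ennreal (K ^ n)"
    using K by (simp add: w1 ennreal_power)
  have "(\<integral>\<^sup>+\<omega>. inverse (ennreal (Y \<omega>)) ^ k * (\<Prod>i\<in>{1..n}. ennreal (c (X i \<omega>)) ^ k) \<partial>M) \<le> ennreal K ^ n * inverse (ennreal (sq_sum N w)) ^ k"
    unfolding Y_def
  proof (rule product_moment_chain[OF M X indep])
    show "(\<lambda>y::real. inverse (ennreal y) ^ k) \<in> borel_measurable borel" "(\<lambda>A. ennreal (c A) ^ k) \<in> borel_measurable (mat_borel N)"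
      by measurable
    fix i :: nat and u assume i: "i \<ge> 1"
    show "(\<integral>\<^sup>+\<omega>. inverse (ennreal (image_sq N (X i \<omega>) u)) ^ k * ennreal (c (X i \<omega>)) ^ k \<partial>M) \<le> ennreal K * inverse (ennreal (sq_sum N u)) ^ k"
    proof (cases "sq_sum N u > 0")
      case True
      have "(\<integral>\<^sup>+\<omega>. inverse (ennreal (image_sq N (X i \<omega>) u)) ^ k * ennreal (c (X i \<omega>)) ^ k \<partial>M)
        = (\<integral>\<^sup>+\<omega>. inverse (ennreal (sq_sum N u)) ^ k * inverse (ennreal (image_sq N (X i \<omega>) u / (c (X i \<omega>) * sq_sum N u))) ^ k \<partial>M)"
      proof (intro nn_integral_cong_AE, use c_pos[OF i] in eventually_elim)
        case (elim \<omega>)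
        let ?a = "image_sq N (X i \<omega>) u" and ?c = "c (X i \<omega>)" and ?s = "sq_sum N u"
        have "?a / (?c * ?s) = inverse (?c * ?s) * ?a" by (simp add: divide_inverse)
        then have "inverse (ennreal (?a / (?c * ?s))) = inverse (ennreal (inverse (?c * ?s))) * inverse (ennreal ?a)"
          using inverse_ennreal_mult_pos[of ?a "inverse (?c * ?s)"] elim True image_sq_nonneg[of N "X i \<omega>" u] by simp
        also have "inverse (ennreal (inverse (?c * ?s))) = ennreal (?c * ?s)"
          using elim True by (subst inverse_ennreal) auto
        finally have "inverse (ennreal ?s) * inverse (ennreal (?a / (?c * ?s))) = (inverse (ennreal ?s) * ennreal ?s) * ennreal ?c * inverse (ennreal ?a)"
          using elim True by (simp add: ennreal_mult mult_ac)
        also have "inverse (ennreal ?s) * ennreal ?s = 1"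
          using True by (simp add: inverse_ennreal ennreal_mult[symmetric])
        finally have "inverse (ennreal ?a) * ennreal ?c = inverse (ennreal ?s) * inverse (ennreal (?a / (?c * ?s)))"
          by (simp add: mult.commute)
        then show ?case by (simp only: power_mult_distrib[symmetric])
      qed
      also have "\<dots> = inverse (ennreal (sq_sum N u)) ^ k * (\<integral>\<^sup>+\<omega>. inverse (ennreal (image_sq N (X i \<omega>) u / (c (X i \<omega>) * sq_sum N u))) ^ k \<partial>M)"
        using i by (intro nn_integral_cmult) measurable
      also have "\<dots> \<le> inverse (ennreal (sq_sum N u)) ^ k * ennreal K" by (intro mult_left_mono low i True) simp
      finally show ?thesis by (simp add: mult.commute)
    next
      case False
      \<comment> \<open>For u = 0 the right-hand side of the negative moment bound is infinite,
        since K is positive.\<close>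
      then have "ennreal (sq_sum N u) = 0" by (simp add: ennreal_neg)
      then show ?thesis using K k by (simp add: ennreal_mult_top)
    qed
  qed simp
  then have low': "(\<integral>\<^sup>+\<omega>. inverse (ennreal (Y \<omega>)) ^ k * (\<Prod>i\<in>{1..n}. ennreal (c (X i \<omega>)) ^ k) \<partial>M) \<le> ennreal (K ^ n)"
    using K by (simp add: w1 ennreal_power)
  have AEc: "AE \<omega> in M. \<forall>i\<in>{1..n}. c (X i \<omega>) > 0"
    using c_pos by (intro AE_finite_allI) auto
  have C_eq: "C \<omega> > 0" "(\<Prod>i\<in>{1..n}. ennreal (c (X i \<omega>)) ^ k) = ennreal (C \<omega>) ^ k"
    "(\<Prod>i\<in>{1..n}. ennreal (1 / c (X i \<omega>)) ^ k) = ennreal (1 / C \<omega>) ^ k"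
    "(\<Sum>i=1..n. ln (c (X i \<omega>))) = ln (C \<omega>)"
    if pos: "\<forall>i\<in>{1..n}. c (X i \<omega>) > 0" for \<omega>
  proof -
    show "C \<omega> > 0" using pos unfolding C_def by (intro prod_pos) auto
    show "(\<Prod>i\<in>{1..n}. ennreal (c (X i \<omega>)) ^ k) = ennreal (C \<omega>) ^ k"
      unfolding C_def prod_power_distrib[symmetric] using pos by (subst prod_ennreal) (auto intro: less_imp_le)
    have "1 / C \<omega> = (\<Prod>i\<in>{1..n}. 1 / c (X i \<omega>))" unfolding C_def by (simp add: prod_dividef)
    then show "(\<Prod>i\<in>{1..n}. ennreal (1 / c (X i \<omega>)) ^ k) = ennreal (1 / C \<omega>) ^ k"
      unfolding prod_power_distrib[symmetric] using pos by (subst prod_ennreal) (auto intro: less_imp_le)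
    show "(\<Sum>i=1..n. ln (c (X i \<omega>))) = ln (C \<omega>)"
      unfolding C_def using pos by (subst ln_prod; fastforce)
  qed
  have Y0: "Y \<omega> \<ge> 0" for \<omega> by (simp add: Y_def sq_sum_nonneg)
  have up'': "(\<integral>\<^sup>+\<omega>. ennreal (Y \<omega> / C \<omega>) ^ k \<partial>M) \<le> ennreal (K ^ n)"
  proof -
    have "(\<integral>\<^sup>+\<omega>. ennreal (Y \<omega> / C \<omega>) ^ k \<partial>M) = (\<integral>\<^sup>+\<omega>. ennreal (Y \<omega>) ^ k * (\<Prod>i\<in>{1..n}. ennreal (1 / c (X i \<omega>)) ^ k) \<partial>M)"
    proof (intro nn_integral_cong_AE, use AEc in eventually_elim)
      case (elim \<omega>)
      have "ennreal (Y \<omega> / C \<omega>) = ennreal (Y \<omega>) * ennreal (1 / C \<omega>)"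
        using Y0[of \<omega>] C_eq(1)[OF elim] by (simp add: ennreal_mult[symmetric])
      then show ?case unfolding C_eq(3)[OF elim] by (simp add: power_mult_distrib)
    qed
    then show ?thesis using up' by simp
  qed
  have low'': "(\<integral>\<^sup>+\<omega>. inverse (ennreal (Y \<omega> / C \<omega>)) ^ k \<partial>M) \<le> ennreal (K ^ n)"
  proof -
    have "(\<integral>\<^sup>+\<omega>. inverse (ennreal (Y \<omega> / C \<omega>)) ^ k \<partial>M) = (\<integral>\<^sup>+\<omega>. inverse (ennreal (Y \<omega>)) ^ k * (\<Prod>i\<in>{1..n}. ennreal (c (X i \<omega>)) ^ k) \<partial>M)"
    proof (intro nn_integral_cong_AE, use AEc in eventually_elim)
      case (elim \<omega>)
      have "inverse (ennreal (Y \<omega> / C \<omega>)) = inverse (ennreal (inverse (C \<omega>))) * inverse (ennreal (Y \<omega>))"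
        using inverse_ennreal_mult_pos[of "Y \<omega>" "inverse (C \<omega>)"] Y0[of \<omega>] C_eq(1)[OF elim]
        by (simp add: divide_inverse mult.commute)
      also have "inverse (ennreal (inverse (C \<omega>))) = ennreal (C \<omega>)"
        using C_eq(1)[OF elim] by (subst inverse_ennreal) auto
      finally show ?case unfolding C_eq(2)[OF elim] by (simp add: power_mult_distrib mult.commute)
    qed
    then show ?thesis using low' by simp
  qed
  let ?a = "exp (real n * (real k * t))"
  let ?A = "{\<omega>\<in>space M. ennreal ?a \<le> ennreal (Y \<omega> / C \<omega>) ^ k}"
  let ?B = "{\<omega>\<in>space M. ennreal ?a \<le> inverse (ennreal (Y \<omega> / C \<omega>)) ^ k}"
  let ?E = "{\<omega> \<in> space M. log_deviates ((eucl_norm (mat_product N X n \<omega> *\<^sub>v v))\<^sup>2) n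
      ((1 / real n) * (\<Sum>i=1..n. ln (c (X i \<omega>)))) t}"
  \<comment> \<open>The inclusion holds only almost everywhere because the factors c (X i) are
    positive only almost surely. Measurability is required of the larger set alone.\<close>
  have "measure M ?E \<le> measure M (?A \<union> ?B)"
  proof (rule finite_measure_mono_AE)
    show "AE \<omega> in M. \<omega> \<in> ?E \<longrightarrow> \<omega> \<in> ?A \<union> ?B"
      using AEc
    proof eventually_elim
      case (elim \<omega>)
      show ?case
      proof
        assume "\<omega> \<in> ?E"
        then have \<omega>: "\<omega> \<in> space M" and "log_deviates (Y \<omega>) n (ln (C \<omega>) / real n) t"
          using Y C_eq(4)[OF elim] by auto
        from deviation_dichotomy[OF Y0 C_eq(1)[OF elim] n this(2) k] \<omega> show "\<omega> \<in> ?A \<union> ?B" by auto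
      qed
    qed
    show "?A \<union> ?B \<in> sets M" by measurable
  qed
  also have "\<dots> \<le> measure M ?A + measure M ?B" by (intro measure_Un_le) measurable
  also have "\<dots> \<le> K ^ n / ?a + K ^ n / ?a"
    using K by (intro add_mono chernoff_tail[OF M _ up''] chernoff_tail[OF M _ low'']) auto
  also have "\<dots> = 2 * (K * exp (- (real k * t))) ^ n"
  proof -
    have "exp (- (real k * t)) ^ n = exp (- (real n * (real k * t)))"
      by (simp add: exp_of_nat_mult[symmetric])
    then show ?thesis by (simp add: power_mult_distrib exp_minus divide_inverse)
  qed
  finally show ?thesis .
qed

subsection \<open>One-step moments and the deviation bounds\<close>

text \<open>The Laplace transform of a chi-square variable with one degree of freedom: the tilted
  density is again Gaussian up to a constant.\<close>

lemma nn_integral_normal_quadratic: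
  fixes \<tau> \<theta> :: real
  assumes \<tau>: "\<tau> > 0" and \<theta>: "1 + \<theta> > 0" and M: "prob_space M"
    and Z: "distributed M lborel Z (normal_density 0 \<tau>)"
  shows "(\<integral>\<^sup>+\<omega>. ennreal (exp (- \<theta> * (Z \<omega> / \<tau>)\<^sup>2 / 2)) \<partial>M) = ennreal ((1 + \<theta>) powr (- (1 / 2)))"
proof -
  have "(\<integral>\<^sup>+\<omega>. ennreal (exp (- \<theta> * (Z \<omega> / \<tau>)\<^sup>2 / 2)) \<partial>M)
      = (\<integral>\<^sup>+z. ennreal (normal_density 0 \<tau> z) * ennreal (exp (- \<theta> * (z / \<tau>)\<^sup>2 / 2)) \<partial>lborel)"
    by (rule distributed_nn_integral[OF Z, symmetric]) measurable
  also have "\<dots> = (\<integral>\<^sup>+z. ennreal (1 / sqrt (2 * pi * \<tau>\<^sup>2)) * ennreal (exp (- ((1 + \<theta>) / \<tau>\<^sup>2 * (z + 0)\<^sup>2) / 2)) \<partial>lborel)"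
  proof (rule nn_integral_cong)
    fix z :: real
    have "exp (- z\<^sup>2 / (2 * \<tau>\<^sup>2)) * exp (- \<theta> * (z / \<tau>)\<^sup>2 / 2) = exp (- ((1 + \<theta>) / \<tau>\<^sup>2 * (z + 0)\<^sup>2) / 2)"
      unfolding mult_exp_exp using \<tau> by (intro arg_cong[of _ _ exp]) (simp add: field_simps)
    then show "ennreal (normal_density 0 \<tau> z) * ennreal (exp (- \<theta> * (z / \<tau>)\<^sup>2 / 2))
        = ennreal (1 / sqrt (2 * pi * \<tau>\<^sup>2)) * ennreal (exp (- ((1 + \<theta>) / \<tau>\<^sup>2 * (z + 0)\<^sup>2) / 2))"
      by (simp add: normal_density_def ennreal_mult[symmetric] mult.assoc)
  qed
  also have "\<dots> = ennreal (1 / sqrt (2 * pi * \<tau>\<^sup>2)) * ennreal (sqrt (2 * pi / ((1 + \<theta>) / \<tau>\<^sup>2)))"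
    using nn_integral_gaussian_shift[of "(1 + \<theta>) / \<tau>\<^sup>2" 0] \<tau> \<theta> by (subst nn_integral_cmult) auto
  also have "\<dots> = ennreal (1 / sqrt (2 * pi * \<tau>\<^sup>2) * sqrt (2 * pi / ((1 + \<theta>) / \<tau>\<^sup>2)))"
    using \<theta> by (intro ennreal_mult[symmetric]) auto
  also have "1 / sqrt (2 * pi * \<tau>\<^sup>2) * sqrt (2 * pi / ((1 + \<theta>) / \<tau>\<^sup>2)) = 1 / sqrt (1 + \<theta>)"
    using \<tau> by (simp add: real_sqrt_divide real_sqrt_mult)
  also have "1 / sqrt (1 + \<theta>) = (1 + \<theta>) powr (- (1 / 2))"
    using \<theta> by (simp add: powr_half_sqrt[symmetric] powr_minus inverse_eq_divide)
  finally show ?thesis .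
qed

text \<open>A sum of independent centred normal variables is normal with the variances added. The
  summands must have positive variance, so the sum runs over the nonzero coordinates of u.\<close>

lemma gaussian_row_normal:
  assumes M: "prob_space M" and G: "gaussian_matrix M N \<sigma> X" and \<sigma>: "\<sigma> > 0" and N: "N \<ge> 1"
    and i: "i < N" and u: "sq_sum N u > 0"
  shows "distributed M lborel (\<lambda>\<omega>. app N (\<lambda>i j. X \<omega> $$ (i, j)) u i) (normal_density 0 (\<sigma> * sqrt (sq_sum N u / real N)))"
proof -
  interpret prob_space M by fact
  have indep: "indep_vars (\<lambda>_. borel) (\<lambda>p \<omega>. X \<omega> $$ p) ({..<N} \<times> {..<N})"
    and normal: "\<And>p. p \<in> {..<N} \<times> {..<N} \<Longrightarrow> distributed M lborel (\<lambda>\<omega>. X \<omega> $$ p) (normal_density 0 (\<sigma> / sqrt (real N)))"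
    using G unfolding gaussian_matrix_def by blast+
  define J where "J = {j. j < N \<and> u j \<noteq> 0}"
  have J: "finite J" "J \<subseteq> {..<N}" by (auto simp: J_def)
  have restrict: "(\<Sum>j\<in>J. f j) = (\<Sum>j<N. f j)" if "\<And>j. j < N \<Longrightarrow> u j = 0 \<Longrightarrow> f j = 0" for f :: "nat \<Rightarrow> real"
    using that by (intro sum.mono_neutral_left) (auto simp: J_def)
  have "J \<noteq> {}"
  proof
    assume "J = {}"
    then have "sq_sum N u = 0" by (auto simp: J_def sq_sum_def)
    with u show False by simp
  qed
  let ?I = "{i} \<times> J"
  have sum_I: "(\<Sum>p\<in>?I. g p) = (\<Sum>j\<in>J. g (i, j))" for g :: "nat \<times> nat \<Rightarrow> real"
  proof -
    have "?I = Pair i ` J" by auto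
    then show ?thesis by (simp add: sum.reindex inj_on_def)
  qed
  let ?s = "\<lambda>p. \<bar>u (snd p)\<bar> * (\<sigma> / sqrt (real N))"
  have "distributed M lborel (\<lambda>\<omega>. \<Sum>p\<in>?I. u (snd p) * X \<omega> $$ p) (normal_density (\<Sum>p\<in>?I. 0) (sqrt (\<Sum>p\<in>?I. (?s p)\<^sup>2)))"
  proof (rule sum_indep_normal)
    show "indep_vars (\<lambda>_. borel) (\<lambda>p \<omega>. u (snd p) * X \<omega> $$ p) ?I"
      using i J by (intro indep_vars_compose2[OF indep_vars_subset[OF indep]]) auto
    show "0 < ?s p" if "p \<in> ?I" for p using that \<sigma> N by (auto simp: J_def)
    show "distributed M lborel (\<lambda>\<omega>. u (snd p) * X \<omega> $$ p) (normal_density 0 (?s p))" if p: "p \<in> ?I" for p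
    proof -
      have "p \<in> {..<N} \<times> {..<N}" "u (snd p) \<noteq> 0" using p i by (auto simp: J_def)
      from normal_density_affine[OF normal[OF this(1)] _ this(2), of 0] \<sigma> N show ?thesis by simp
    qed
  qed (use J \<open>J \<noteq> {}\<close> in auto)
  also have "(\<lambda>\<omega>. \<Sum>p\<in>?I. u (snd p) * X \<omega> $$ p) = (\<lambda>\<omega>. app N (\<lambda>i j. X \<omega> $$ (i, j)) u i)"
  proof
    fix \<omega>
    have "(\<Sum>p\<in>?I. u (snd p) * X \<omega> $$ p) = (\<Sum>j\<in>J. X \<omega> $$ (i, j) * u j)"
      by (simp add: sum_I mult.commute)
    then show "(\<Sum>p\<in>?I. u (snd p) * X \<omega> $$ p) = app N (\<lambda>i j. X \<omega> $$ (i, j)) u i"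
      unfolding app_def by (subst (asm) restrict) auto
  qed
  also have "(\<Sum>p\<in>?I. (?s p)\<^sup>2) = \<sigma>\<^sup>2 * (sq_sum N u / real N)"
  proof -
    have "(\<Sum>p\<in>?I. (?s p)\<^sup>2) = (\<Sum>j\<in>J. (u j)\<^sup>2 * (\<sigma>\<^sup>2 / real N))"
      by (simp add: sum_I power_mult_distrib power_divide)
    also have "\<dots> = sq_sum N u * (\<sigma>\<^sup>2 / real N)"
      unfolding sq_sum_def sum_distrib_right by (rule restrict) simp
    finally show ?thesis by simp
  qed
  also have "sqrt (\<sigma>\<^sup>2 * (sq_sum N u / real N)) = \<sigma> * sqrt (sq_sum N u / real N)"
    unfolding real_sqrt_mult using \<sigma> by simp
  finally show ?thesis by simp
qed

text \<open>Distinct rows use disjoint sets of entries, so the coordinates of X u are independent.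
  After division by their common standard deviation, the sum of squares is chi-square with N degrees
  of freedom and its Laplace transform is a product.\<close>

lemma gaussian_laplace:
  assumes M: "prob_space M" and G: "gaussian_matrix M N \<sigma> X" and \<sigma>: "\<sigma> > 0" and N: "N \<ge> 1"
    and u: "sq_sum N u > 0"
  shows "laplace_dominated M (\<lambda>\<omega>. real N * (image_sq N (X \<omega>) u / (\<sigma>\<^sup>2 * sq_sum N u))) 1 (real N / (2 * 1))"
proof -
  interpret prob_space M by fact
  define \<tau> where "\<tau> = \<sigma> * sqrt (sq_sum N u / real N)"
  have \<tau>: "\<tau> > 0" "\<tau>\<^sup>2 = \<sigma>\<^sup>2 * sq_sum N u / real N" using \<sigma> u N by (auto simp: \<tau>_def power_mult_distrib)
  define Z where "Z i \<omega> = app N (\<lambda>i j. X \<omega> $$ (i, j)) u i" for i \<omega>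
  have normal: "distributed M lborel (Z i) (normal_density 0 \<tau>)" if "i < N" for i
    unfolding Z_def \<tau>_def by (rule gaussian_row_normal[OF M G \<sigma> N that u])
  have Zm[measurable]: "Z i \<in> borel_measurable M" if "i < N" for i
    using distributed_measurable[OF normal[OF that]] by simp
  have Q: "real N * (image_sq N (X \<omega>) u / (\<sigma>\<^sup>2 * sq_sum N u)) = (\<Sum>i<N. (Z i \<omega> / \<tau>)\<^sup>2)" for \<omega>
  proof -
    have "(\<Sum>i<N. (Z i \<omega> / \<tau>)\<^sup>2) = image_sq N (X \<omega>) u / \<tau>\<^sup>2"
      by (simp add: image_sq_eq_sq_sum_app sq_sum_def Z_def power_divide sum_divide_distrib)
    then show ?thesis unfolding \<tau>(2) by simp
  qed
  have indep: "indep_vars (\<lambda>_. borel) (\<lambda>p \<omega>. X \<omega> $$ p) ({..<N} \<times> {..<N})"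
    using G unfolding gaussian_matrix_def by blast
  show ?thesis
    unfolding laplace_dominated_def Q
  proof (intro conjI allI impI ballI)
    fix \<theta> :: real assume \<theta>: "1 + \<theta> * 1 > 0"
    \<comment> \<open>One block of entries per row; independence of the entries passes to functions
      of disjoint blocks.\<close>
    let ?K = "\<lambda>i. {i} \<times> {..<N}"
    let ?Y = "\<lambda>i f. ennreal (exp (- \<theta> * ((\<Sum>j<N. f (i, j) * u j) / \<tau>)\<^sup>2 / 2))"
    have "indep_vars (\<lambda>i. PiM (?K i) (\<lambda>_. borel)) (\<lambda>i \<omega>. restrict (\<lambda>p. X \<omega> $$ p) (?K i)) {..<N}"
      by (rule indep_vars_restrict[OF indep]) (auto simp: disjoint_family_on_def)
    then have "indep_vars (\<lambda>_. borel) (\<lambda>i \<omega>. ?Y i (restrict (\<lambda>p. X \<omega> $$ p) (?K i))) {..<N}"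
    proof (rule indep_vars_compose2)
      fix i
      have [measurable]: "(\<lambda>f. f (i, j)) \<in> borel_measurable (PiM (?K i) (\<lambda>_. borel))" if "j < N" for j
        using that by (intro measurable_component_singleton) auto
      show "?Y i \<in> borel_measurable (PiM (?K i) (\<lambda>_. borel))" by measurable
    qed
    moreover have "(\<lambda>i \<omega>. ?Y i (restrict (\<lambda>p. X \<omega> $$ p) (?K i))) = (\<lambda>i \<omega>. ennreal (exp (- \<theta> * (Z i \<omega> / \<tau>)\<^sup>2 / 2)))"
      by (intro ext) (simp add: Z_def app_def)
    ultimately have ind: "indep_vars (\<lambda>_. borel) (\<lambda>i \<omega>. ennreal (exp (- \<theta> * (Z i \<omega> / \<tau>)\<^sup>2 / 2))) {..<N}"
      by (simp only:)
    have "(\<integral>\<^sup>+\<omega>. ennreal (exp (- \<theta> * (\<Sum>i<N. (Z i \<omega> / \<tau>)\<^sup>2) / 2)) \<partial>M)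
        = (\<integral>\<^sup>+\<omega>. (\<Prod>i<N. ennreal (exp (- \<theta> * (Z i \<omega> / \<tau>)\<^sup>2 / 2))) \<partial>M)"
      by (intro nn_integral_cong) (simp add: prod_ennreal exp_sum[symmetric] sum_distrib_left sum_divide_distrib sum_negf)
    also have "\<dots> = (\<Prod>i<N. \<integral>\<^sup>+\<omega>. ennreal (exp (- \<theta> * (Z i \<omega> / \<tau>)\<^sup>2 / 2)) \<partial>M)"
      by (rule indep_vars_nn_integral[OF _ ind]) auto
    also have "\<dots> = (\<Prod>i<N. ennreal ((1 + \<theta>) powr (- (1 / 2))))"
      using \<theta> \<tau> by (intro prod.cong refl nn_integral_normal_quadratic[OF _ _ M normal]) auto
    also have "\<dots> = ennreal ((1 + \<theta> * 1) powr (- (real N / (2 * 1))))"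
    proof -
      have "((1 + \<theta>) powr (- (1 / 2))) ^ N = (1 + \<theta>) powr (- (real N / 2))"
        using \<theta> by (subst powr_realpow[symmetric]) (auto simp: powr_powr)
      then show ?thesis by (simp add: ennreal_power)
    qed
    finally show "(\<integral>\<^sup>+\<omega>. ennreal (exp (- \<theta> * (\<Sum>i<N. (Z i \<omega> / \<tau>)\<^sup>2) / 2)) \<partial>M) \<le> ennreal ((1 + \<theta> * 1) powr (- (real N / (2 * 1))))"
      by simp
  next
    show "(\<lambda>\<omega>. \<Sum>i<N. (Z i \<omega> / \<tau>)\<^sup>2) \<in> borel_measurable M" by measurable
  qed (auto intro: sum_nonneg)
qed

text \<open>The constant of \<open>laplace_ratio_moments\<close>. The Gaussian case is fitted to it
  with b = 1, so that one choice of the moment order serves both parts.\<close>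

definition moment_bound :: "real \<Rightarrow> nat \<Rightarrow> nat \<Rightarrow> real" where
  "moment_bound b N k = exp (6 * b * (real k)\<^sup>2 / (real N * (1 - 4 * b * real k / real N)))"

text \<open>The denominator is deterministic, so no Cauchy-Schwarz step occurs and the moments of
  order k are used directly. The resulting coefficients 1 and 2 are relaxed to 6.\<close>

lemma gaussian_moments:
  assumes M: "prob_space M" and G: "gaussian_matrix M N \<sigma> X" and \<sigma>: "\<sigma> > 0" and N: "N \<ge> 1"
    and u: "sq_sum N u > 0" and k: "k > 0" "4 * real k < real N"
  shows "(\<integral>\<^sup>+\<omega>. ennreal (image_sq N (X \<omega>) u / (\<sigma>\<^sup>2 * sq_sum N u)) ^ k \<partial>M) \<le> ennreal (moment_bound 1 N k)"
    and "(\<integral>\<^sup>+\<omega>. inverse (ennreal (image_sq N (X \<omega>) u / (\<sigma>\<^sup>2 * sq_sum N u))) ^ k \<partial>M) \<le> ennreal (moment_bound 1 N k)"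
proof -
  note L = gaussian_laplace[OF M G \<sigma> N u]
  define c where "c = (real k)\<^sup>2 / (real N * (1 - 4 * real k / real N))"
  have den: "0 < real N * (1 - 4 * real k / real N)" using N k by (simp add: field_simps)
  have le: "(real k)\<^sup>2 / (real N * (1 - 2 * real k / real N)) \<le> c"
  proof -
    have "real N * (1 - 4 * real k / real N) \<le> real N * (1 - 2 * real k / real N)"
      by (intro mult_left_mono diff_left_mono divide_right_mono) auto
    from divide_left_mono[OF this _ mult_pos_pos[OF less_le_trans[OF den this] den]]
    show ?thesis unfolding c_def by simp
  qed
  have c: "c \<ge> 0" unfolding c_def using den by (intro divide_nonneg_pos) auto
  have K: "moment_bound 1 N k = exp (6 * c)" by (simp add: moment_bound_def c_def)
  have N0: "real N > 0" using N by simp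
  have "(\<integral>\<^sup>+\<omega>. ennreal (image_sq N (X \<omega>) u / (\<sigma>\<^sup>2 * sq_sum N u)) ^ k \<partial>M) \<le> ennreal (exp (1 * ((real k)\<^sup>2 / (real N * (1 - 2 * real k / real N)))))"
    using laplace_power_moment[OF L, of k] N0 k by simp
  also have "\<dots> \<le> ennreal (moment_bound 1 N k)" unfolding K using le c by (intro ennreal_leI) simp
  finally show "(\<integral>\<^sup>+\<omega>. ennreal (image_sq N (X \<omega>) u / (\<sigma>\<^sup>2 * sq_sum N u)) ^ k \<partial>M) \<le> ennreal (moment_bound 1 N k)" .
  have "(\<integral>\<^sup>+\<omega>. inverse (ennreal (image_sq N (X \<omega>) u / (\<sigma>\<^sup>2 * sq_sum N u))) ^ k \<partial>M) \<le> ennreal (exp (2 * ((real k)\<^sup>2 / (real N * (1 - 2 * real k / real N)))))"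
    using laplace_inverse_power_moment[OF M L, of k] N0 k by simp
  also have "\<dots> \<le> ennreal (moment_bound 1 N k)" unfolding K using le c by (intro ennreal_leI) simp
  finally show "(\<integral>\<^sup>+\<omega>. inverse (ennreal (image_sq N (X \<omega>) u / (\<sigma>\<^sup>2 * sq_sum N u))) ^ k \<partial>M) \<le> ennreal (moment_bound 1 N k)" .
qed

lemma rotationally_invariant_moments:
  assumes M: "prob_space M" and X: "X \<in> measurable M (mat_borel N)" and rot: "rotationally_invariant M N X"
    and N: "N \<ge> 1" and b: "AE \<omega> in M. \<forall>s\<in>#gram_eigenvalues (X \<omega>). s \<le> b * mean_gram_eigenvalue (X \<omega>)"
    and s: "AE \<omega> in M. mean_gram_eigenvalue (X \<omega>) > 0"
    and u: "sq_sum N u > 0" and k: "k > 0" "4 * b * real k < real N"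
  shows "(\<integral>\<^sup>+\<omega>. ennreal (image_sq N (X \<omega>) u / (mean_gram_eigenvalue (X \<omega>) * sq_sum N u)) ^ k \<partial>M) \<le> ennreal (moment_bound b N k)"
    and "(\<integral>\<^sup>+\<omega>. inverse (ennreal (image_sq N (X \<omega>) u / (mean_gram_eigenvalue (X \<omega>) * sq_sum N u))) ^ k \<partial>M) \<le> ennreal (moment_bound b N k)"
proof -
  have AE: "AE \<omega> in M. X \<omega> \<in> carrier_mat N N"
    using measurable_space[OF X] by (intro AE_I2) simp
  have "AE \<omega> in M. (\<integral>\<^sup>+g. ennreal (gain N (X \<omega>) g) ^ k \<partial>std_gauss N) \<le> ennreal (moment_bound b N k)"
    using AE b s unfolding moment_bound_def by eventually_elim (rule gain_moments(1)[OF _ N _ _ k])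
  from rotational_invariance_average[OF M X rot N _ this u]
  show "(\<integral>\<^sup>+\<omega>. ennreal (image_sq N (X \<omega>) u / (mean_gram_eigenvalue (X \<omega>) * sq_sum N u)) ^ k \<partial>M) \<le> ennreal (moment_bound b N k)"
    unfolding gain_def by measurable
  have "AE \<omega> in M. (\<integral>\<^sup>+g. inverse (ennreal (gain N (X \<omega>) g)) ^ k \<partial>std_gauss N) \<le> ennreal (moment_bound b N k)"
    using AE b s unfolding moment_bound_def by eventually_elim (rule gain_moments(2)[OF _ N _ _ k])
  from rotational_invariance_average[OF M X rot N _ this u]
  show "(\<integral>\<^sup>+\<omega>. inverse (ennreal (image_sq N (X \<omega>) u / (mean_gram_eigenvalue (X \<omega>) * sq_sum N u))) ^ k \<partial>M) \<le> ennreal (moment_bound b N k)"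
    unfolding gain_def by measurable
qed

text \<open>The order \<open>k\<close> is chosen with \<open>b * k / (N * t)\<close> between \<open>1/16\<close> and \<open>1/12\<close>, around the minimiser of
  the exponent \<open>6 * b * k\<^sup>2 / N - k * t\<close>; the width of the window leaves room for an integer.\<close>

lemma moment_order_exists:
  fixes b t :: real
  assumes b: "b \<ge> 1" and t: "0 < t" "t < 1 / 4" and N: "real N \<ge> 48 * b / t"
  obtains k where "k > 0" "4 * b * real k < real N"
    "moment_bound b N k * exp (- (real k * t)) \<le> exp (- (1 / (32 * b\<^sup>2)) * real N * t\<^sup>2)"
proof -
  \<comment> \<open>The lower end of the window, rounded up. As N t / (48 b) is at least 1, rounding
    stays below the upper end: 1/16 + 1/48 = 1/12.\<close>
  define k where "k = nat \<lceil>real N * t / (16 * b)\<rceil>"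
  have "48 * b / t > 0" using b t by simp
  with N have N0: "real N > 0" by linarith
  have pos: "real N * t / (16 * b) > 0" using N0 t b by simp
  have k1: "real N * t / (16 * b) \<le> real k" unfolding k_def by linarith
  have "real k \<le> real N * t / (16 * b) + 1" unfolding k_def using pos by linarith
  also have "1 \<le> real N * t / (48 * b)" using N t b by (simp add: field_simps)
  finally have k2: "real k \<le> real N * t / (12 * b)" using b by (simp add: field_simps)
  define a where "a = b * real k / (real N * t)"
  have a: "1 / 16 \<le> a" "a \<le> 1 / 12" using k1 k2 b N0 t by (simp_all add: a_def field_simps)
  have k_eq: "real k = a * (real N * t) / b" using b N0 t by (simp add: a_def)
  have x: "4 * b * real k / real N = 4 * a * t" using b N0 by (simp add: k_eq)
  \<comment> \<open>From a <= 1/12 and t < 1/4 the correction 4 a t is at most 1/12; hence the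
    denominator 11/12 and the factor 6 / (11/12) = 72/11.\<close>
  have "4 * a * t \<le> 4 * (1 / 12) * (1 / 4)" using a t by (intro mult_mono) auto
  then have den: "1 - 4 * a * t \<ge> 11 / 12" by simp
  show ?thesis
  proof (rule that)
    show "k > 0" using k1 pos by linarith
    have "4 * b * real k / real N < 1" unfolding x using den by linarith
    then show "4 * b * real k < real N" using N0 by (simp add: field_simps)
    have "6 * b * (real k)\<^sup>2 / (real N * (1 - 4 * b * real k / real N)) \<le> 6 * b * (real k)\<^sup>2 / (real N * (11 / 12))"
      unfolding x using den N0 b by (intro divide_left_mono mult_left_mono mult_pos_pos) auto
    also have "\<dots> = 72 / 11 * a\<^sup>2 * (real N * t\<^sup>2 / b)"
      using b N0 t by (simp add: k_eq power2_eq_square field_simps)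
    finally have "6 * b * (real k)\<^sup>2 / (real N * (1 - 4 * b * real k / real N)) \<le> 72 / 11 * a\<^sup>2 * (real N * t\<^sup>2 / b)" .
    moreover have "real k * t = a * (real N * t\<^sup>2 / b)" by (simp add: k_eq power2_eq_square)
    ultimately have "6 * b * (real k)\<^sup>2 / (real N * (1 - 4 * b * real k / real N)) - real k * t
        \<le> (72 / 11 * a\<^sup>2 - a) * (real N * t\<^sup>2 / b)"
      unfolding left_diff_distrib by linarith
    also have "\<dots> \<le> (- (1 / 32)) * (real N * t\<^sup>2 / b)"
    proof (rule mult_right_mono)
      \<comment> \<open>The product is nonnegative because a lies in the window; this replaces a^2
        by a linear function of a, and what remains is linear arithmetic.\<close>
      have "(a - 1 / 16) * (1 / 12 - a) \<ge> 0" using a by (intro mult_nonneg_nonneg) auto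
      then have "a\<^sup>2 \<le> 7 / 48 * a - 1 / 192" by (simp add: power2_eq_square algebra_simps)
      then show "72 / 11 * a\<^sup>2 - a \<le> - (1 / 32)" using a by linarith
    qed (use N0 b in auto)
    \<comment> \<open>The argument yields the rate 1 / (32 b); since b is at least 1, it implies the
      rate with b squared.\<close>
    also have "\<dots> \<le> - (1 / (32 * b\<^sup>2)) * real N * t\<^sup>2"
    proof -
      have "real N * t\<^sup>2 / (32 * b\<^sup>2) \<le> real N * t\<^sup>2 / (32 * b)"
        using b N0 self_le_power[of b 2] by (intro divide_left_mono) auto
      then show ?thesis by simp
    qed
    finally show "moment_bound b N k * exp (- (real k * t)) \<le> exp (- (1 / (32 * b\<^sup>2)) * real N * t\<^sup>2)"
      unfolding moment_bound_def mult_exp_exp by simp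
  qed
qed

section \<open>Assembly of the deviation bounds\<close>

lemma dimension_threshold:
  fixes r :: real obtains N1 :: nat where "N1 \<ge> 1" "\<And>N. N \<ge> N1 \<Longrightarrow> real N \<ge> r"
proof (rule that[of "max 1 (nat \<lceil>r\<rceil>)"])
  show "real N \<ge> r" if "N \<ge> max 1 (nat \<lceil>r\<rceil>)" for N using that by linarith
qed simp

text \<open>The moment order depends on N, b and t but not on n, so the per-step factor is raised to
  the power n and the threshold for N is uniform in n.\<close>

lemma deviation_probability:
  fixes X :: "nat \<Rightarrow> 'a \<Rightarrow> real mat" and c :: "real mat \<Rightarrow> real"
  assumes "prob_space M" "iid_matrices M N X" "c \<in> borel_measurable (mat_borel N)"
    and "\<And>i. i \<ge> 1 \<Longrightarrow> AE \<omega> in M. c (X i \<omega>) > 0"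
    and "\<And>i u k. i \<ge> 1 \<Longrightarrow> sq_sum N u > 0 \<Longrightarrow> k > 0 \<Longrightarrow> 4 * b * real k < real N \<Longrightarrow>
      (\<integral>\<^sup>+\<omega>. ennreal (image_sq N (X i \<omega>) u / (c (X i \<omega>) * sq_sum N u)) ^ k \<partial>M) \<le> ennreal (moment_bound b N k)"
    and "\<And>i u k. i \<ge> 1 \<Longrightarrow> sq_sum N u > 0 \<Longrightarrow> k > 0 \<Longrightarrow> 4 * b * real k < real N \<Longrightarrow>
      (\<integral>\<^sup>+\<omega>. inverse (ennreal (image_sq N (X i \<omega>) u / (c (X i \<omega>) * sq_sum N u))) ^ k \<partial>M) \<le> ennreal (moment_bound b N k)"
    and b: "b \<ge> 1" and t: "0 < t" "t < 1 / 4" and N: "real N \<ge> 48 * b / t"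
    and n: "n \<ge> 1" and v: "v \<in> carrier_vec N" "eucl_norm v = 1"
  shows "measure M {\<omega> \<in> space M. log_deviates ((eucl_norm (mat_product N X n \<omega> *\<^sub>v v))\<^sup>2) n
      ((1 / real n) * (\<Sum>i=1..n. ln (c (X i \<omega>)))) t} \<le> 2 * exp (- (1 / (32 * b\<^sup>2)) * real N * real n * t\<^sup>2)"
proof -
  obtain k where k: "k > 0" "4 * b * real k < real N"
    "moment_bound b N k * exp (- (real k * t)) \<le> exp (- (1 / (32 * b\<^sup>2)) * real N * t\<^sup>2)"
    using moment_order_exists[OF b t N] by blast
  have "measure M {\<omega> \<in> space M. log_deviates ((eucl_norm (mat_product N X n \<omega> *\<^sub>v v))\<^sup>2) n
      ((1 / real n) * (\<Sum>i=1..n. ln (c (X i \<omega>)))) t} \<le> 2 * (moment_bound b N k * exp (- (real k * t))) ^ n"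
    using k by (intro log_norm_deviation assms) (auto simp: moment_bound_def)
  also have "\<dots> \<le> 2 * exp (- (1 / (32 * b\<^sup>2)) * real N * t\<^sup>2) ^ n"
    using k(3) by (intro mult_left_mono power_mono) (auto simp: moment_bound_def)
  also have "exp (- (1 / (32 * b\<^sup>2)) * real N * t\<^sup>2) ^ n = exp (- (1 / (32 * b\<^sup>2)) * real N * real n * t\<^sup>2)"
    by (simp add: exp_of_nat_mult[symmetric] mult_ac)
  finally show ?thesis .
qed

lemma eucl_norm_nonneg: "eucl_norm v \<ge> 0"
  by (simp add: eucl_norm_def scalar_prod_def sum_nonneg)

text \<open>Squaring doubles the logarithm and hence the deviation; this is how the unsquared norm
  of part (i) is reached. Both sides hold when y = 0.\<close>

lemma log_deviates_sq:
  assumes "y \<ge> 0" "\<sigma> > 0" "n \<ge> 1"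
  shows "log_deviates (y\<^sup>2) n ((1 / real n) * (\<Sum>i=1..n. ln (\<sigma>\<^sup>2))) (2 * t) \<longleftrightarrow> log_deviates y n (ln \<sigma>) t"
proof (cases "y = 0")
  case False
  then have eq: "ln (y\<^sup>2) / real n - (1 / real n) * (\<Sum>i=1..n. ln (\<sigma>\<^sup>2)) = 2 * (ln y / real n - ln \<sigma>)"
    using assms by (simp add: ln_realpow field_simps)
  have double: "\<bar>2 * z\<bar> > 2 * t \<longleftrightarrow> \<bar>z\<bar> > t" for z :: real by (simp add: abs_mult)
  then show ?thesis unfolding log_deviates_def eq double using False by (simp only: zero_eq_power2)
qed (simp add: log_deviates_def)

text \<open>The definition through roots of a polynomial hides measurability; the formula in the
  entries shows it.\<close>

lemma measurable_mean_gram_eigenvalue: "mean_gram_eigenvalue \<in> borel_measurable (mat_borel N)"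
proof -
  have "(\<lambda>A. (\<Sum>i<N. \<Sum>j<N. (A $$ (i, j))\<^sup>2) / real N) \<in> borel_measurable (mat_borel N)"
    using measurable_entry by measurable
  then show ?thesis by (subst measurable_cong) (auto simp: mean_gram_eigenvalue_entries)
qed

theorem proposition3:
  fixes M :: "nat \<Rightarrow> 'a measure"
    and X :: "nat \<Rightarrow> nat \<Rightarrow> 'a \<Rightarrow> real mat"
  assumes prob: "\<And>N. N \<ge> 1 \<Longrightarrow> prob_space (M N)"
    and iid: "\<And>N. N \<ge> 1 \<Longrightarrow> iid_matrices (M N) N (X N)"
  shows
    "(\<forall>\<sigma>>0. (\<forall>N\<ge>1. \<forall>i\<ge>1. gaussian_matrix (M N) N \<sigma> (X N i)) \<longrightarrow>
        (\<exists>t0>0. \<forall>t. 0 < t \<and> t < t0 \<longrightarrow>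
          (\<exists>N1\<ge>1. \<forall>N\<ge>N1. \<forall>v\<in>carrier_vec N. eucl_norm v = 1 \<longrightarrow> (\<forall>n\<ge>1.
             measure (M N) {\<omega> \<in> space (M N).
                log_deviates (eucl_norm (mat_product N (X N) n \<omega> *\<^sub>v v)) n (ln \<sigma>) t}
             \<le> 2 * exp (- (1 / 8) * real N * real n * t\<^sup>2)))))
     \<and>
     (\<forall>b::real.
        (\<forall>N\<ge>1. \<forall>i\<ge>1. rotationally_invariant (M N) N (X N i)) \<and>
        (\<forall>N\<ge>1. \<forall>i\<ge>1. AE \<omega> in M N. \<forall>s\<in>#gram_eigenvalues (X N i \<omega>).
            s \<le> b * mean_gram_eigenvalue (X N i \<omega>)) \<and>
        (\<forall>N\<ge>1. \<forall>i\<ge>1. AE \<omega> in M N. mean_gram_eigenvalue (X N i \<omega>) > 0) \<longrightarrow>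
        (\<forall>t. 0 < t \<and> t < 1 / 4 \<longrightarrow>
          (\<exists>N1\<ge>1. \<forall>N\<ge>N1. \<forall>v\<in>carrier_vec N. eucl_norm v = 1 \<longrightarrow> (\<forall>n\<ge>1.
             measure (M N) {\<omega> \<in> space (M N).
                log_deviates ((eucl_norm (mat_product N (X N) n \<omega> *\<^sub>v v))\<^sup>2) n
                  ((1 / real n) * (\<Sum>i=1..n. ln (mean_gram_eigenvalue (X N i \<omega>)))) t}
             \<le> 2 * exp (- (1 / (32 * b\<^sup>2)) * real N * real n * t\<^sup>2)))))"
proof (intro conjI allI impI)
  fix \<sigma> :: real assume \<sigma>: "\<sigma> > 0" and G: "\<forall>N\<ge>1. \<forall>i\<ge>1. gaussian_matrix (M N) N \<sigma> (X N i)"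
  show "\<exists>t0>0. \<forall>t. 0 < t \<and> t < t0 \<longrightarrow>
          (\<exists>N1\<ge>1. \<forall>N\<ge>N1. \<forall>v\<in>carrier_vec N. eucl_norm v = 1 \<longrightarrow> (\<forall>n\<ge>1.
             measure (M N) {\<omega> \<in> space (M N).
                log_deviates (eucl_norm (mat_product N (X N) n \<omega> *\<^sub>v v)) n (ln \<sigma>) t}
             \<le> 2 * exp (- (1 / 8) * real N * real n * t\<^sup>2)))"
  \<comment> \<open>The squared version is applied at 2 t, which has to stay below 1/4.\<close>
  proof (intro exI[of _ "1 / 8"] conjI allI impI)
    fix t :: real assume "0 < t \<and> t < 1 / 8"
    then have t: "0 < 2 * t" "2 * t < 1 / 4" by auto
    obtain N1 :: nat where N1: "N1 \<ge> 1" "\<And>N. N \<ge> N1 \<Longrightarrow> real N \<ge> 48 * 1 / (2 * t)"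
      using dimension_threshold by blast
    show "\<exists>N1\<ge>1. \<forall>N\<ge>N1. \<forall>v\<in>carrier_vec N. eucl_norm v = 1 \<longrightarrow> (\<forall>n\<ge>1.
             measure (M N) {\<omega> \<in> space (M N).
                log_deviates (eucl_norm (mat_product N (X N) n \<omega> *\<^sub>v v)) n (ln \<sigma>) t}
             \<le> 2 * exp (- (1 / 8) * real N * real n * t\<^sup>2))"
    proof (intro exI[of _ N1] conjI allI impI ballI)
      fix N n :: nat and v assume N: "N1 \<le> N" and v: "v \<in> carrier_vec N" "eucl_norm v = 1" and n: "1 \<le> n"
      have N': "N \<ge> 1" using N N1 by simp
      \<comment> \<open>The normalisation is the constant \<sigma> squared and b = 1; the exponent
        (2 t)^2 / 32 is t^2 / 8.\<close>
      have "measure (M N) {\<omega> \<in> space (M N). log_deviates ((eucl_norm (mat_product N (X N) n \<omega> *\<^sub>v v))\<^sup>2) n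
          ((1 / real n) * (\<Sum>i=1..n. ln (\<sigma>\<^sup>2))) (2 * t)}
        \<le> 2 * exp (- (1 / (32 * 1\<^sup>2)) * real N * real n * (2 * t)\<^sup>2)"
        using N1(2)[OF N] t n v N' prob iid \<sigma> G
        by (intro deviation_probability gaussian_moments) auto
      then show "measure (M N) {\<omega> \<in> space (M N). log_deviates (eucl_norm (mat_product N (X N) n \<omega> *\<^sub>v v)) n (ln \<sigma>) t}
          \<le> 2 * exp (- (1 / 8) * real N * real n * t\<^sup>2)"
        unfolding log_deviates_sq[OF eucl_norm_nonneg \<sigma> n] by (simp add: power_mult_distrib mult_ac)
    qed (rule N1)
  qed simp
next
  fix b t :: real
  assume H: "(\<forall>N\<ge>1. \<forall>i\<ge>1. rotationally_invariant (M N) N (X N i)) \<and>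
        (\<forall>N\<ge>1. \<forall>i\<ge>1. AE \<omega> in M N. \<forall>s\<in>#gram_eigenvalues (X N i \<omega>).
            s \<le> b * mean_gram_eigenvalue (X N i \<omega>)) \<and>
        (\<forall>N\<ge>1. \<forall>i\<ge>1. AE \<omega> in M N. mean_gram_eigenvalue (X N i \<omega>) > 0)"
    and "0 < t \<and> t < 1 / 4"
  then have t: "0 < t" "t < 1 / 4" by auto
  have rot: "rotationally_invariant (M N) N (X N i)"
    and le: "AE \<omega> in M N. \<forall>s\<in>#gram_eigenvalues (X N i \<omega>). s \<le> b * mean_gram_eigenvalue (X N i \<omega>)"
    and pos: "AE \<omega> in M N. mean_gram_eigenvalue (X N i \<omega>) > 0" if "N \<ge> 1" "i \<ge> 1" for N i
    using H that by blast+
  have X: "X N i \<in> measurable (M N) (mat_borel N)" if "N \<ge> 1" "i \<ge> 1" for N i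
    using iid[OF that(1)] that(2) by (auto simp: iid_matrices_def)
  \<comment> \<open>The theorem allows any real b, but the largest eigenvalue is at least the mean.
    One sample already shows it: a constant statement that holds almost surely in a probability
    space is true.\<close>
  have b: "b \<ge> 1"
  proof -
    interpret prob_space "M 1" by (rule prob) simp
    have "AE \<omega> in M 1. X 1 1 \<omega> \<in> carrier_mat 1 1"
      using measurable_space[OF X[of 1 1]] by (intro AE_I2) simp
    then have "AE \<omega> in M 1. b \<ge> 1"
      using le[OF order.refl order.refl] pos[OF order.refl order.refl]
      by eventually_elim (rule gram_det_bound(1)[of _ 1]; simp)
    then show ?thesis by simp
  qed
  obtain N1 :: nat where N1: "N1 \<ge> 1" "\<And>N. N \<ge> N1 \<Longrightarrow> real N \<ge> 48 * b / t"
    using dimension_threshold by blast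
  show "\<exists>N1\<ge>1. \<forall>N\<ge>N1. \<forall>v\<in>carrier_vec N. eucl_norm v = 1 \<longrightarrow> (\<forall>n\<ge>1.
             measure (M N) {\<omega> \<in> space (M N).
                log_deviates ((eucl_norm (mat_product N (X N) n \<omega> *\<^sub>v v))\<^sup>2) n
                  ((1 / real n) * (\<Sum>i=1..n. ln (mean_gram_eigenvalue (X N i \<omega>)))) t}
             \<le> 2 * exp (- (1 / (32 * b\<^sup>2)) * real N * real n * t\<^sup>2))"
  proof (intro exI[of _ N1] conjI allI impI ballI)
    fix N n :: nat and v assume N: "N1 \<le> N" and v: "v \<in> carrier_vec N" "eucl_norm v = 1" and n: "1 \<le> n"
    have N': "N \<ge> 1" using N N1 by simp
    show "measure (M N) {\<omega> \<in> space (M N).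
                log_deviates ((eucl_norm (mat_product N (X N) n \<omega> *\<^sub>v v))\<^sup>2) n
                  ((1 / real n) * (\<Sum>i=1..n. ln (mean_gram_eigenvalue (X N i \<omega>)))) t}
             \<le> 2 * exp (- (1 / (32 * b\<^sup>2)) * real N * real n * t\<^sup>2)"
      using N1(2)[OF N] t b n v N' prob iid rot le pos X
      by (intro deviation_probability measurable_mean_gram_eigenvalue rotationally_invariant_moments) auto
  qed (rule N1)
qed

end
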